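(* $$\delta_1=\deg_{x_1}g=\deg_{\{y_1,y_2\}}\Big(\operatorname{PP}_{\{d,k\}}\big(\operatorname{Res}_{y_3}(F(\bar y_H),S(\bar y_H,d,k))\big)\Big).$$
   Context: Standing assumptions and notation. $f(y_1,y_2)\in\mathbb C[y_1,y_2]$ is an irreducible polynomial of degree $n$ defining an affine plane curve $\mathcal C\subset\mathbb C^2$; $\mathcal C$ is not a line, and $f$ does not divide $f_1^2+f_2^2$, where $f_i=\partial f/\partial y_i$. Write $\bar y=(y_1,y_2)$, $\bar x=(x_1,x_2)$, and let $d,u$ be further variables. Put $b(\bar y,\bar x,d)=(x_1-y_1)^2+(x_2-y_2)^2-d^2$, $n(\bar y,\bar x)=-f_2(\bar y)(x_1-y_1)+f_1(\bar y)(x_2-y_2)$, $w(\bar y,u)=u(f_1^2(\bar y)+f_2^2(\bar y))-1$. Let $\Omega(d)\subset\mathbb C^6$ be the common zero set of $f,b,n,w$ in the variables $(\bar y,\bar x,d,u)$. The generic offset $\mathcal O_d(\mathcal C)\subset\mathbb C^3$ is the Zariski closure of the projection of $\Omega(d)$ to the $(\bar x,d)$-coordinates (it is a surface). The generic offset equation $g(x_1,x_2,d)\in\mathbb C[\bar x,d]$ is a square-free polynomial defining the surface $\mathcal O_d(\mathcal C)$, normalized to have no factor of positive degree lying in $\mathbb C[d]$ (it is determined up to a nonzero constant factor). $F(y_1,y_2,y_3)=y_3^nf(y_1/y_3,y_2/y_3)$, $F_i=\partial F/\partial y_i$, $\bar y_H=(y_1,y_2,y_3)$, and $S(\bar y_H,d,k)=(F_1^2+F_2^2)(y_2-ky_3)^2-F_2^2y_3^2d^2\in\mathbb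 C[y_1,y_2,y_3,d,k]$. $\operatorname{Res}_{y_3}$ is the resultant with respect to $y_3$; $\operatorname{PP}_{\{d,k\}}$ is the primitive part with respect to the variables $d,k$ (division by the gcd of the coefficients as a polynomial in $d,k$); $\deg_{\{y_1,y_2\}}$ is the total degree in $y_1,y_2$. *)

theory Defs
  imports "HOL-Library.Poly_Mapping" "HOL-Computational_Algebra.Polynomial"
    "HOL-Computational_Algebra.Factorial_Ring" "Subresultants.Resultant_Prelim"
begin

type_synonym mpoly = "(nat \<Rightarrow>\<^sub>0 nat) \<Rightarrow>\<^sub>0 complex"

definition mVar :: "nat \<Rightarrow> mpoly" where
  "mVar i = Poly_Mapping.single (Poly_Mapping.single i 1) 1"

definition mConst :: "complex \<Rightarrow> mpoly" where
  "mConst c = Poly_Mapping.single 0 c"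

definition mvars :: "mpoly \<Rightarrow> nat set" where
  "mvars p = \<Union> (Poly_Mapping.keys ` Poly_Mapping.keys p)"

definition meval :: "mpoly \<Rightarrow> (nat \<Rightarrow> complex) \<Rightarrow> complex" where
  "meval p a = (\<Sum>m\<in>Poly_Mapping.keys p.
      Poly_Mapping.lookup p m * (\<Prod>i\<in>Poly_Mapping.keys m. a i ^ Poly_Mapping.lookup m i))"

definition mdegV :: "nat set \<Rightarrow> mpoly \<Rightarrow> nat" where
  "mdegV V p = Max (insert 0 ((\<lambda>m. \<Sum>i\<in>V. Poly_Mapping.lookup m i) ` Poly_Mapping.keys p))"

definition mtdeg :: "mpoly \<Rightarrow> nat" where
  "mtdeg p = Max (insert 0 ((\<lambda>m. \<Sum>i\<in>Poly_Mapping.keys m. Poly_Mapping.lookup m i) ` Poly_Mapping.keys p))"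

definition mpderiv :: "nat \<Rightarrow> mpoly \<Rightarrow> mpoly" where
  "mpderiv i p = (\<Sum>m\<in>Poly_Mapping.keys p.
      Poly_Mapping.single (m - Poly_Mapping.single i 1)
        (of_nat (Poly_Mapping.lookup m i) * Poly_Mapping.lookup p m))"

definition mto_upoly :: "nat \<Rightarrow> mpoly \<Rightarrow> mpoly poly" where
  "mto_upoly i p = (\<Sum>m\<in>Poly_Mapping.keys p.
      monom (Poly_Mapping.single (Poly_Mapping.update i 0 m) (Poly_Mapping.lookup p m))
            (Poly_Mapping.lookup m i))"

definition mres :: "nat \<Rightarrow> mpoly \<Rightarrow> mpoly \<Rightarrow> mpoly" where
  "mres i p q = resultant (mto_upoly i p) (mto_upoly i q)"

text \<open>Variable conventions.
  For f (in C[y1,y2]): y1 = X_0, y2 = X_1.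
  For F, S and the resultant: y1 = X_0, y2 = X_1, y3 = X_2, d = X_3, k = X_4.
  For the generic offset equation g (in C[x1,x2,d]): x1 = X_0, x2 = X_1, d = X_2.\<close>

definition pt2 :: "complex \<Rightarrow> complex \<Rightarrow> nat \<Rightarrow> complex" where
  "pt2 a b = (\<lambda>i. if i = 0 then a else if i = 1 then b else 0)"

definition pt3 :: "complex \<Rightarrow> complex \<Rightarrow> complex \<Rightarrow> nat \<Rightarrow> complex" where
  "pt3 a b c = (\<lambda>i. if i = 0 then a else if i = 1 then b else if i = 2 then c else 0)"

definition Omega :: "mpoly \<Rightarrow> (complex \<times> complex \<times> complex \<times> complex \<times> complex \<times> complex) set" where
  "Omega f = {(y1, y2, x1, x2, d, u).
      meval f (pt2 y1 y2) = 0 \<and>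
      (x1 - y1)^2 + (x2 - y2)^2 - d^2 = 0 \<and>
      - meval (mpderiv 1 f) (pt2 y1 y2) * (x1 - y1) + meval (mpderiv 0 f) (pt2 y1 y2) * (x2 - y2) = 0 \<and>
      u * ((meval (mpderiv 0 f) (pt2 y1 y2))^2 + (meval (mpderiv 1 f) (pt2 y1 y2))^2) - 1 = 0}"

definition offset_proj :: "mpoly \<Rightarrow> (complex \<times> complex \<times> complex) set" where
  "offset_proj f = (\<lambda>(y1, y2, x1, x2, d, u). (x1, x2, d)) ` Omega f"

definition zariski_closure3 :: "(complex \<times> complex \<times> complex) set \<Rightarrow> (complex \<times> complex \<times> complex) set" where
  "zariski_closure3 A = {(a, b, c). \<forall>h. mvars h \<subseteq> {0, 1, 2} \<longrightarrow>
      (\<forall>(a', b', c')\<in>A. meval h (pt3 a' b' c') = 0) \<longrightarrow> meval h (pt3 a b c) = 0}"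

definition generic_offset :: "mpoly \<Rightarrow> (complex \<times> complex \<times> complex) set" where
  "generic_offset f = zariski_closure3 (offset_proj f)"

definition is_generic_offset_eq :: "mpoly \<Rightarrow> mpoly \<Rightarrow> bool" where
  "is_generic_offset_eq f g \<longleftrightarrow>
     mvars g \<subseteq> {0, 1, 2} \<and>
     (\<forall>q. q * q dvd g \<longrightarrow> q dvd 1) \<and>
     (\<forall>q. q dvd g \<longrightarrow> mvars q \<subseteq> {2} \<longrightarrow> mtdeg q = 0) \<and>
     {(a, b, c). meval g (pt3 a b c) = 0} = generic_offset f"

definition homog :: "mpoly \<Rightarrow> mpoly" where
  "homog f = (\<Sum>m\<in>Poly_Mapping.keys f.
      Poly_Mapping.single
        (m + Poly_Mapping.single 2 (mtdeg f - Poly_Mapping.lookup m 0 - Poly_Mapping.lookup m 1))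
        (Poly_Mapping.lookup f m))"

definition S_poly :: "mpoly \<Rightarrow> mpoly" where
  "S_poly f = (let F = homog f; F1 = mpderiv 0 F; F2 = mpderiv 1 F in
     (F1^2 + F2^2) * (mVar 1 - mVar 4 * mVar 2)^2 - F2^2 * (mVar 2)^2 * (mVar 3)^2)"

definition res_FS :: "mpoly \<Rightarrow> mpoly" where
  "res_FS f = mres 2 (homog f) (S_poly f)"

text \<open>P is a primitive part of R with respect to {d,k}: R = c * P, where c is a nonzero
  polynomial in y1,y2 only and P has no non-constant factor lying in C[y1,y2]
  (i.e. the gcd of the coefficients of P as a polynomial in d,k is a unit).\<close>
definition is_PP_dk :: "mpoly \<Rightarrow> mpoly \<Rightarrow> bool" where
  "is_PP_dk R P \<longleftrightarrow> (\<exists>c. mvars c \<subseteq> {0, 1} \<and> c \<noteq> 0 \<and> R = c * P) \<and>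
     (\<forall>q. q dvd P \<longrightarrow> mvars q \<subseteq> {0, 1} \<longrightarrow> mtdeg q = 0)"

end

theory Submission
  imports Defs "HOL-Computational_Algebra.Computational_Algebra" "HOL-Computational_Algebra.Field_as_Ring"
    "Subresultants.Subresultant_Gcd" "Jordan_Normal_Form.Char_Poly"
begin

text \<open>
  Both degrees count the same finite set. Fix generic values of d and of k = x2, and let X be the set of
  points y of the curve with sg(y) (y2 - k)^2 = f2(y)^2 d^2, where sg = f1^2 + f2^2 is nonzero.

  On one side, a point y of X yields the offset point with x2 = k and x1 = y1 + (k - y2) f1 / f2. This is a
  bijection onto the roots of g(x1, k, d), which are simple because g is square-free: differentiating g
  along the offset shows that (x - y, -d) is proportional to the gradient of g at (x, d), so y is recovered
  rationally from (x, d).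

  On the other side, over the slope t = y1 / y2 the product formula writes the resultant as a product of
  sg(y) (y2 - k)^2 - f2(y)^2 d^2 over the points y of the curve on the line y1 = t y2, up to a factor depending only on t. The
  multiplicity of a slope t as a root of the primitive part equals, for generic (k, d), the multiplicity
  of k as a root for fixed t, because both are the exponent of the irreducible factor through
  (t, k); and the latter is the number of points of X over t.
\<close>

text \<open>Three obstacles shape the details. First, d is only a square root of t^2 sg, so the
  offset is not parametrized by polynomials. Reducing g modulo d^2 - t^2 sg and using both signs of
  d gives two polynomials divisible by f; with them the foot point may move along its tangent line,
  and no local parametrization of the curve is needed. The tangent vector obtained degenerates at
  the focal value of t, which is repaired by letting t vary along the ruling. Second, facts shown at
  parametrized points must reach every zero of g. They are cleared of denominators and multiplied by
  factors that absorb the degenerate points, and then hold on the closure. Third, a total degree in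
  y1, y2 must become a number of slopes. The resultant and all its factors are homogeneous in (y1,
  y2), so this is the degree in the slope unless a root lies at infinity. Primitivity enters here:
  neither y2 nor any y1 - t y2 divides P, so generic (d, k) keep the roots away from infinity and
  from the finitely many exceptional slopes.\<close>

abbreviation lookup where "lookup \<equiv> Poly_Mapping.lookup"
abbreviation keys where "keys \<equiv> Poly_Mapping.keys"
abbreviation single where "single \<equiv> Poly_Mapping.single"

section \<open>Evaluation of multivariate polynomials as a ring homomorphism\<close>

definition mmon :: "(nat \<Rightarrow> 'a::comm_ring_1) \<Rightarrow> (nat \<Rightarrow>\<^sub>0 nat) \<Rightarrow> 'a" where
  "mmon a m = (\<Prod>i\<in>keys m. a i ^ lookup m i)"

text \<open>Coefficients pass through \<phi> and variables go to arbitrary ring elements, so that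
  numerical evaluation, substitution, \<open>mto_upoly\<close>, the conversions to iterated
  polynomials and restriction to parametrized curves are instances of one homomorphism.\<close>

definition mev :: "(complex \<Rightarrow> 'a) \<Rightarrow> (nat \<Rightarrow> 'a::comm_ring_1) \<Rightarrow> mpoly \<Rightarrow> 'a" where
  "mev \<phi> a p = (\<Sum>m\<in>keys p. \<phi> (lookup p m) * mmon a m)"

lemma meval_mev: "meval p a = mev (\<lambda>c. c) a p"
  by (simp add: meval_def mev_def mmon_def)

lemma mmon_superset:
  assumes "finite K" "keys m \<subseteq> K"
  shows "mmon a m = (\<Prod>i\<in>K. a i ^ lookup m i)"
  unfolding mmon_def using assms
  by (intro prod.mono_neutral_left) (auto simp: in_keys_iff)

lemma mmon_0 [simp]: "mmon a 0 = 1"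
  by (simp add: mmon_def)

lemma mmon_single: "mmon a (single i k) = a i ^ k"
  by (cases "k = 0") (auto simp: mmon_def)

lemma mmon_add: "mmon a (m + n) = mmon a m * mmon a n"
proof -
  let ?K = "keys m \<union> keys n"
  have "mmon a (m + n) = (\<Prod>i\<in>?K. a i ^ lookup (m + n) i)"
    by (rule mmon_superset) (auto simp: keys_add)
  also have "\<dots> = (\<Prod>i\<in>?K. a i ^ lookup m i) * (\<Prod>i\<in>?K. a i ^ lookup n i)"
    by (simp add: lookup_add power_add prod.distrib)
  also have "\<dots> = mmon a m * mmon a n"
    by (simp add: mmon_superset[of ?K])
  finally show ?thesis .
qed

lemma mpoly_sum_monomials:
  "(p::mpoly) = (\<Sum>m\<in>keys p. single m (lookup p m))"
proof (rule poly_mapping_eqI)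
  fix k
  show "lookup p k
    = lookup (\<Sum>m\<in>keys p. single m (lookup p m)) k"
    by (simp add: lookup_sum lookup_single when_def in_keys_iff)
qed

lemma single_mConst_mVar:
  "single m c = mConst c * mmon mVar m"
proof -
  have pw: "mVar i ^ k = single (single i k) 1" for i k
    by (induction k) (simp_all add: mVar_def mult_single flip: single_add)
  have "finite K \<Longrightarrow> (\<Prod>i\<in>K. mVar i ^ lookup m i)
      = single (\<Sum>i\<in>K. single i (lookup m i)) 1" for K
    by (induction K rule: finite_induct) (simp_all add: pw mult_single)
  moreover have "(\<Sum>i\<in>keys m. single i (lookup m i)) = m"
    by (rule poly_mapping_eqI) (simp add: lookup_sum lookup_single when_def in_keys_iff)
  ultimately show ?thesis
    by (simp add: mmon_def mConst_def mult_single)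
qed

lemma mvars_0 [simp]: "mvars 0 = {}" and mvars_1 [simp]: "mvars 1 = {}"
  by (auto simp: mvars_def simp flip: single_one)

lemma mvars_mConst [simp]: "mvars (mConst c) = {}"
  by (auto simp: mvars_def mConst_def)

lemma mvars_mVar [simp]: "mvars (mVar i) = {i}"
  by (auto simp: mvars_def mVar_def)

lemma mvars_add: "mvars (p + q) \<subseteq> mvars p \<union> mvars q"
  unfolding mvars_def using keys_add[of p q] by blast

lemma mvars_mult: "mvars (p * q) \<subseteq> mvars p \<union> mvars q"
proof -
  have "i \<in> mvars p \<union> mvars q" if "m \<in> keys (p * q)" "i \<in> keys m" for m i
  proof -
    obtain a b where "m = a + b" "a \<in> keys p" "b \<in> keys q"
      using keys_mult[of p q] \<open>m \<in> keys (p * q)\<close> by blast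
    thus ?thesis using keys_add[of a b] \<open>i \<in> keys m\<close> unfolding mvars_def by blast
  qed
  thus ?thesis unfolding mvars_def[of "p * q"] by blast
qed

lemma mvars_uminus [simp]: "mvars (- p) = mvars p"
proof -
  have "keys (- p) = keys p"
    by (auto simp: in_keys_iff)
  thus ?thesis by (simp add: mvars_def)
qed

lemma mvars_diff: "mvars (p - q) \<subseteq> mvars p \<union> mvars q"
  using mvars_add[of p "- q"] by simp

lemma mvars_power: "mvars (p ^ n) \<subseteq> mvars p"
  by (induction n) (use mvars_mult in fastforce)+

lemma mvars_sum: "mvars (\<Sum>x\<in>A. h x) \<subseteq> (\<Union>x\<in>A. mvars (h x))"
proof (induction A rule: infinite_finite_induct)
  case (insert x F)
  thus ?case using mvars_add[of "h x" "sum h F"] by auto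
qed auto

lemma mvars_prod: "mvars (\<Prod>x\<in>A. h x) \<subseteq> (\<Union>x\<in>A. mvars (h x))"
proof (induction A rule: infinite_finite_induct)
  case (insert x F)
  thus ?case using mvars_mult[of "h x" "prod h F"] by auto
qed auto

text \<open>The monomials of \<open>p\<close> only involve variables of \<open>V\<close>, so only
  these have to be handled. Identities valid merely for polynomials in two or three variables are
  proved this way.\<close>

lemma mpoly_vars_induct [consumes 1, case_names const var add mult]:
  assumes "mvars p \<subseteq> V"
    and const: "\<And>c. P (mConst c)"
    and var: "\<And>i. i \<in> V \<Longrightarrow> P (mVar i)"
    and add: "\<And>p q. P p \<Longrightarrow> P q \<Longrightarrow> P (p + q)"
    and mult: "\<And>p q. P p \<Longrightarrow> P q \<Longrightarrow> P (p * q)"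
  shows "P p"
proof -
  have zero: "P 0" using const[of 0] by (simp add: mConst_def)
  have one: "P 1" using const[of 1] by (simp add: mConst_def)
  have pw: "P (mVar i ^ k)" if "i \<in> V" for i k
    by (induction k) (use one mult var that in auto)
  have mon: "P (\<Prod>i\<in>K. mVar i ^ h i)" if "finite K" "K \<subseteq> V" for K h
    using that by (induction K rule: finite_induct) (use one mult pw in auto)
  have single: "P (single m c)" if "m \<in> keys p" for m c
    unfolding single_mConst_mVar mmon_def
    by (rule mult[OF const mon]) (use assms(1) that in \<open>auto simp: mvars_def\<close>)
  have "P (\<Sum>m\<in>K. single m (h m))" if "finite K" "K \<subseteq> keys p" for K h
    using that by (induction K rule: finite_induct) (use zero add single in auto)
  from this[of "keys p" "lookup p"] show ?thesis
    by (simp flip: mpoly_sum_monomials)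
qed

lemma mpoly_induct [case_names const var add mult]:
  assumes "\<And>c. P (mConst c)" "\<And>i. P (mVar i)"
    and "\<And>p q. P p \<Longrightarrow> P q \<Longrightarrow> P (p + q)" "\<And>p q. P p \<Longrightarrow> P q \<Longrightarrow> P (p * q)"
  shows "P (p :: mpoly)"
  using mpoly_vars_induct[of p UNIV P] assms by blast

context comm_ring_hom
begin

lemma hom_mmon: "hom (mmon a m) = mmon (\<lambda>i. hom (a i)) m"
  by (simp add: mmon_def hom_prod hom_power)

end

locale mev_hom = comm_ring_hom \<phi> for \<phi> :: "complex \<Rightarrow> 'a::comm_ring_1" +
  fixes a :: "nat \<Rightarrow> 'a"
begin

lemma mev_superset:
  assumes "finite K" "keys p \<subseteq> K"
  shows "mev \<phi> a p = (\<Sum>m\<in>K. \<phi> (lookup p m) * mmon a m)"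
  unfolding mev_def using assms
  by (intro sum.mono_neutral_left) (auto simp: in_keys_iff)

lemma mev_add: "mev \<phi> a (p + q) = mev \<phi> a p + mev \<phi> a q"
proof -
  let ?K = "keys p \<union> keys q"
  have "mev \<phi> a (p + q) = (\<Sum>m\<in>?K. \<phi> (lookup (p + q) m) * mmon a m)"
    by (rule mev_superset) (auto simp: keys_add)
  also have "\<dots> = (\<Sum>m\<in>?K. \<phi> (lookup p m) * mmon a m)
      + (\<Sum>m\<in>?K. \<phi> (lookup q m) * mmon a m)"
    by (simp add: lookup_add hom_add algebra_simps sum.distrib)
  also have "\<dots> = mev \<phi> a p + mev \<phi> a q"
    by (simp add: mev_superset[of ?K])
  finally show ?thesis .
qed

lemma mev_0: "mev \<phi> a 0 = 0"
  by (simp add: mev_def)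

lemma mev_single: "mev \<phi> a (single m c) = \<phi> c * mmon a m"
  by (cases "c = 0") (auto simp: mev_def)

lemma mev_sum: "mev \<phi> a (\<Sum>x\<in>A. h x) = (\<Sum>x\<in>A. mev \<phi> a (h x))"
  by (induction A rule: infinite_finite_induct) (simp_all add: mev_0 mev_add)

lemma mev_mult: "mev \<phi> a (p * q) = mev \<phi> a p * mev \<phi> a q"
proof -
  have "p * q = (\<Sum>m\<in>keys p. \<Sum>n\<in>keys q.
      single (m + n) (lookup p m * lookup q n))"
    by (subst mpoly_sum_monomials[of p], subst mpoly_sum_monomials[of q])
      (simp only: sum_product mult_single)
  hence "mev \<phi> a (p * q) = (\<Sum>m\<in>keys p. \<Sum>n\<in>keys q.
      (\<phi> (lookup p m) * mmon a m) * (\<phi> (lookup q n) * mmon a n))"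
    by (simp only: mev_sum mev_single hom_mult mmon_add mult_ac)
  thus ?thesis by (simp only: mev_def sum_product)
qed

lemma mev_1: "mev \<phi> a 1 = 1"
  using mev_single[of 0 1] by simp

lemma mev_comm_ring_hom: "comm_ring_hom (mev \<phi> a)"
  by unfold_locales (simp_all add: mev_0 mev_1 mev_add mev_mult)

lemma mev_mVar [simp]: "mev \<phi> a (mVar i) = a i"
  by (simp add: mVar_def mev_single mmon_single)

lemma mev_mConst [simp]: "mev \<phi> a (mConst c) = \<phi> c"
  by (simp add: mConst_def mev_single)

sublocale mev: comm_ring_hom "mev \<phi> a"
  by (rule mev_comm_ring_hom)

end

lemma mConst_hom: "comm_ring_hom mConst"
  by unfold_locales (simp_all add: mConst_def single_add mult_single)

lemma comm_ring_hom_unique_on_mpoly: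
  assumes "comm_ring_hom G" "comm_ring_hom H" "mvars p \<subseteq> V"
    and "\<And>c. G (mConst c) = H (mConst c)" "\<And>i. i \<in> V \<Longrightarrow> G (mVar i) = H (mVar i)"
  shows "G p = H p"
proof -
  interpret G: comm_ring_hom G by fact
  interpret H: comm_ring_hom H by fact
  from assms(3) show ?thesis
    by (induction rule: mpoly_vars_induct) (simp_all add: assms G.hom_add G.hom_mult H.hom_add H.hom_mult)
qed

lemma comm_ring_hom_comp:
  assumes "comm_ring_hom G" "comm_ring_hom H"
  shows "comm_ring_hom (\<lambda>x. G (H x))"
proof -
  interpret G: comm_ring_hom G by fact
  interpret H: comm_ring_hom H by fact
  show ?thesis
    by unfold_locales (simp_all add: G.hom_add H.hom_add G.hom_mult H.hom_mult)
qed

lemma comm_ring_hom_id: "comm_ring_hom (\<lambda>x. x)"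
  by unfold_locales auto

lemma meval_comm_ring_hom: "comm_ring_hom (\<lambda>p. meval p a)"
proof -
  interpret mev_hom "\<lambda>c. c" a
    unfolding mev_hom_def by (rule comm_ring_hom_id)
  show ?thesis unfolding meval_mev by (rule mev_comm_ring_hom)
qed

interpretation meval: comm_ring_hom "\<lambda>p. meval p a" for a
  by (rule meval_comm_ring_hom)

lemma meval_mVar [simp]: "meval (mVar i) a = a i"
  and meval_mConst [simp]: "meval (mConst c) a = c"
proof -
  interpret mev_hom "\<lambda>c. c" a
    unfolding mev_hom_def by (rule comm_ring_hom_id)
  show "meval (mVar i) a = a i" "meval (mConst c) a = c"
    unfolding meval_mev by simp_all
qed

text \<open>A homomorphism passes through the sum over monomials. Most evaluation rules below
  compose two evaluations in this way and then compare the values at the variables.\<close>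

lemma comm_ring_hom_mev_eq:
  assumes "comm_ring_hom G" "comm_ring_hom \<phi>"
  shows "G (mev \<phi> a p) = mev (\<lambda>c. G (\<phi> c)) (\<lambda>i. G (a i)) p"
proof -
  interpret G: comm_ring_hom G by fact
  show ?thesis by (simp add: mev_def G.hom_sum G.hom_mult G.hom_mmon)
qed

lemma mev_cong:
  assumes "\<And>i. i \<in> mvars p \<Longrightarrow> a i = b i"
  shows "mev \<phi> a p = mev \<phi> b p"
proof -
  have "mmon a m = mmon b m" if "m \<in> keys p" for m
    unfolding mmon_def
    by (rule prod.cong[OF refl], subst assms) (use that in \<open>auto simp: mvars_def\<close>)
  thus ?thesis by (simp add: mev_def)
qed

lemma meval_cong: "(\<And>i. i \<in> mvars p \<Longrightarrow> a i = b i) \<Longrightarrow> meval p a = meval p b"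
  unfolding meval_mev by (rule mev_cong)

lemma mev_mConst_mVar: "mev mConst mVar p = p"
proof -
  have "mev mConst mVar p = (\<Sum>m\<in>keys p. single m (lookup p m))"
    by (simp add: mev_def flip: single_mConst_mVar)
  thus ?thesis by (simp flip: mpoly_sum_monomials)
qed

lemma mvars_mev:
  assumes "\<And>i. i \<in> mvars p \<Longrightarrow> mvars (a i) \<subseteq> V"
  shows "mvars (mev mConst a p) \<subseteq> V"
proof -
  have *: "mvars (mmon a m) \<subseteq> V" if "m \<in> keys p" for m
  proof -
    have "mvars (mmon a m) \<subseteq> (\<Union>i\<in>keys m. mvars (a i ^ lookup m i))"
      unfolding mmon_def by (rule mvars_prod)
    also have "\<dots> \<subseteq> (\<Union>i\<in>keys m. mvars (a i))"
      using mvars_power by blast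
    also have "\<dots> \<subseteq> V" using assms that by (auto simp: mvars_def)
    finally show ?thesis .
  qed
  have "mvars (mev mConst a p)
      \<subseteq> (\<Union>m\<in>keys p. mvars (mConst (lookup p m) * mmon a m))"
    unfolding mev_def by (rule mvars_sum)
  also have "\<dots> \<subseteq> V" using * mvars_mult by fastforce
  finally show ?thesis .
qed

lemma meval_mev_mConst: "meval (mev mConst a p) b = meval p (\<lambda>i. meval (a i) b)"
  using comm_ring_hom_mev_eq[OF meval_comm_ring_hom[of b] mConst_hom, of a p]
  by (simp add: meval_mev[of p])

lemma const_poly_hom: "comm_ring_hom (\<lambda>c::'a::comm_ring_1. [:c:])"
  by unfold_locales (simp_all add: one_pCons)

lemma poly_eval_hom: "comm_ring_hom (\<lambda>p::'a::comm_ring_1 poly. poly p x)"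
  by unfold_locales simp_all

lemma poly_mev_const: "poly (mev (\<lambda>c. [:c:]) r p) z = meval p (\<lambda>i. poly (r i) z)"
  using comm_ring_hom_mev_eq[OF poly_eval_hom[of z] const_poly_hom, of r p]
  by (simp add: meval_mev)

lemma eventually_meval_line_nonzero:
  assumes "meval p (\<lambda>i. poly (r i) z0) \<noteq> 0"
  shows "\<forall>\<^sub>F z in cofinite. meval p (\<lambda>i. poly (r i) z) \<noteq> 0"
proof -
  have "mev (\<lambda>c. [:c:]) r p \<noteq> 0" using assms poly_mev_const[of r p z0] by auto
  thus ?thesis
    by (simp add: eventually_cofinite poly_roots_finite flip: poly_mev_const)
qed

lemma const_mConst_hom: "comm_ring_hom (\<lambda>c. [:mConst c:])"
  by (rule comm_ring_hom_comp[OF const_poly_hom mConst_hom])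

text \<open>The definition of \<open>mto_upoly\<close> by monomials is thereby recognized as an
  evaluation, hence as a ring homomorphism that is compatible with specializing the
  coefficients.\<close>

lemma mto_upoly_mev:
  "mto_upoly i p = mev (\<lambda>c. [:mConst c:]) (\<lambda>j. if j = i then [:0, 1:] else [:mVar j:]) p"
proof -
  have "[:mConst c:] * mmon (\<lambda>j. if j = i then [:0, 1:] else [:mVar j:]) m
      = monom (single (Poly_Mapping.update i 0 m) c) (lookup m i)" for c m
  proof -
    let ?K = "insert i (keys m)"
    let ?m = "Poly_Mapping.update i 0 m"
    have "mmon (\<lambda>j. if j = i then [:0, 1:] else [:mVar j:]) m
       = (\<Prod>j\<in>?K. (if j = i then [:0, 1:] else [:mVar j:]) ^ lookup m j)"
      by (rule mmon_superset) auto
    also have "\<dots> = [:0, 1:] ^ lookup m i *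
       (\<Prod>j\<in>keys m - {i}. [:mVar j:] ^ lookup m j)"
      by (subst prod.insert_remove) auto
    also have "(\<Prod>j\<in>keys m - {i}. [:mVar j:] ^ lookup m j)
        = (\<Prod>j\<in>keys m - {i}. [:mVar j ^ lookup ?m j:])"
      by (rule prod.cong) (auto simp: poly_const_pow lookup_update)
    also have "\<dots> = [:mmon mVar ?m:]"
    proof -
      have "keys ?m = keys m - {i}"
        by (auto simp: in_keys_iff lookup_update split: if_splits)
      thus ?thesis
        by (subst comm_ring_hom.hom_mmon[OF const_poly_hom]) (simp add: mmon_def poly_const_pow)
    qed
    finally show ?thesis
      by (simp add: single_mConst_mVar monom_altdef mult_ac)
  qed
  thus ?thesis by (simp add: mto_upoly_def mev_def)
qed

text \<open>The index of the second variable would otherwise be rewritten to \<open>Suc 0\<close>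
  and no longer match facts about \<open>mVar 1\<close> or \<open>pt2 a b 1\<close>.\<close>

declare One_nat_def [simp del]

lemma map_poly_eval_hom:
  assumes "comm_ring_hom h"
  shows "comm_ring_hom (\<lambda>Q. poly (map_poly h Q) x)"
proof -
  interpret h: comm_ring_hom h by fact
  interpret m: map_poly_comm_ring_hom h ..
  show ?thesis by unfold_locales (simp_all add: m.hom_add m.hom_mult)
qed

lemma comm_ring_hom_unique_on_poly:
  assumes "comm_ring_hom G" "comm_ring_hom H"
    and "\<And>c. G [:c:] = H [:c:]" "G [:0, 1:] = H [:0, 1:]"
  shows "G p = H p"
proof -
  interpret G: comm_ring_hom G by fact
  interpret H: comm_ring_hom H by fact
  show ?thesis
  proof (induction p)
    case (pCons c p)
    have "pCons c p = [:c:] + [:0, 1:] * p" by simp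
    thus ?case by (simp only: G.hom_add G.hom_mult H.hom_add H.hom_mult assms(3,4) pCons.IH)
  qed simp
qed

lemma poly_mto_upoly_mVar: "poly (mto_upoly i p) (mVar i) = p"
proof -
  have "poly (mto_upoly i p) (mVar i) = mev mConst mVar p"
    unfolding mto_upoly_mev
    by (subst comm_ring_hom_mev_eq[OF poly_eval_hom const_mConst_hom]) (simp, rule mev_cong, simp)
  thus ?thesis by (simp add: mev_mConst_mVar)
qed

lemma meval_mto_upoly: "poly (map_poly (\<lambda>c. meval c a) (mto_upoly i p)) z = meval p (a(i := z))"
  unfolding mto_upoly_mev
  by (subst comm_ring_hom_mev_eq[OF map_poly_eval_hom[OF meval_comm_ring_hom] const_mConst_hom])
    (simp add: meval_mev[of p] Polynomial.map_poly_pCons, rule mev_cong, simp add: Polynomial.map_poly_pCons)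

lemma mvars_coeff_mto_upoly:
  assumes "mvars p \<subseteq> insert i V"
  shows "mvars (coeff (mto_upoly i p) n) \<subseteq> V"
  using assms
proof (induction arbitrary: n rule: mpoly_vars_induct)
  interpret mev_hom "\<lambda>c. [:mConst c:]" "\<lambda>j. if j = i then [:0, 1:] else [:mVar j:]"
    unfolding mev_hom_def by (rule const_mConst_hom)
  {
    case (const c)
    thus ?case by (cases n) (auto simp: mto_upoly_mev)
  next
    case (var j)
    thus ?case by (auto simp: mto_upoly_mev coeff_pCons split: nat.splits)
  next
    case (add p q)
    thus ?case using mvars_add by (fastforce simp: mto_upoly_mev mev_add)
  next
    case (mult p q)
    have "mvars (coeff (mto_upoly i p) k * coeff (mto_upoly i q) (n - k)) \<subseteq> V" for k
      using mult mvars_mult by blast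
    hence "mvars (\<Sum>k\<le>n. coeff (mto_upoly i p) k * coeff (mto_upoly i q) (n - k)) \<subseteq> V"
      using mvars_sum[of "\<lambda>k. coeff (mto_upoly i p) k * coeff (mto_upoly i q) (n - k)" "{..n}"] by blast
    thus ?case
      by (simp only: mto_upoly_mev mev_mult coeff_mult)
  }
qed

lemma mpoly_mvars_empty: "mvars p = {} \<Longrightarrow> p = mConst (meval p (\<lambda>_. 0))"
  using comm_ring_hom_mev_eq[OF mConst_hom comm_ring_hom_id, of "\<lambda>_. 0" p]
    mev_cong[of p mVar "\<lambda>_. mConst 0" mConst] mev_mConst_mVar[of p]
  by (simp add: meval_mev)

lemma finite_mvars [simp]: "finite (mvars p)"
  by (simp add: mvars_def)

text \<open>Induction on a finite set of variables containing those of \<open>p\<close>: as a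
  polynomial in one of them, \<open>p\<close> has coefficients in fewer variables, and a complex
  univariate polynomial that vanishes everywhere is zero.\<close>

lemma mpoly_eq_0I:
  assumes "\<And>a. meval p a = 0"
  shows "p = 0"
proof -
  have "finite V \<Longrightarrow> mvars p \<subseteq> V \<Longrightarrow> (\<And>a. meval p a = 0) \<Longrightarrow> p = 0" for V
  proof (induction V arbitrary: p rule: finite_induct)
    case empty
    thus ?case using mpoly_mvars_empty[of p] by (simp add: mConst_def)
  next
    case (insert i V)
    have "coeff (mto_upoly i p) n = 0" for n
    proof (rule insert.IH)
      show "mvars (coeff (mto_upoly i p) n) \<subseteq> V"
        using insert.prems by (intro mvars_coeff_mto_upoly) auto
      fix a
      have "poly (map_poly (\<lambda>c. meval c a) (mto_upoly i p)) z = 0" for z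
        by (simp add: meval_mto_upoly insert.prems)
      hence "map_poly (\<lambda>c. meval c a) (mto_upoly i p) = 0"
        using poly_all_0_iff_0 by blast
      hence "coeff (map_poly (\<lambda>c. meval c a) (mto_upoly i p)) n = 0" by simp
      thus "meval (coeff (mto_upoly i p) n) a = 0" by (simp add: coeff_map_poly)
    qed
    hence "mto_upoly i p = 0" by (simp add: poly_eq_iff)
    thus ?case using poly_mto_upoly_mVar[of i p] by simp
  qed
  thus ?thesis using assms finite_mvars by blast
qed

lemma mpoly_eqI: "(\<And>a. meval p a = meval q a) \<Longrightarrow> p = q"
  using mpoly_eq_0I[of "p - q"] by (simp add: meval.hom_minus)

section \<open>Conversion to iterated univariate polynomials\<close>

definition to_poly2 :: "mpoly \<Rightarrow> complex poly poly" where
  "to_poly2 = mev (\<lambda>c. [:[:c:]:])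
     (\<lambda>i. if i = 0 then [:0, 1:] else if i = 1 then [:[:0, 1:]:] else 0)"

text \<open>The variable x1 is outermost, x2 innermost, and d lies between. Thus the outer degree is
  the degree in x1, coefficients are specialized at (d, k) by \<open>eval2 c d k\<close>, and gcds
  and unique factorization in iterated polynomial rings become available.\<close>

definition to_poly3 :: "mpoly \<Rightarrow> complex poly poly poly" where
  "to_poly3 = mev (\<lambda>c. [:[:[:c:]:]:])
     (\<lambda>i. if i = 0 then [:0, 1:] else if i = 2 then [:[:0, 1:]:]
          else if i = 1 then [:[:[:0, 1:]:]:] else 0)"

definition of_poly2 :: "nat \<Rightarrow> nat \<Rightarrow> complex poly poly \<Rightarrow> mpoly" where
  "of_poly2 i j Q = poly (map_poly (\<lambda>q. poly (map_poly mConst q) (mVar j)) Q) (mVar i)"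

definition of_poly3 :: "complex poly poly poly \<Rightarrow> mpoly" where
  "of_poly3 Q = poly (map_poly (of_poly2 2 1) Q) (mVar 0)"

lemma const2_hom: "comm_ring_hom (\<lambda>c::'a::comm_ring_1. [:[:c:]:])"
  by (rule comm_ring_hom_comp[OF const_poly_hom const_poly_hom])

lemma const3_hom: "comm_ring_hom (\<lambda>c::'a::comm_ring_1. [:[:[:c:]:]:])"
  by (rule comm_ring_hom_comp[OF const_poly_hom const2_hom])

lemma to_poly2_hom: "comm_ring_hom to_poly2"
  unfolding to_poly2_def
  by (rule mev_hom.mev_comm_ring_hom) (simp add: mev_hom_def const2_hom)

lemma to_poly3_hom: "comm_ring_hom to_poly3"
  unfolding to_poly3_def
  by (rule mev_hom.mev_comm_ring_hom) (simp add: mev_hom_def const3_hom)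

lemma of_poly2_hom: "comm_ring_hom (of_poly2 i j)"
  unfolding of_poly2_def[abs_def]
  by (intro map_poly_eval_hom mConst_hom)

lemma of_poly3_hom: "comm_ring_hom of_poly3"
  unfolding of_poly3_def[abs_def]
  by (intro map_poly_eval_hom of_poly2_hom)

interpretation to_poly2: comm_ring_hom to_poly2 by (rule to_poly2_hom)
interpretation to_poly3: comm_ring_hom to_poly3 by (rule to_poly3_hom)
interpretation of_poly2: comm_ring_hom "of_poly2 i j" for i j by (rule of_poly2_hom)
interpretation of_poly3: comm_ring_hom of_poly3 by (rule of_poly3_hom)

lemma to_poly2_mConst [simp]: "to_poly2 (mConst c) = [:[:c:]:]"
  and to_poly2_mVar [simp]: "to_poly2 (mVar i) = (if i = 0 then [:0, 1:] else if i = 1 then [:[:0, 1:]:] else 0)"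
  unfolding to_poly2_def
  by (subst mev_hom.mev_mConst mev_hom.mev_mVar; simp add: mev_hom_def const2_hom)+

lemma to_poly3_mConst [simp]: "to_poly3 (mConst c) = [:[:[:c:]:]:]"
  and to_poly3_mVar [simp]: "to_poly3 (mVar i) = (if i = 0 then [:0, 1:] else if i = 2 then [:[:0, 1:]:]
          else if i = 1 then [:[:[:0, 1:]:]:] else 0)"
  unfolding to_poly3_def
  by (subst mev_hom.mev_mConst mev_hom.mev_mVar; simp add: mev_hom_def const3_hom)+

lemma mConst_0 [simp]: "mConst 0 = 0" and mConst_1 [simp]: "mConst 1 = 1"
  by (simp_all add: mConst_def)

lemma of_poly2_simps [simp]:
  "of_poly2 i j [:[:c:]:] = mConst c" "of_poly2 i j [:0, 1:] = mVar i"
  "of_poly2 i j [:[:0, 1:]:] = mVar j"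
  by (simp_all add: of_poly2_def Polynomial.map_poly_pCons map_poly_1')

lemma of_poly3_simps [simp]:
  "of_poly3 [:Q:] = of_poly2 2 1 Q" "of_poly3 [:0, 1:] = mVar 0"
  by (simp_all add: of_poly3_def Polynomial.map_poly_pCons)

lemma of_poly_simps' [simp]:
  "of_poly2 i j (pCons 0 1) = mVar i" "of_poly2 i j [:pCons 0 1:] = mVar j"
  "of_poly3 (pCons 0 1) = mVar 0"
  using of_poly2_simps of_poly3_simps by (metis one_pCons)+

lemma of_poly2_to_poly2: "mvars p \<subseteq> {0, 1} \<Longrightarrow> of_poly2 0 1 (to_poly2 p) = p"
  by (rule comm_ring_hom_unique_on_mpoly[OF comm_ring_hom_comp[OF of_poly2_hom to_poly2_hom] comm_ring_hom_id])
    auto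

lemma of_poly3_to_poly3: "mvars p \<subseteq> {0, 1, 2} \<Longrightarrow> of_poly3 (to_poly3 p) = p"
  by (rule comm_ring_hom_unique_on_mpoly[OF comm_ring_hom_comp[OF of_poly3_hom to_poly3_hom] comm_ring_hom_id])
    auto

lemma to_poly2_of_poly2: "to_poly2 (of_poly2 0 1 Q) = Q"
proof (rule comm_ring_hom_unique_on_poly[OF comm_ring_hom_comp[OF to_poly2_hom of_poly2_hom] comm_ring_hom_id])
  fix q :: "complex poly"
  show "to_poly2 (of_poly2 0 1 [:q:]) = [:q:]"
    by (rule comm_ring_hom_unique_on_poly[OF comm_ring_hom_comp[OF comm_ring_hom_comp[OF to_poly2_hom of_poly2_hom]
      const_poly_hom] const_poly_hom]) auto
qed auto

lemma to_poly3_of_poly3: "to_poly3 (of_poly3 Q) = Q"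
proof (rule comm_ring_hom_unique_on_poly[OF comm_ring_hom_comp[OF to_poly3_hom of_poly3_hom] comm_ring_hom_id])
  fix q :: "complex poly poly"
  show "to_poly3 (of_poly3 [:q:]) = [:q:]"
  proof (rule comm_ring_hom_unique_on_poly[OF comm_ring_hom_comp[OF comm_ring_hom_comp[OF to_poly3_hom of_poly3_hom]
      const_poly_hom] const_poly_hom])
    fix r :: "complex poly"
    show "to_poly3 (of_poly3 [:[:r:]:]) = [:[:r:]:]"
      by (rule comm_ring_hom_unique_on_poly[OF comm_ring_hom_comp[OF comm_ring_hom_comp[OF to_poly3_hom of_poly3_hom]
      const2_hom] const2_hom]) auto
  qed auto
qed auto

lemma mvars_of_poly2: "mvars (of_poly2 i j Q) \<subseteq> {i, j}"
proof -
  have sub: "mvars (poly (map_poly h q) x) \<subseteq> V"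
    if "h 0 = 0" "\<And>c. mvars (h c) \<subseteq> V" "mvars x \<subseteq> V" for h :: "'a::comm_ring_1 \<Rightarrow> mpoly" and q x V
  proof (induction q)
    case (pCons c q)
    thus ?case using that mvars_add mvars_mult
      by (simp add: Polynomial.map_poly_pCons) (meson order.trans Un_least)
  qed simp
  show ?thesis unfolding of_poly2_def by (intro sub) auto
qed

definition eval2 :: "complex poly poly \<Rightarrow> complex \<Rightarrow> complex \<Rightarrow> complex" where
  "eval2 Q a b = poly (poly Q [:a:]) b"

definition eval3 :: "complex poly poly poly \<Rightarrow> complex \<Rightarrow> complex \<Rightarrow> complex \<Rightarrow> complex" where
  "eval3 Q x d k = poly (poly (poly Q [:[:x:]:]) [:d:]) k"

lemma eval2_hom: "comm_ring_hom (\<lambda>Q. eval2 Q a b)"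
  by unfold_locales (simp_all add: eval2_def)

lemma eval3_hom: "comm_ring_hom (\<lambda>Q. eval3 Q x d k)"
  by unfold_locales (simp_all add: eval3_def)

lemma eval2_to_poly2: "eval2 (to_poly2 p) a b = meval p (pt2 a b)"
  unfolding to_poly2_def comm_ring_hom_mev_eq[OF eval2_hom const2_hom]
  by (simp add: meval_mev eval2_def) (rule mev_cong, simp add: pt2_def)

lemma eval3_to_poly3: "eval3 (to_poly3 p) x d k = meval p (pt3 x k d)"
  unfolding to_poly3_def comm_ring_hom_mev_eq[OF eval3_hom const3_hom]
  by (simp add: meval_mev eval3_def) (rule mev_cong, simp add: pt3_def)

lemma to_poly2_dvd_iff:
  assumes "mvars p \<subseteq> {0, 1}" "mvars q \<subseteq> {0, 1}"
  shows "to_poly2 p dvd to_poly2 q \<longleftrightarrow> p dvd q"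
proof
  assume "to_poly2 p dvd to_poly2 q"
  then obtain Q where "to_poly2 q = to_poly2 p * Q" by (elim dvdE)
  hence "of_poly2 0 1 (to_poly2 q) = of_poly2 0 1 (to_poly2 p) * of_poly2 0 1 Q"
    by (simp add: of_poly2.hom_mult)
  thus "p dvd q" using assms by (simp add: of_poly2_to_poly2)
qed (auto simp: to_poly2.hom_mult elim!: dvdE)

lemma to_poly2_irreducible:
  assumes "irreducible p" "mvars p \<subseteq> {0, 1}"
  shows "irreducible (to_poly2 p)"
proof (rule irreducibleI)
  have "p \<noteq> 0" "\<not> p dvd 1" using assms by (auto simp: irreducible_def)
  thus "to_poly2 p \<noteq> 0" using of_poly2_to_poly2[OF assms(2)] by auto
  show "\<not> to_poly2 p dvd 1"
    using to_poly2_dvd_iff[of p 1] assms \<open>\<not> p dvd 1\<close> by simp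
  fix A B assume *: "to_poly2 p = A * B"
  hence "of_poly2 0 1 (to_poly2 p) = of_poly2 0 1 A * of_poly2 0 1 B"
    by (simp add: of_poly2.hom_mult)
  hence "p = of_poly2 0 1 A * of_poly2 0 1 B" using assms by (simp add: of_poly2_to_poly2)
  hence "of_poly2 0 1 A dvd 1 \<or> of_poly2 0 1 B dvd 1"
    using assms(1) by (meson irreducibleD)
  moreover have "of_poly2 0 1 A dvd 1 \<Longrightarrow> A dvd 1" for A
    using to_poly2_dvd_iff[of "of_poly2 0 1 A" 1] mvars_of_poly2[of 0 1 A] by (simp add: to_poly2_of_poly2)
  ultimately show "A dvd 1 \<or> B dvd 1" by blast
qed

section \<open>Partial degrees through scaling of variables\<close>

definition scale_poly :: "nat set \<Rightarrow> mpoly \<Rightarrow> mpoly poly" where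
  "scale_poly V = mev (\<lambda>c. [:mConst c:]) (\<lambda>i. if i \<in> V then [:0, mVar i:] else [:mVar i:])"

lemma scale_poly_hom: "comm_ring_hom (scale_poly V)"
  unfolding scale_poly_def
  by (rule mev_hom.mev_comm_ring_hom) (simp add: mev_hom_def const_mConst_hom)

interpretation scale_poly: comm_ring_hom "scale_poly V" for V by (rule scale_poly_hom)

lemma scale_poly_mConst [simp]: "scale_poly V (mConst c) = [:mConst c:]"
  and scale_poly_mVar [simp]: "scale_poly V (mVar i) = (if i \<in> V then [:0, mVar i:] else [:mVar i:])"
  unfolding scale_poly_def
  by (subst mev_hom.mev_mConst mev_hom.mev_mVar; simp add: mev_hom_def const_mConst_hom)+

lemma scale_poly_eval:
  "poly (map_poly (\<lambda>c. meval c a) (scale_poly V p)) s = meval p (\<lambda>i. if i \<in> V then s * a i else a i)"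
  unfolding scale_poly_def comm_ring_hom_mev_eq[OF map_poly_eval_hom[OF meval_comm_ring_hom] const_mConst_hom]
  by (simp add: meval_mev[of p] Polynomial.map_poly_pCons) (rule mev_cong, simp add: Polynomial.map_poly_pCons)

lemma scale_poly_single:
  assumes "finite V"
  shows "scale_poly V (single m c)
    = monom (single m c) (\<Sum>i\<in>V. lookup m i)"
proof -
  let ?a = "\<lambda>i. if i \<in> V then [:0, mVar i:] else [:mVar i:]"
  let ?K = "V \<union> keys m"
  have fin: "finite ?K" using assms by simp
  have a: "?a i = [:mVar i:] * (if i \<in> V then [:0, 1:] else 1)" for i by simp
  have "mmon ?a m = (\<Prod>i\<in>?K. ?a i ^ lookup m i)"
    by (rule mmon_superset[OF fin]) auto
  also have "\<dots> = (\<Prod>i\<in>?K. [:mVar i:] ^ lookup m i)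
      * (\<Prod>i\<in>?K. (if i \<in> V then [:0, 1:] else 1) ^ lookup m i)"
    by (simp only: a power_mult_distrib prod.distrib)
  also have "(\<Prod>i\<in>?K. [:mVar i:] ^ lookup m i) = [:mmon mVar m:]"
    unfolding comm_ring_hom.hom_mmon[OF const_poly_hom] by (rule mmon_superset[symmetric, OF fin]) auto
  also have "(\<Prod>i\<in>?K. (if i \<in> V then [:0, 1:] else 1) ^ lookup m i)
      = (\<Prod>i\<in>V. [:0, 1::mpoly:] ^ lookup m i)"
    by (rule prod.mono_neutral_cong_right) (use fin in auto)
  also have "\<dots> = monom 1 (\<Sum>i\<in>V. lookup m i)"
    by (simp add: power_sum monom_altdef)
  finally show ?thesis
    unfolding single_mConst_mVar scale_poly.hom_mult comm_ring_hom.hom_mmon[OF scale_poly_hom]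
    by (simp add: smult_monom mult_ac)
qed

lemma scale_poly_sum:
  assumes "finite V"
  shows "scale_poly V p = (\<Sum>m\<in>keys p.
    monom (single m (lookup p m)) (\<Sum>i\<in>V. lookup m i))"
  by (subst mpoly_sum_monomials) (simp only: scale_poly.hom_sum scale_poly_single[OF assms])

lemma lookup_coeff_scale_poly:
  assumes "finite V"
  shows "lookup (coeff (scale_poly V p) j) m
    = (if (\<Sum>i\<in>V. lookup m i) = j then lookup p m else 0)"
proof -
  have "lookup (coeff (scale_poly V p) j) m
    = (\<Sum>n\<in>keys p. if n = m then
        (if (\<Sum>i\<in>V. lookup m i) = j then lookup p m else 0) else 0)"
    unfolding scale_poly_sum[OF assms] coeff_sum lookup_sum
    by (rule sum.cong) (auto simp: lookup_single when_def)
  thus ?thesis by (simp add: in_keys_iff)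
qed

text \<open>Scaling the variables of \<open>V\<close> by an indeterminate sorts monomials by their
  degree in \<open>V\<close>, and distinct monomials cannot cancel. Since
  \<open>scale_poly V\<close> is a homomorphism into polynomials over an integral domain, these
  degrees become additive on products, and a homogeneous polynomial is one whose image is a
  monomial.\<close>

lemma degree_scale_poly:
  assumes "finite V"
  shows "degree (scale_poly V p) = mdegV V p"
proof (rule antisym)
  let ?w = "\<lambda>m. \<Sum>i\<in>V. lookup m i"
  let ?M = "insert 0 (?w ` keys p)"
  have fin: "finite ?M" by simp
  show "degree (scale_poly V p) \<le> mdegV V p"
  proof (rule degree_le, intro allI impI)
    fix j assume j: "mdegV V p < j"
    show "coeff (scale_poly V p) j = 0"
    proof (rule poly_mapping_eqI)
      fix m
      have "?w m = j \<Longrightarrow> m \<notin> keys p"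
        using j Max_ge[OF fin, of "?w m"] by (auto simp: mdegV_def)
      thus "lookup (coeff (scale_poly V p) j) m = lookup 0 m"
        by (auto simp: lookup_coeff_scale_poly[OF assms] in_keys_iff)
    qed
  qed
  show "mdegV V p \<le> degree (scale_poly V p)"
  proof -
    have "mdegV V p \<in> ?M" unfolding mdegV_def by (rule Max_in) auto
    thus ?thesis
    proof
      assume "mdegV V p \<in> ?w ` keys p"
      then obtain m where m: "m \<in> keys p" "mdegV V p = ?w m" by auto
      have "lookup (coeff (scale_poly V p) (mdegV V p)) m \<noteq> 0"
        using m by (simp add: lookup_coeff_scale_poly[OF assms] in_keys_iff)
      hence "coeff (scale_poly V p) (mdegV V p) \<noteq> 0" by auto
      thus ?thesis by (rule le_degree)
    qed simp
  qed
qed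

lemma mtdeg_eq_mdegV:
  assumes "finite V" "mvars p \<subseteq> V"
  shows "mtdeg p = mdegV V p"
proof -
  have "(\<Sum>i\<in>keys m. lookup m i) = (\<Sum>i\<in>V. lookup m i)"
    if "m \<in> keys p" for m
    by (rule sum.mono_neutral_left) (use assms that in \<open>auto simp: mvars_def simp flip: not_in_keys_iff_lookup_eq_zero\<close>)
  thus ?thesis unfolding mtdeg_def mdegV_def by (simp cong: image_cong)
qed

section \<open>The product formula for resultants\<close>

text \<open>Each row lists the coefficients of a monomial multiple of \<open>p\<close> or
  \<open>q\<close>, so that row operations can be carried out on polynomials. Only degree bounds are
  assumed, because specialization may lower degrees.\<close>

lemma sylvester_mat_sub_rows:
  assumes "degree p \<le> m" "degree q \<le> n"
  shows "sylvester_mat_sub m n p q = mat (m + n) (m + n) (\<lambda>(i, j).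
    coeff (if i < n then monom 1 (n - 1 - i) * p else monom 1 (m + n - 1 - i) * (q::'a::comm_ring_1 poly)) (m + n - 1 - j))"
proof (rule eq_matI)
  fix i j assume "i < dim_row (mat (m + n) (m + n) (\<lambda>(i, j).
    coeff (if i < n then monom 1 (n - 1 - i) * p else monom 1 (m + n - 1 - i) * q) (m + n - 1 - j)))"
   "j < dim_col (mat (m + n) (m + n) (\<lambda>(i, j).
    coeff (if i < n then monom 1 (n - 1 - i) * p else monom 1 (m + n - 1 - i) * q) (m + n - 1 - j)))"
  hence ij: "i < m + n" "j < m + n" by auto
  show "sylvester_mat_sub m n p q $$ (i, j) = mat (m + n) (m + n) (\<lambda>(i, j).
    coeff (if i < n then monom 1 (n - 1 - i) * p else monom 1 (m + n - 1 - i) * q) (m + n - 1 - j)) $$ (i, j)"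
  proof (cases "i < n")
    case True
    have "n - 1 - i \<le> m + n - 1 - j \<longleftrightarrow> j \<le> m + i" using True ij by auto
    moreover have "j \<le> m + i \<Longrightarrow> m + n - 1 - j - (n - 1 - i) = m + i - j" using True ij by auto
    moreover have "j < i \<Longrightarrow> coeff p (m + i - j) = 0" using assms by (intro coeff_eq_0) auto
    ultimately show ?thesis using True ij
      by (auto simp: sylvester_mat_sub_index coeff_monom_mult not_le)
  next
    case False
    have "m + n - 1 - i \<le> m + n - 1 - j \<longleftrightarrow> j \<le> i" using False ij by auto
    moreover have "j \<le> i \<Longrightarrow> m + n - 1 - j - (m + n - 1 - i) = i - j" using False ij by auto
    moreover have "j < i - n \<Longrightarrow> coeff q (i - j) = 0" using assms by (intro coeff_eq_0) auto
    ultimately show ?thesis using False ij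
      by (auto simp: sylvester_mat_sub_index coeff_monom_mult not_le)
  qed
qed auto

lemma det_bidiagonal:
  fixes h :: "nat \<Rightarrow> 'a::idom"
  shows "det (mat n n (\<lambda>(i, j). if i = j then 1 else if j = Suc i then h i else 0)) = 1"
    (is "det ?C = 1")
proof -
  have "det ?C = prod_list (diag_mat ?C)"
    by (rule det_upper_triangular[of _ n]) (auto simp: upper_triangular_def)
  also have "diag_mat ?C = map (\<lambda>_. 1) [0..<n]"
    unfolding diag_mat_def by (rule map_cong) auto
  also have "prod_list \<dots> = 1" by (induction n) auto
  finally show ?thesis .
qed

text \<open>With coefficients in descending order, multiplication by \<open>[:-\<alpha>, 1:]\<close>
  acts on rows as a unit bidiagonal matrix. The quotients, with a last column of remainders, form
  the other matrix factor; that column has the single entry \<rho>, in the last row, and is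
  expanded.\<close>

lemma det_coeff_rows_linear_factor:
  fixes Q :: "nat \<Rightarrow> 'a::idom poly"
  assumes "\<And>i. i \<le> N \<Longrightarrow> coeff (Q i) N = 0"
    and P: "\<And>i. i \<le> N \<Longrightarrow> P i = [:-\<alpha>, 1:] * Q i + [:if i = N then \<rho> else 0:]"
  shows "det (mat (Suc N) (Suc N) (\<lambda>(i, j). coeff (P i) (N - j)))
    = \<rho> * det (mat N N (\<lambda>(i, j). coeff (Q i) (N - 1 - j)))"
proof -
  define B where "B = mat (Suc N) (Suc N)
    (\<lambda>(i, j). if j < N then coeff (Q i) (N - 1 - j) else if i = N then \<rho> else 0)"
  define C where "C = mat (Suc N) (Suc N) (\<lambda>(i, j). if i = j then 1 else if j = Suc i then - \<alpha> else 0)"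
  have carr: "B \<in> carrier_mat (Suc N) (Suc N)" "C \<in> carrier_mat (Suc N) (Suc N)"
    by (auto simp: B_def C_def)
  have "mat (Suc N) (Suc N) (\<lambda>(i, j). coeff (P i) (N - j)) = B * C"
  proof (rule eq_matI)
    fix i j assume "i < dim_row (B * C)" "j < dim_col (B * C)"
    hence ij: "i \<le> N" "j \<le> N" using carr by auto
    have "(B * C) $$ (i, j) = (\<Sum>k = 0..<Suc N. B $$ (i, k) * C $$ (k, j))"
      using ij carr by (simp add: scalar_prod_def)
    also have "\<dots> = (\<Sum>k = 0..<Suc N. (if k = j then B $$ (i, j) else 0)
        + (if k = j - 1 \<and> j > 0 then - \<alpha> * B $$ (i, j - 1) else 0))"
      by (rule sum.cong) (use ij in \<open>auto simp: C_def\<close>)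
    also have "\<dots> = B $$ (i, j) + (if j > 0 then - \<alpha> * B $$ (i, j - 1) else 0)"
      using ij by (cases "j > 0") (auto simp: sum.distrib)
    also have "\<dots> = coeff (P i) (N - j)"
    proof (cases "N - j")
      case 0
      hence j: "j = N" using ij by simp
      show ?thesis
        using j ij assms(1)[of i] by (auto simp: P B_def coeff_mult_0)
    next
      case (Suc l)
      hence l: "l = N - 1 - j" "j < N" by auto
      have "coeff (P i) (Suc l) = coeff (Q i) l - \<alpha> * coeff (Q i) (Suc l)"
        using ij by (simp add: P)
      moreover have "j = 0 \<Longrightarrow> coeff (Q i) (Suc l) = 0" using Suc ij assms(1)[of i] by simp
      moreover have "j > 0 \<Longrightarrow> N - 1 - (j - 1) = Suc l" using Suc by simp
      ultimately show ?thesis using Suc l ij by (auto simp: B_def)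
    qed
    finally show "mat (Suc N) (Suc N) (\<lambda>(i, j). coeff (P i) (N - j)) $$ (i, j) = (B * C) $$ (i, j)"
      using ij by simp
  qed (use carr in auto)
  hence "det (mat (Suc N) (Suc N) (\<lambda>(i, j). coeff (P i) (N - j))) = det B"
    using det_mult[OF carr] by (simp add: C_def det_bidiagonal)
  also have "\<dots> = (\<Sum>i<Suc N. B $$ (i, N) * cofactor B i N)"
    by (rule laplace_expansion_column[OF carr(1)]) simp
  also have "\<dots> = (\<Sum>i<Suc N. if i = N then \<rho> * cofactor B N N else 0)"
    by (rule sum.cong) (auto simp: B_def)
  also have "\<dots> = \<rho> * det (mat_delete B N N)"
    by (simp add: cofactor_def)
  also have "mat_delete B N N = mat N N (\<lambda>(i, j). coeff (Q i) (N - 1 - j))"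
    by (rule eq_matI) (auto simp: mat_delete_def B_def)
  finally show ?thesis .
qed

text \<open>Induction removes one root \<alpha> of the first polynomial. Its rows are divisible by
  the linear factor; the rows of \<open>q\<close> become divisible after subtracting \<alpha> times
  the next row, except the last one, which leaves the remainder
  \<open>poly q \<alpha>\<close>.\<close>

lemma resultant_sub_split:
  fixes q :: "'a::idom poly"
  assumes "degree q \<le> n"
  shows "resultant_sub (length as) n (Polynomial.smult c (\<Prod>\<alpha>\<leftarrow>as. [:-\<alpha>, 1:])) q
    = c ^ n * (\<Prod>\<alpha>\<leftarrow>as. poly q \<alpha>)"
proof (induction as)
  case Nil
  have "sylvester_mat_sub 0 n [:c:] q = c \<cdot>\<^sub>m 1\<^sub>m n"
    by (rule eq_matI) (auto simp: sylvester_mat_sub_index)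
  thus ?case by (simp add: resultant_sub_def)
next
  case (Cons \<alpha> as)
  define p1 where "p1 = Polynomial.smult c (\<Prod>\<alpha>\<leftarrow>as. [:-\<alpha>, 1:])"
  define p where "p = [:-\<alpha>, 1:] * p1"
  define m where "m = length as"
  define N where "N = m + n"
  have "degree (\<Prod>\<alpha>\<leftarrow>as. [:-\<alpha>, 1:]) = length as"
  proof (induction as)
    case (Cons a as)
    have "(\<Prod>\<alpha>\<leftarrow>as. [:-\<alpha>, 1:]) \<noteq> 0" by (auto simp: prod_list_zero_iff)
    thus ?case using Cons by (simp add: degree_mult_eq del: mult_pCons_left)
  qed simp
  hence deg1: "degree p1 \<le> m" unfolding p1_def m_def by (metis degree_smult_le)
  hence deg: "degree p \<le> Suc m" unfolding p_def using degree_mult_le[of "[:-\<alpha>, 1:]" p1] by simp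
  define P where "P = (\<lambda>i. if i < n then monom 1 (n - 1 - i) * p else monom 1 (N - i) * q)"
  \<comment> \<open>Consecutive rows of \<open>q\<close> differ by one power of the variable, so
    this difference is the linear factor times the lower of the two.\<close>
  define P' where "P' = (\<lambda>i. if n \<le> i \<and> i < N then P i - Polynomial.smult \<alpha> (P (Suc i)) else P i)"
  define Q where "Q = (\<lambda>i. if i < n then monom 1 (n - 1 - i) * p1
    else if i < N then monom 1 (N - 1 - i) * q else synthetic_div q \<alpha>)"
  define R where "R = mat (Suc N) (Suc N) (\<lambda>(i, j). if i = j then 1 else if j = Suc i then
      (if n \<le> i then - \<alpha> else 0) else 0)"
  define A where "A = mat (Suc N) (Suc N) (\<lambda>(i, j). coeff (P i) (N - j))"
  have carr: "R \<in> carrier_mat (Suc N) (Suc N)" "A \<in> carrier_mat (Suc N) (Suc N)"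
    by (auto simp: R_def A_def)
  have "sylvester_mat_sub (Suc m) n p q = A"
    unfolding sylvester_mat_sub_rows[OF deg assms] A_def P_def N_def by auto
  hence "resultant_sub (Suc m) n p q = det A" by (simp add: resultant_sub_def)
  also have "det A = det (R * A)" using det_mult[OF carr] by (simp add: R_def det_bidiagonal)
  also have "R * A = mat (Suc N) (Suc N) (\<lambda>(i, j). coeff (P' i) (N - j))"
  proof (rule eq_matI)
    fix i j assume "i < dim_row (mat (Suc N) (Suc N) (\<lambda>(i, j). coeff (P' i) (N - j)))"
      "j < dim_col (mat (Suc N) (Suc N) (\<lambda>(i, j). coeff (P' i) (N - j)))"
    hence ij: "i \<le> N" "j \<le> N" by auto
    have "(R * A) $$ (i, j) = (\<Sum>k = 0..<Suc N. R $$ (i, k) * A $$ (k, j))"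
      using ij carr by (simp add: scalar_prod_def)
    also have "\<dots> = (\<Sum>k = 0..<Suc N. (if k = i then A $$ (i, j) else 0)
        + (if k = Suc i then (if n \<le> i then - \<alpha> * A $$ (Suc i, j) else 0) else 0))"
      by (rule sum.cong) (use ij in \<open>auto simp: R_def\<close>)
    also have "\<dots> = A $$ (i, j) + (if i < N \<and> n \<le> i then - \<alpha> * A $$ (Suc i, j) else 0)"
      using ij by (auto simp: sum.distrib)
    also have "\<dots> = coeff (P' i) (N - j)" using ij by (auto simp: A_def P'_def)
    finally show "(R * A) $$ (i, j) = mat (Suc N) (Suc N) (\<lambda>(i, j). coeff (P' i) (N - j)) $$ (i, j)"
      using ij by simp
  qed (use carr in auto)
  also have "det \<dots> = poly q \<alpha> * det (mat N N (\<lambda>(i, j). coeff (Q i) (N - 1 - j)))"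
  proof (rule det_coeff_rows_linear_factor)
    fix i assume i: "i \<le> N"
    have dm: "degree (monom 1 k * r) \<le> k + degree r" for k and r :: "'a poly"
      using degree_mult_le[of "monom 1 k" r] by (simp add: degree_monom_eq)
    consider "i < n" | "n \<le> i" "i < N" | "n \<le> i" "i = N" using i by linarith
    thus "coeff (Q i) N = 0"
    proof cases
      case 1
      have "degree (Q i) < N" using 1 dm[of "n - 1 - i" p1] deg1 by (simp add: Q_def N_def)
      thus ?thesis by (rule coeff_eq_0)
    next
      case 2
      have "degree (Q i) < N" using 2 dm[of "N - 1 - i" q] assms by (simp add: Q_def)
      thus ?thesis by (rule coeff_eq_0)
    next
      case 3
      show ?thesis
      proof (cases "degree q = 0")
        case True
        hence "synthetic_div q \<alpha> = 0" by (simp add: synthetic_div_eq_0_iff)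
        thus ?thesis using 3 by (simp add: Q_def)
      next
        case False
        thus ?thesis using 3 assms by (intro coeff_eq_0) (auto simp: Q_def degree_synthetic_div N_def)
      qed
    qed
    show "P' i = [:-\<alpha>, 1:] * Q i + [:if i = N then poly q \<alpha> else 0:]"
      using \<open>i \<le> N\<close>
    proof (cases "i < N \<and> n \<le> i")
      case True
      hence "N - i = Suc (N - 1 - i)" "N - Suc i = N - 1 - i" by auto
      hence "P' i = [:0, 1:] * (monom 1 (N - 1 - i) * q) - Polynomial.smult \<alpha> (monom 1 (N - 1 - i) * q)"
        using True by (simp add: P'_def P_def monom_Suc)
      thus ?thesis using True by (simp add: Q_def)
    next
      case False
      hence "i < n \<or> i = N" using i by auto
      thus ?thesis
      proof
        assume "i < n"
        moreover have "i \<noteq> N" using \<open>i < n\<close> by (simp add: N_def)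
        ultimately show ?thesis
          by (simp add: P'_def P_def Q_def p_def mult_ac del: mult_pCons_left mult_pCons_right)
      next
        assume "i = N"
        thus ?thesis using False synthetic_div_correct'[of \<alpha> q]
          by (simp add: P'_def P_def Q_def N_def)
      qed
    qed
  qed
  also have "mat N N (\<lambda>(i, j). coeff (Q i) (N - 1 - j)) = sylvester_mat_sub m n p1 q"
    unfolding sylvester_mat_sub_rows[OF deg1 assms] by (rule eq_matI) (auto simp: Q_def N_def)
  also have "det \<dots> = c ^ n * (\<Prod>\<alpha>\<leftarrow>as. poly q \<alpha>)"
    using Cons.IH by (simp add: resultant_sub_def p1_def m_def)
  finally show ?case by (simp add: p_def p1_def m_def mult_ac)
qed

text \<open>The Sylvester matrix is built from the degrees before \<open>h\<close> is applied, and
  \<open>det\<close> commutes with \<open>h\<close>. Hence the exponent is the degree of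
  \<open>H\<close> itself even if its image has smaller degree, and \<open>as\<close> must have the
  degree of \<open>G\<close> as its length.\<close>

lemma hom_resultant_split:
  fixes G H :: "'a::comm_ring_1 poly" and h :: "'a \<Rightarrow> 'b::idom"
  assumes "comm_ring_hom h" "map_poly h G = Polynomial.smult (h (lead_coeff G)) (\<Prod>\<alpha>\<leftarrow>as. [:-\<alpha>, 1:])"
    and "length as = degree G"
  shows "h (resultant G H) = h (lead_coeff G) ^ degree H * (\<Prod>\<alpha>\<leftarrow>as. poly (map_poly h H) \<alpha>)"
proof -
  interpret h: comm_ring_hom h by fact
  have "h (resultant G H) = resultant_sub (degree G) (degree H) (map_poly h G) (map_poly h H)"
    unfolding resultant_sub resultant_sub_def h.hom_det[symmetric]
    by (simp add: sylvester_mat_sub_map)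
  thus ?thesis
    using resultant_sub_split[of "map_poly h H" "degree H" as "h (lead_coeff G)"] degree_map_poly_le[of h H]
    by (simp add: assms(2,3))
qed

section \<open>Elimination, common zeros and orders of bivariate polynomials\<close>

lemma complex_hom_split:
  fixes G :: "'a::comm_ring_1 poly" and h :: "'a \<Rightarrow> complex"
  assumes "comm_ring_hom h" "h (lead_coeff G) \<noteq> 0"
  obtains as where "map_poly h G = Polynomial.smult (h (lead_coeff G)) (\<Prod>\<alpha>\<leftarrow>as. [:-\<alpha>, 1:])"
    "length as = degree G"
proof -
  interpret h: comm_ring_hom h by fact
  have "coeff (map_poly h G) (degree G) \<noteq> 0" using assms(2) by (simp add: coeff_map_poly)
  hence deg: "degree (map_poly h G) = degree G"
    using le_degree degree_map_poly_le by (metis le_antisym)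
  obtain as where *: "Polynomial.smult (coeff (map_poly h G) (degree (map_poly h G))) (\<Prod>\<alpha>\<leftarrow>as. [:-\<alpha>, 1:])
      = map_poly h G" "length as = degree (map_poly h G)"
    using fundamental_theorem_algebra_factorized by blast
  have "coeff (map_poly h G) (degree (map_poly h G)) = h (lead_coeff G)"
    unfolding deg by (simp add: coeff_map_poly)
  thus ?thesis using that[of as] * deg by metis
qed

text \<open>The eliminant is the resultant times the leading coefficient of \<open>G\<close>. A
  common root makes a factor of the product formula vanish; the leading coefficient covers the
  specializations at which \<open>G\<close> loses degree.\<close>

lemma eliminant_exists:
  fixes G H :: "'a::{factorial_ring_gcd,semiring_gcd_mult_normalize} poly"
  assumes "degree (gcd G H) = 0" "G \<noteq> 0"
  obtains r where "r \<noteq> 0"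
    "\<And>(h :: 'a \<Rightarrow> complex) x. comm_ring_hom h \<Longrightarrow> poly (map_poly h G) x = 0 \<Longrightarrow> poly (map_poly h H) x = 0 \<Longrightarrow> h r = 0"
proof
  show "lead_coeff G * resultant G H \<noteq> 0"
    using assms resultant_0_gcd[of G H] by simp
  fix h :: "'a \<Rightarrow> complex" and x
  assume h: "comm_ring_hom h" and 0: "poly (map_poly h G) x = 0" "poly (map_poly h H) x = 0"
  interpret h: comm_ring_hom h by fact
  show "h (lead_coeff G * resultant G H) = 0"
  proof (cases "h (lead_coeff G) = 0")
    case False
    obtain as where as: "map_poly h G = Polynomial.smult (h (lead_coeff G)) (\<Prod>\<alpha>\<leftarrow>as. [:-\<alpha>, 1:])"
      "length as = degree G" using complex_hom_split[OF h False] .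
    have "x \<in> set as" using 0(1) False unfolding as(1)
      by (auto simp: poly_prod_list o_def prod_list_zero_iff)
    hence "(\<Prod>\<alpha>\<leftarrow>as. poly (map_poly h H) \<alpha>) = 0" using 0(2) by (force simp: prod_list_zero_iff)
    thus ?thesis using hom_resultant_split[OF h as, of H] by (simp add: h.hom_mult)
  qed (simp add: h.hom_mult)
qed

lemma eval2_map_poly: "eval2 Q a b = poly (map_poly (\<lambda>c. poly c b) Q) a"
proof (rule comm_ring_hom_unique_on_poly[OF eval2_hom map_poly_eval_hom[OF poly_eval_hom]])
  show "eval2 [:c:] a b = poly (map_poly (\<lambda>c. poly c b) [:c:]) a" for c
    by (simp add: eval2_def Polynomial.map_poly_pCons)
  show "eval2 [:0, 1:] a b = poly (map_poly (\<lambda>c. poly c b) [:0, 1:]) a"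
    by (simp add: eval2_def Polynomial.map_poly_pCons)
qed

lemma eval3_map_poly: "eval3 Q x d k = poly (map_poly (\<lambda>c. eval2 c d k) Q) x"
proof (rule comm_ring_hom_unique_on_poly[OF eval3_hom map_poly_eval_hom[OF eval2_hom]])
  show "eval3 [:c:] x d k = poly (map_poly (\<lambda>c. eval2 c d k) [:c:]) x" for c
    by (simp add: eval3_def eval2_def Polynomial.map_poly_pCons)
  show "eval3 [:0, 1:] x d k = poly (map_poly (\<lambda>c. eval2 c d k) [:0, 1:]) x"
    by (simp add: eval3_def eval2_def Polynomial.map_poly_pCons)
qed

lemma eventually_poly_nonzero: "p \<noteq> 0 \<Longrightarrow> \<forall>\<^sub>F x in cofinite. poly (p :: 'a::idom poly) x \<noteq> 0"
  by (simp add: eventually_cofinite poly_roots_finite)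

lemma eventually_map_poly_nonzero:
  assumes "(Q :: complex poly poly) \<noteq> 0"
  shows "\<forall>\<^sub>F k in cofinite. map_poly (\<lambda>c. poly c k) Q \<noteq> 0"
proof -
  have "lead_coeff Q \<noteq> 0" using assms by simp
  from eventually_poly_nonzero[OF this] show ?thesis
    by eventually_elim (auto simp: poly_eq_iff coeff_map_poly)
qed

lemma irreducible_gcd_degree_0:
  fixes G :: "'a::{factorial_ring_gcd,semiring_gcd_mult_normalize} poly"
  assumes "irreducible G" "\<not> G dvd H"
  shows "degree (gcd G H) = 0"
proof -
  have "\<not> G dvd gcd G H" using assms(2) by auto
  hence "is_unit (gcd G H)" using assms(1) by (meson gcd_dvd1 irreducibleD')
  thus ?thesis by (rule is_unit_polyE) auto
qed

lemma eval2_slice_zero_imp_dvd: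
  assumes "map_poly (\<lambda>c. poly c b) (Q :: complex poly poly) = 0"
  shows "[:[:-b, 1:]:] dvd Q"
  unfolding const_poly_dvd_iff
proof
  fix n
  have "poly (coeff Q n) b = coeff (map_poly (\<lambda>c. poly c b) Q) n" by (simp add: coeff_map_poly)
  thus "[:-b, 1:] dvd coeff Q n" using assms unfolding poly_eq_0_iff_dvd[symmetric] by simp
qed

text \<open>An eliminant leaves finitely many values b. On such a level \<open>G\<close> has
  finitely many zeros unless it vanishes on the whole level; then \<open>G\<close> is up to a unit
  the linear polynomial of that level, which does not divide \<open>H\<close>, so \<open>H\<close>
  has finitely many zeros there.\<close>

lemma finite_common_zeros:
  assumes G: "irreducible (G :: complex poly poly)" and ndvd: "\<not> G dvd H"
  shows "finite {(a, b). eval2 G a b = 0 \<and> eval2 H a b = 0}"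
proof -
  have "G \<noteq> 0" using G by (auto simp: irreducible_def)
  then obtain r where r: "r \<noteq> 0" "\<And>(h :: complex poly \<Rightarrow> complex) x. comm_ring_hom h \<Longrightarrow>
      poly (map_poly h G) x = 0 \<Longrightarrow> poly (map_poly h H) x = 0 \<Longrightarrow> h r = 0"
    using eliminant_exists[OF irreducible_gcd_degree_0[OF G ndvd]] by blast
  define B where "B = {b. poly r b = 0}"
  have "finite B" unfolding B_def using r(1) by (rule poly_roots_finite)
  have slice: "finite {a. eval2 G a b = 0 \<and> eval2 H a b = 0}" for b
  proof (cases "map_poly (\<lambda>c. poly c b) G = 0")
    case False
    have "finite {a. eval2 G a b = 0}"
      unfolding eval2_map_poly using False by (rule poly_roots_finite)
    thus ?thesis by (rule rev_finite_subset) auto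
  next
    case True
    let ?l = "[:[:-b, 1:]:] :: complex poly poly"
    have "?l dvd G" using True by (rule eval2_slice_zero_imp_dvd)
    moreover have "\<not> is_unit ?l" by (auto simp: is_unit_poly_iff is_unit_triv)
    ultimately have "G dvd ?l" using G by (meson irreducibleD')
    hence "map_poly (\<lambda>c. poly c b) H \<noteq> 0"
      using ndvd eval2_slice_zero_imp_dvd[of b H] dvd_trans by blast
    hence "finite {a. eval2 H a b = 0}"
      unfolding eval2_map_poly by (rule poly_roots_finite)
    thus ?thesis by (rule rev_finite_subset) auto
  qed
  have "{(a, b). eval2 G a b = 0 \<and> eval2 H a b = 0}
      \<subseteq> (\<Union>b\<in>B. {a. eval2 G a b = 0 \<and> eval2 H a b = 0} \<times> {b})"
    using r(2)[OF poly_eval_hom] by (auto simp: B_def eval2_map_poly)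
  thus ?thesis
    by (rule finite_subset) (use slice \<open>finite B\<close> in auto)
qed

lemma pderiv_poly_const: "pderiv (poly Q [:t:]) = poly (map_poly pderiv Q) [:t:]"
  for Q :: "complex poly poly"
  by (induction Q) (simp_all add: pderiv_add pderiv_smult Polynomial.map_poly_pCons)

lemma pderiv_map_poly_eval: "pderiv (map_poly (\<lambda>c. poly c k) Q) = map_poly (\<lambda>c. poly c k) (pderiv Q)"
  for Q :: "complex poly poly"
  by (rule poly_eqI) (simp add: coeff_pderiv coeff_map_poly)

lemma order_eq_1I:
  fixes p :: "'a::field_char_0 poly"
  assumes "poly p a = 0" "poly (pderiv p) a \<noteq> 0"
  shows "order a p = 1"
proof -
  have "pderiv p \<noteq> 0" "p \<noteq> 0" using assms(2) by auto
  thus ?thesis using assms order_pderiv[of p a] order_root[of p a] order_0I[of "pderiv p" a] by simp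
qed

lemma eventually_no_common_zero:
  assumes "irreducible (G :: complex poly poly)" "\<not> G dvd H"
  shows "\<forall>\<^sub>F b in cofinite. \<forall>a. \<not> (eval2 G a b = 0 \<and> eval2 H a b = 0)"
proof -
  have "{b. \<not> (\<forall>a. \<not> (eval2 G a b = 0 \<and> eval2 H a b = 0))}
      \<subseteq> snd ` {(a, b). eval2 G a b = 0 \<and> eval2 H a b = 0}" by force
  thus ?thesis unfolding eventually_cofinite
    using finite_common_zeros[OF assms] finite_subset by blast
qed

text \<open>At a generic zero of a bivariate polynomial both partial orders equal the exponent of the
  irreducible factor through that zero.\<close>

lemma eventually_order_swap:
  assumes "(Q :: complex poly poly) \<noteq> 0" "\<And>t. poly Q [:t:] \<noteq> 0"
  shows "\<forall>\<^sub>F k in cofinite. \<forall>t. order t (map_poly (\<lambda>c. poly c k) Q) = order k (poly Q [:t:])"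
  using assms
proof (induction Q rule: prime_divisors_induct)
  case zero
  thus ?case by simp
next
  case (unit Q)
  then obtain c where "Q = [:c:]" "is_unit c" by (auto elim: is_unit_polyE)
  then obtain e where "Q = [:[:e:]:]" "e \<noteq> 0"
    by (metis degree_eq_zeroE is_unit_iff_degree not_is_unit_0 pCons_0_0)
  thus ?case by (simp add: Polynomial.map_poly_pCons order_0I)
next
  case (factor p Q)
  have p: "irreducible p" using factor by (simp add: prime_elem_imp_irreducible)
  have p0: "p \<noteq> 0" "Q \<noteq> 0" and pt: "poly p [:t:] \<noteq> 0" "poly Q [:t:] \<noteq> 0" for t
    using factor.prems by auto
  have "\<forall>\<^sub>F k in cofinite. \<forall>t. order t (map_poly (\<lambda>c. poly c k) p) = order k (poly p [:t:])"
  proof (cases "degree p = 0")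
    case True
    then obtain c where c: "p = [:c:]" by (rule degree_eq_zeroE)
    hence "c \<noteq> 0" using p0 by auto
    from eventually_poly_nonzero[OF this] show ?thesis
      by eventually_elim (simp add: c Polynomial.map_poly_pCons order_0I)
  next
    case False
    have "\<not> p dvd pderiv p" using False by (rule not_dvd_pderiv)
    note ev1 = eventually_no_common_zero[OF p this]
    show ?thesis
    \<comment> \<open>If the derivative in k is a multiple of \<open>p\<close>, each slice at fixed
      t divides its own derivative. It is then constant and nonzero by assumption, so
      \<open>p\<close> has no zeros.\<close>
    proof (cases "p dvd map_poly pderiv p")
      case True
      then obtain r where r: "map_poly pderiv p = p * r" by (elim dvdE)
      have nz: "eval2 p t k \<noteq> 0" for t k
      proof -
        have "poly p [:t:] dvd pderiv (poly p [:t:])"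
          by (simp add: pderiv_poly_const r)
        hence "degree (poly p [:t:]) = 0" using not_dvd_pderiv by blast
        then obtain e where "poly p [:t:] = [:e:]" by (rule degree_eq_zeroE)
        thus ?thesis using pt(1)[of t] by (auto simp: eval2_def)
      qed
      have "order t (map_poly (\<lambda>c. poly c k) p) = 0" "order k (poly p [:t:]) = 0" for t k
        using nz[of t k] by (auto intro!: order_0I simp: eval2_map_poly) (auto simp: eval2_def simp flip: eval2_map_poly)
      thus ?thesis by simp
    next
      case False
      \<comment> \<open>For all but finitely many k, neither partial derivative vanishes at a zero
        of \<open>p\<close> on this level, so such a zero is simple in both directions.\<close>
      from eventually_no_common_zero[OF p this] ev1 show ?thesis
      proof eventually_elim
        case (elim k)
        show ?case
        proof
          fix t
          show "order t (map_poly (\<lambda>c. poly c k) p) = order k (poly p [:t:])"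
          proof (cases "eval2 p t k = 0")
            case True
            have "order t (map_poly (\<lambda>c. poly c k) p) = 1"
              by (rule order_eq_1I) (use True elim in \<open>auto simp: pderiv_map_poly_eval simp flip: eval2_map_poly\<close>)
            moreover have "order k (poly p [:t:]) = 1"
              by (rule order_eq_1I) (use True elim in \<open>auto simp: pderiv_poly_const eval2_def\<close>)
            ultimately show ?thesis by simp
          next
            case False
            have "order t (map_poly (\<lambda>c. poly c k) p) = 0"
              by (rule order_0I) (use False in \<open>simp flip: eval2_map_poly\<close>)
            moreover have "order k (poly p [:t:]) = 0"
              by (rule order_0I) (use False in \<open>simp add: eval2_def\<close>)
            ultimately show ?thesis by simp
          qed
        qed
      qed
    qed
  qed
  moreover have "\<forall>\<^sub>F k in cofinite. \<forall>t. order t (map_poly (\<lambda>c. poly c k) Q) = order k (poly Q [:t:])"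
    by (rule factor.IH) (use p0 pt in auto)
  ultimately show ?case
    using eventually_map_poly_nonzero[OF p0(1)] eventually_map_poly_nonzero[OF p0(2)]
  proof eventually_elim
    case (elim k)
    interpret m: map_poly_comm_ring_hom "\<lambda>c. poly c k"
      by (simp add: map_poly_comm_ring_hom_def poly_eval_hom)
    show ?case using elim pt by (simp add: m.hom_mult order_mult)
  qed
qed

section \<open>Derivatives along polynomial curves\<close>

text \<open>The subtraction of exponents is truncated. A variable that does not occur carries the
  coefficient \<open>of_nat 0\<close>, which removes the monomial that truncation leaves
  behind.\<close>

lemma pderiv_mmon:
  fixes r :: "nat \<Rightarrow> complex poly"
  assumes "finite V" "keys m \<subseteq> V"
  shows "pderiv (mmon r m) = (\<Sum>i\<in>V. of_nat (lookup m i)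
    * mmon r (m - single i 1) * pderiv (r i))"
proof -
  have "pderiv (mmon r m) = (\<Sum>i\<in>V. (\<Prod>j\<in>V - {i}. r j ^ lookup m j)
      * pderiv (r i ^ lookup m i))"
    unfolding mmon_superset[OF assms] by (rule pderiv_prod)
  also have "\<dots> = (\<Sum>i\<in>V. of_nat (lookup m i)
    * mmon r (m - single i 1) * pderiv (r i))"
  proof (rule sum.cong[OF refl])
    fix i assume i: "i \<in> V"
    have "mmon r (m - single i 1)
      = (\<Prod>j\<in>V. r j ^ lookup (m - single i 1) j)"
      by (rule mmon_superset[OF assms(1)])
        (use assms(2) in \<open>auto simp: in_keys_iff lookup_minus subset_iff\<close>)
    also have "\<dots> = r i ^ (lookup m i - 1) * (\<Prod>j\<in>V - {i}. r j ^ lookup m j)"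
      by (subst prod.remove[OF assms(1) i])
        (auto simp: lookup_minus lookup_single intro!: prod.cong)
    finally have *: "mmon r (m - single i 1)
      = r i ^ (lookup m i - 1) * (\<Prod>j\<in>V - {i}. r j ^ lookup m j)" .
    show "(\<Prod>j\<in>V - {i}. r j ^ lookup m j) * pderiv (r i ^ lookup m i)
      = of_nat (lookup m i) * mmon r (m - single i 1) * pderiv (r i)"
      unfolding * by (simp add: pderiv_power mult_ac of_nat_poly)
  qed
  finally show ?thesis .
qed

lemma mev_mpderiv:
  assumes "comm_ring_hom \<phi>"
  shows "mev \<phi> a (mpderiv i p) = (\<Sum>m\<in>keys p.
    \<phi> (of_nat (lookup m i) * lookup p m) * mmon a (m - single i 1))"
proof -
  interpret mev_hom \<phi> a using assms by (simp add: mev_hom_def)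
  show ?thesis unfolding mpderiv_def mev_sum mev_single ..
qed

abbreviation curve_mev :: "(nat \<Rightarrow> complex poly) \<Rightarrow> mpoly \<Rightarrow> complex poly" where
  "curve_mev \<equiv> mev (\<lambda>c. [:c:])"

text \<open>The chain rule. Formal partial derivatives enter the geometry below through derivatives
  along polynomial curves.\<close>

lemma pderiv_curve_mev:
  assumes "finite V" "mvars p \<subseteq> V"
  shows "pderiv (curve_mev r p) = (\<Sum>i\<in>V. curve_mev r (mpderiv i p) * pderiv (r i))"
proof -
  have "pderiv (curve_mev r p) = (\<Sum>m\<in>keys p. \<Sum>i\<in>V.
     [:of_nat (lookup m i) * lookup p m:] * mmon r (m - single i 1) * pderiv (r i))"
    unfolding mev_def pderiv_sum
  proof (rule sum.cong[OF refl])
    fix m assume m: "m \<in> keys p"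
    hence "keys m \<subseteq> V" using assms(2) by (auto simp: mvars_def)
    from pderiv_mmon[OF assms(1) this, of r]
    show "pderiv ([:lookup p m:] * mmon r m) = (\<Sum>i\<in>V.
     [:of_nat (lookup m i) * lookup p m:] * mmon r (m - single i 1) * pderiv (r i))"
      by (simp add: pderiv_smult smult_sum2 of_nat_poly mult_ac)
  qed
  also have "\<dots> = (\<Sum>i\<in>V. curve_mev r (mpderiv i p) * pderiv (r i))"
    by (subst sum.swap) (simp only: mev_mpderiv[OF const_poly_hom] sum_distrib_right)
  finally show ?thesis .
qed

lemma mvars_mpderiv: "mvars (mpderiv i p) \<subseteq> mvars p"
proof -
  have "mvars (single (m - single i 1)
        (of_nat (lookup m i) * lookup p m)) \<subseteq> mvars p"
    if "m \<in> keys p" for m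
  proof -
    have "keys (m - single i 1) \<subseteq> keys m"
      by (auto simp: in_keys_iff lookup_minus)
    thus ?thesis using that by (auto simp: mvars_def)
  qed
  thus ?thesis unfolding mpderiv_def using mvars_sum by fastforce
qed

definition curve2 :: "complex poly \<Rightarrow> complex poly \<Rightarrow> mpoly \<Rightarrow> complex poly" where
  "curve2 A B = curve_mev (\<lambda>i. if i = 0 then A else if i = 1 then B else 0)"

definition curve3 :: "complex poly \<Rightarrow> complex poly \<Rightarrow> complex poly \<Rightarrow> mpoly \<Rightarrow> complex poly" where
  "curve3 A B C = curve_mev (\<lambda>i. if i = 0 then A else if i = 1 then B else if i = 2 then C else 0)"

lemma poly_curve2 [simp]: "poly (curve2 A B p) z = meval p (pt2 (poly A z) (poly B z))"
  unfolding curve2_def poly_mev_const by (rule arg_cong[where f = "meval p"]) (auto simp: pt2_def)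

lemma poly_curve3 [simp]: "poly (curve3 A B C p) z = meval p (pt3 (poly A z) (poly B z) (poly C z))"
  unfolding curve3_def poly_mev_const by (rule arg_cong[where f = "meval p"]) (auto simp: pt3_def)

lemma pderiv_curve2:
  "mvars p \<subseteq> {0, 1} \<Longrightarrow> pderiv (curve2 A B p)
    = curve2 A B (mpderiv 0 p) * pderiv A + curve2 A B (mpderiv 1 p) * pderiv B"
  unfolding curve2_def by (subst pderiv_curve_mev[of "{0, 1}"]) auto

lemma pderiv_curve3:
  "mvars p \<subseteq> {0, 1, 2} \<Longrightarrow> pderiv (curve3 A B C p)
    = curve3 A B C (mpderiv 0 p) * pderiv A + curve3 A B C (mpderiv 1 p) * pderiv B
      + curve3 A B C (mpderiv 2 p) * pderiv C"
  unfolding curve3_def by (subst pderiv_curve_mev[of "{0, 1, 2}"]) auto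

lemma poly_eq_complexI: "(\<And>z. poly p z = poly q z) \<Longrightarrow> p = (q :: complex poly)"
  using poly_eq_poly_eq_iff by blast

lemma meval_pt3_pt2: "mvars p \<subseteq> {0, 1} \<Longrightarrow> meval p (pt3 a b c) = meval p (pt2 a b)"
  by (rule meval_cong) (auto simp: pt2_def pt3_def)

section \<open>Zeros of the curve\<close>

locale plane_curve =
  fixes f :: mpoly
  assumes f_vars: "mvars f \<subseteq> {0, 1}"
    and f_irred: "irreducible f"
    and not_line: "\<not> (\<exists>a b c :: complex. (a, b) \<noteq> (0, 0) \<and>
          {(y1, y2). meval f (pt2 y1 y2) = 0} = {(y1, y2). a * y1 + b * y2 + c = 0})"
    and f_ndvd: "\<not> f dvd ((mpderiv 0 f)^2 + (mpderiv 1 f)^2)"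
begin

abbreviation fv where "fv y1 y2 \<equiv> meval f (pt2 y1 y2)"
abbreviation f1 where "f1 y1 y2 \<equiv> meval (mpderiv 0 f) (pt2 y1 y2)"
abbreviation f2 where "f2 y1 y2 \<equiv> meval (mpderiv 1 f) (pt2 y1 y2)"
abbreviation sg where "sg y1 y2 \<equiv> (f1 y1 y2)\<^sup>2 + (f2 y1 y2)\<^sup>2"

lemma partial_vars: "mvars (mpderiv i f) \<subseteq> {0, 1}"
  using mvars_mpderiv f_vars by blast

lemma finite_zeros_on_curve:
  assumes "mvars h \<subseteq> {0, 1}" "\<not> f dvd h"
  shows "finite {(y1, y2). fv y1 y2 = 0 \<and> meval h (pt2 y1 y2) = 0}"
proof -
  have "\<not> to_poly2 f dvd to_poly2 h" using assms to_poly2_dvd_iff f_vars by blast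
  from finite_common_zeros[OF to_poly2_irreducible[OF f_irred f_vars] this]
  show ?thesis by (simp add: eval2_to_poly2)
qed

text \<open>A line inside the curve gives infinitely many common zeros with its linear form
  \<open>l\<close>, so \<open>f\<close> divides \<open>l\<close>. The zero set of \<open>f\<close>
  then lies in the line as well as containing it, which \<open>not_line\<close> forbids.\<close>

lemma no_line_in_curve:
  assumes "(u, v) \<noteq> (0, 0)"
  shows "curve2 [:p1, u:] [:p2, v:] f \<noteq> 0"
proof
  assume 0: "curve2 [:p1, u:] [:p2, v:] f = 0"
  have van: "fv (p1 + s * u) (p2 + s * v) = 0" for s
    using arg_cong[OF 0, of "\<lambda>p. poly p s"] by simp
  define l where "l = mConst v * (mVar 0 - mConst p1) - mConst u * (mVar 1 - mConst p2)"
  have lv: "mvars l \<subseteq> {0, 1}"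
    unfolding l_def
    by (intro order.trans[OF mvars_diff] Un_least order.trans[OF mvars_mult]) auto
  have le: "meval l (pt2 y1 y2) = v * (y1 - p1) - u * (y2 - p2)" for y1 y2
    by (simp add: l_def meval.hom_minus meval.hom_mult pt2_def)
  have "inj (\<lambda>s. (p1 + s * u, p2 + s * v))" using assms by (auto simp: inj_def)
  hence "infinite (range (\<lambda>s. (p1 + s * u, p2 + s * v)))"
    using finite_imageD infinite_UNIV_char_0 by blast
  moreover have "range (\<lambda>s. (p1 + s * u, p2 + s * v)) \<subseteq> {(y1, y2). fv y1 y2 = 0 \<and> meval l (pt2 y1 y2) = 0}"
    using van by (auto simp: le)
  ultimately have "f dvd l" using finite_zeros_on_curve[OF lv] finite_subset by blast
  then obtain q where "l = f * q" by (elim dvdE)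
  hence sub: "fv y1 y2 = 0 \<Longrightarrow> meval l (pt2 y1 y2) = 0" for y1 y2 by (simp add: meval.hom_mult)
  have line: "\<exists>s. y1 = p1 + s * u \<and> y2 = p2 + s * v" if "v * (y1 - p1) - u * (y2 - p2) = 0" for y1 y2
  proof (cases "u = 0")
    case True
    thus ?thesis using that assms by (intro exI[of _ "(y2 - p2) / v"]) auto
  next
    case False
    thus ?thesis using that by (intro exI[of _ "(y1 - p1) / u"]) (auto simp: field_simps)
  qed
  have "fv y1 y2 = 0 \<longleftrightarrow> v * y1 + (- u) * y2 + (u * p2 - v * p1) = 0" for y1 y2
  proof
    assume "fv y1 y2 = 0"
    from sub[OF this] show "v * y1 + (- u) * y2 + (u * p2 - v * p1) = 0" by (simp add: le algebra_simps)
  next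
    assume "v * y1 + (- u) * y2 + (u * p2 - v * p1) = 0"
    hence "v * (y1 - p1) - u * (y2 - p2) = 0" by (simp add: algebra_simps)
    with line obtain s where "y1 = p1 + s * u" "y2 = p2 + s * v" by blast
    thus "fv y1 y2 = 0" using van by simp
  qed
  hence "{(y1, y2). fv y1 y2 = 0} = {(y1, y2). v * y1 + (- u) * y2 + (u * p2 - v * p1) = 0}" by auto
  thus False using not_line assms by (metis neg_equal_0_iff_equal prod.inject)
qed

text \<open>If y1 occurs in \<open>f\<close>, all but finitely many values of y2 carry a point of
  the curve; otherwise a root in y2 gives a whole horizontal line.\<close>

lemma infinite_curve: "infinite {(y1, y2). fv y1 y2 = 0}"
proof -
  let ?F = "to_poly2 f"
  have irr: "irreducible ?F" by (rule to_poly2_irreducible[OF f_irred f_vars])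
  have "infinite (snd ` {(y1, y2). fv y1 y2 = 0} \<union> fst ` {(y1, y2). fv y1 y2 = 0})"
  proof (cases "degree ?F = 0")
    case True
    then obtain c where c: "?F = [:c:]" by (rule degree_eq_zeroE)
    have "c \<noteq> 0" "\<not> is_unit c" using irr c by (auto simp: irreducible_def is_unit_poly_iff)
    hence "degree c \<noteq> 0" by (auto simp: is_unit_iff_degree)
    hence "\<not> constant (poly c)" by (simp add: constant_degree)
    then obtain b where "poly c b = 0" using fundamental_theorem_of_algebra by blast
    hence "fv a b = 0" for a by (simp add: c eval2_def flip: eval2_to_poly2)
    hence "fst ` {(y1, y2). fv y1 y2 = 0} = UNIV" by force
    thus ?thesis using infinite_UNIV_char_0[where 'a = complex] by simp
  next
    case False
    have "\<forall>\<^sub>F b in cofinite. b \<in> snd ` {(y1, y2). fv y1 y2 = 0}"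
    proof -
      have "lead_coeff ?F \<noteq> 0" using False by auto
      from eventually_poly_nonzero[OF this] show ?thesis
      proof eventually_elim
        case (elim b)
        have "degree (map_poly (\<lambda>c. poly c b) ?F) \<noteq> 0"
          using elim False le_degree[of "map_poly (\<lambda>c. poly c b) ?F" "degree ?F"]
          by (auto simp: coeff_map_poly)
        hence "\<not> constant (poly (map_poly (\<lambda>c. poly c b) ?F))" by (simp add: constant_degree)
        then obtain a where "poly (map_poly (\<lambda>c. poly c b) ?F) a = 0"
          using fundamental_theorem_of_algebra by blast
        hence "fv a b = 0" by (simp flip: eval2_to_poly2 eval2_map_poly)
        thus ?case by force
      qed
    qed
    hence "finite (- snd ` {(y1, y2). fv y1 y2 = 0})" by (simp add: eventually_cofinite Compl_eq)
    hence "infinite (snd ` {(y1, y2). fv y1 y2 = 0})"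
      using infinite_UNIV_char_0[where 'a = complex] by (metis finite_compl)
    thus ?thesis by simp
  qed
  thus ?thesis by auto
qed

lemma curve_point: obtains y1 y2 where "fv y1 y2 = 0"
  using infinite_curve by (metis (mono_tags, lifting) Collect_empty_eq case_prodE finite.emptyI)

text \<open>Otherwise \<open>h\<close> would have finitely many zeros on an infinite curve. The set
  \<open>Z\<close> makes room for the points with \<open>sg\<close> zero, over which there are no
  offset points.\<close>

lemma dvd_if_vanishes_on_curve:
  assumes "mvars h \<subseteq> {0, 1}" "finite Z"
    and "\<And>y1 y2. fv y1 y2 = 0 \<Longrightarrow> (y1, y2) \<notin> Z \<Longrightarrow> meval h (pt2 y1 y2) = 0"
  shows "f dvd h"
proof (rule ccontr)
  assume "\<not> f dvd h"
  from finite_zeros_on_curve[OF assms(1) this] assms(2)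
  have "finite ({(y1, y2). fv y1 y2 = 0 \<and> meval h (pt2 y1 y2) = 0} \<union> Z)" by simp
  moreover have "{(y1, y2). fv y1 y2 = 0} \<subseteq> {(y1, y2). fv y1 y2 = 0 \<and> meval h (pt2 y1 y2) = 0} \<union> Z"
    using assms(3) by auto
  ultimately show False using infinite_curve finite_subset by blast
qed

lemma finite_sg_zeros: "finite {(y1, y2). fv y1 y2 = 0 \<and> sg y1 y2 = 0}"
proof -
  have "mvars ((mpderiv 0 f)\<^sup>2 + (mpderiv 1 f)\<^sup>2) \<subseteq> {0, 1}"
    using partial_vars mvars_power mvars_add by (meson Un_least order.trans)
  from finite_zeros_on_curve[OF this f_ndvd] show ?thesis
    by (simp add: meval.hom_add meval.hom_power)
qed

text \<open>If the derivative of f along vertical lines were a multiple of f, the restriction of f to a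
  vertical line through a point of the curve would divide its own derivative and vanish.\<close>

lemma finite_f2_zeros: "finite {(y1, y2). fv y1 y2 = 0 \<and> f2 y1 y2 = 0}"
proof (rule finite_zeros_on_curve[OF partial_vars], rule notI)
  assume "f dvd mpderiv 1 f"
  then obtain q where q: "mpderiv 1 f = f * q" by (elim dvdE)
  obtain y1 y2 where y: "fv y1 y2 = 0" by (rule curve_point)
  let ?p = "curve2 [:y1, 0:] [:y2, 1:] f"
  have "pderiv ?p = ?p * curve2 [:y1, 0:] [:y2, 1:] q"
    by (subst pderiv_curve2[OF f_vars], rule poly_eq_complexI) (simp add: q meval.hom_mult pderiv_pCons)
  hence "?p dvd pderiv ?p" by simp
  hence "degree ?p = 0" using not_dvd_pderiv by blast
  then obtain c where c: "?p = [:c:]" by (rule degree_eq_zeroE)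
  have "poly ?p 0 = 0" using y by simp
  hence "c = 0" unfolding c by simp
  hence "?p = 0" using c by simp
  thus False using no_line_in_curve[of 0 1 y1 y2] by simp
qed

text \<open>Restrict \<open>f\<close> to the points (1 + s) y, where y is a curve point other than
  the origin. The Euler expression becomes (1 + s) times the derivative of the restriction, whose
  order at s = 0 is one less than that of the restriction itself, so it cannot be a multiple of
  it.\<close>

lemma euler_not_multiple:
  assumes q: "\<And>y1 y2. y1 * f1 y1 y2 + y2 * f2 y1 y2 = fv y1 y2 * meval q (pt2 y1 y2)"
  shows False
proof -
  have "\<not> {(y1, y2). fv y1 y2 = 0} \<subseteq> {(0, 0)}"
    using infinite_curve finite_subset[of _ "{(0, 0)}"] by blast
  then obtain y1 y2 where y: "fv y1 y2 = 0" "(y1, y2) \<noteq> (0, 0)" by blast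
  define p where "p = curve2 [:y1, y1:] [:y2, y2:] f"
  have p0: "p \<noteq> 0" unfolding p_def by (rule no_line_in_curve) (rule y(2))
  have *: "[:1, 1:] * pderiv p = p * curve2 [:y1, y1:] [:y2, y2:] q"
  proof (rule poly_eq_complexI)
    fix z
    have "poly (pderiv p) z = f1 (y1 + z * y1) (y2 + z * y2) * y1 + f2 (y1 + z * y1) (y2 + z * y2) * y2"
      unfolding p_def pderiv_curve2[OF f_vars] by (simp add: pderiv_pCons)
    hence "poly ([:1, 1:] * pderiv p) z
      = (y1 + z * y1) * f1 (y1 + z * y1) (y2 + z * y2) + (y2 + z * y2) * f2 (y1 + z * y1) (y2 + z * y2)"
      by (simp add: algebra_simps)
    also have "\<dots> = poly (p * curve2 [:y1, y1:] [:y2, y2:] q) z"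
      unfolding q by (simp add: p_def)
    finally show "poly ([:1, 1:] * pderiv p) z = poly (p * curve2 [:y1, y1:] [:y2, y2:] q) z" .
  qed
  have r0: "poly p 0 = 0" using y by (simp add: p_def)
  have "degree p \<noteq> 0"
  proof
    assume "degree p = 0"
    then obtain c where "p = [:c:]" by (rule degree_eq_zeroE)
    thus False using r0 p0 by simp
  qed
  hence pd: "pderiv p \<noteq> 0" by (simp add: pderiv_eq_0_iff)
  hence nz: "[:1, 1:] * pderiv p \<noteq> 0" by (simp del: mult_pCons_left)
  have "order 0 [:1, 1::complex:] = 0" by (rule order_0I) simp
  hence "order 0 ([:1, 1:] * pderiv p) = order 0 (pderiv p)"
    using order_mult[OF nz, of 0] by simp
  moreover have "order 0 p \<le> order 0 ([:1, 1:] * pderiv p)"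
    using nz unfolding * by (simp add: order_mult)
  moreover have "order 0 p = Suc (order 0 (pderiv p))"
    by (rule order_pderiv[OF p0 r0])
  ultimately show False by simp
qed

text \<open>Away from the origin, this expression vanishes where the curve is singular or its
  tangent passes through the origin. Lines through the origin meeting such points have to be
  avoided, since their intersections with the curve are multiple.\<close>

lemma finite_euler_zeros: "finite {(y1, y2). fv y1 y2 = 0 \<and> y1 * f1 y1 y2 + y2 * f2 y1 y2 = 0}"
proof -
  define e where "e = mVar 0 * mpderiv 0 f + mVar 1 * mpderiv 1 f"
  have ev: "mvars e \<subseteq> {0, 1}"
    unfolding e_def
    by (intro order.trans[OF mvars_add] Un_least order.trans[OF mvars_mult] partial_vars) simp_all
  have me: "meval e (pt2 y1 y2) = y1 * f1 y1 y2 + y2 * f2 y1 y2" for y1 y2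
  proof -
    have "pt2 y1 y2 0 = y1" "pt2 y1 y2 1 = y2" by (simp_all add: pt2_def)
    thus ?thesis by (simp only: e_def meval.hom_add meval.hom_mult meval_mVar)
  qed
  have "\<not> f dvd e"
  proof
    assume "f dvd e"
    then obtain q where q: "e = f * q" by (elim dvdE)
    show False by (rule euler_not_multiple[of q]) (simp only: me[symmetric] q meval.hom_mult)
  qed
  from finite_zeros_on_curve[OF ev this] show ?thesis by (simp only: me)
qed

lemma finite_curve_inter_line:
  assumes "(u, v) \<noteq> (0, 0)"
  shows "finite {(y1, y2). fv y1 y2 = 0 \<and> (\<exists>s. y1 = p1 + s * u \<and> y2 = p2 + s * v)}"
proof -
  have "finite {s. poly (curve2 [:p1, u:] [:p2, v:] f) s = 0}"
    by (rule poly_roots_finite[OF no_line_in_curve[OF assms]])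
  hence "finite ((\<lambda>s. (p1 + s * u, p2 + s * v)) ` {s. poly (curve2 [:p1, u:] [:p2, v:] f) s = 0})"
    by simp
  thus ?thesis by (rule rev_finite_subset) auto
qed

end

section \<open>The tangent plane of the offset\<close>

text \<open>Orthogonality to the tangent direction (-b, a) forces (u, v) to be t times the normal
  (a, b). The squared length of the normal stays as a factor in place of a division.\<close>

lemma normal_displacement_identities:
  fixes a b t u v :: complex
  assumes "t * (a\<^sup>2 + b\<^sup>2) = a * u + b * v" "- b * u + a * v = 0"
  shows "(t * a) * (a\<^sup>2 + b\<^sup>2) = u * (a\<^sup>2 + b\<^sup>2)" "(t * b) * (a\<^sup>2 + b\<^sup>2) = v * (a\<^sup>2 + b\<^sup>2)"
proof -
  have 2: "a * v = b * u" using assms(2) by simp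
  have "(t * a) * (a\<^sup>2 + b\<^sup>2) = a * (t * (a\<^sup>2 + b\<^sup>2))" by simp
  also have "\<dots> = a * a * u + b * (a * v)" unfolding assms(1) by (simp add: algebra_simps)
  also have "\<dots> = u * (a\<^sup>2 + b\<^sup>2)" unfolding 2 by (simp add: algebra_simps power2_eq_square)
  finally show "(t * a) * (a\<^sup>2 + b\<^sup>2) = u * (a\<^sup>2 + b\<^sup>2)" .
  have "(t * b) * (a\<^sup>2 + b\<^sup>2) = b * (t * (a\<^sup>2 + b\<^sup>2))" by simp
  also have "\<dots> = a * (b * u) + b * b * v" unfolding assms(1) by (simp add: algebra_simps)
  also have "\<dots> = v * (a\<^sup>2 + b\<^sup>2)" unfolding 2[symmetric] by (simp add: algebra_simps power2_eq_square)
  finally show "(t * b) * (a\<^sup>2 + b\<^sup>2) = v * (a\<^sup>2 + b\<^sup>2)" .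
qed

text \<open>The offset point moves with its foot along the tangent (-b, a); h1 and h2 are the
  velocities of the normal (a, b), and d' comes from d^2 = t^2 (a^2 + b^2). Eliminating
  \<open>gd\<close> against the ruling relation leaves the scalar product of planar gradient and
  tangent, times a focal factor.\<close>

lemma tangent_identity:
  fixes g1 g2 gd a b h1 h2 t d d' :: complex
  assumes 1: "g1 * (- b + t * h1) + g2 * (a + t * h2) + gd * d' = 0"
    and 2: "g1 * (t * a) + g2 * (t * b) + gd * d = 0"
    and 3: "d' * d = t\<^sup>2 * (a * h1 + b * h2)" and 4: "d\<^sup>2 = t\<^sup>2 * (a\<^sup>2 + b\<^sup>2)"
  shows "t\<^sup>2 * ((g2 * a - g1 * b) * (a\<^sup>2 + b\<^sup>2 + t * (a * h2 - b * h1))) = 0"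
proof -
  have "t\<^sup>2 * ((g2 * a - g1 * b) * (a\<^sup>2 + b\<^sup>2 + t * (a * h2 - b * h1)))
    = (t\<^sup>2 * (a\<^sup>2 + b\<^sup>2)) * (g1 * (- b + t * h1) + g2 * (a + t * h2))
      - (g1 * (t * a) + g2 * (t * b)) * (t\<^sup>2 * (a * h1 + b * h2))"
    by (simp add: algebra_simps power2_eq_square)
  also have "\<dots> = d\<^sup>2 * (- (gd * d')) - (- (gd * d)) * (d' * d)"
    using 1 2 by (simp only: 3 4 eq_neg_iff_add_eq_0[symmetric])
  also have "\<dots> = 0" by (simp add: power2_eq_square)
  finally show ?thesis .
qed

lemma normal_identities:
  fixes g1 g2 gd a b t d :: complex
  assumes 1: "g1 * (t * a) + g2 * (t * b) + gd * d = 0" and 2: "d\<^sup>2 = t\<^sup>2 * (a\<^sup>2 + b\<^sup>2)"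
    and 3: "g2 * a - g1 * b = 0"
  shows "d * (d * g1) = d * (- gd * (t * a))" "d * (d * g2) = d * (- gd * (t * b))"
proof -
  have 1: "g1 * (t * a) + g2 * (t * b) = - (gd * d)" using 1 by (simp add: eq_neg_iff_add_eq_0)
  have 3: "g2 * a = g1 * b" using 3 by simp
  have "d * (d * g1) = d\<^sup>2 * g1" by (simp add: power2_eq_square)
  also have "\<dots> = t * a * (g1 * (t * a)) + t * t * b * (g1 * b)"
    unfolding 2 by (simp add: algebra_simps power2_eq_square)
  also have "\<dots> = t * a * (g1 * (t * a) + g2 * (t * b))"
    unfolding 3[symmetric] by (simp add: algebra_simps)
  finally show "d * (d * g1) = d * (- gd * (t * a))" unfolding 1 by (simp add: mult_ac)
  have "d * (d * g2) = d\<^sup>2 * g2" by (simp add: power2_eq_square)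
  also have "\<dots> = t * b * (g2 * (t * b)) + t * t * a * (g2 * a)"
    unfolding 2 by (simp add: algebra_simps power2_eq_square)
  also have "\<dots> = t * b * (g1 * (t * a) + g2 * (t * b))"
    unfolding 3 by (simp add: algebra_simps)
  finally show "d * (d * g2) = d * (- gd * (t * b))" unfolding 1 by (simp add: mult_ac)
qed

text \<open>Division by d^2 - D after substituting polynomials in y1, y2 for x1, x2. Since d is only
  a square root of D, the two signs of d will separate the remainder into \<open>A\<close> and
  \<open>B\<close>.\<close>

lemma reduce_square:
  assumes "mvars g \<subseteq> {0, 1, 2}" "mvars X1 \<subseteq> {0, 1}" "mvars X2 \<subseteq> {0, 1}" "mvars D \<subseteq> {0, 1}"
  shows "\<exists>A B C. mvars A \<subseteq> {0, 1} \<and> mvars B \<subseteq> {0, 1} \<and>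
    (\<forall>y1 y2 d. meval g (pt3 (meval X1 (pt2 y1 y2)) (meval X2 (pt2 y1 y2)) d)
      = meval A (pt2 y1 y2) + d * meval B (pt2 y1 y2) + (d\<^sup>2 - meval D (pt2 y1 y2)) * meval C (pt3 y1 y2 d))"
  using assms(1)
proof (induction rule: mpoly_vars_induct)
  case (const c)
  show ?case by (rule exI[of _ "mConst c"], rule exI[of _ 0], rule exI[of _ 0]) simp
next
  case (var i)
  then consider "i = 0" | "i = 1" | "i = 2" by auto
  thus ?case
  proof cases
    case 1
    show ?thesis unfolding 1
      by (rule exI[of _ X1], rule exI[of _ 0], rule exI[of _ 0]) (simp add: assms pt3_def)
  next
    case 2
    show ?thesis unfolding 2
      by (rule exI[of _ X2], rule exI[of _ 0], rule exI[of _ 0]) (simp add: assms pt3_def)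
  next
    case 3
    show ?thesis unfolding 3
      by (rule exI[of _ 0], rule exI[of _ 1], rule exI[of _ 0]) (simp add: pt3_def)
  qed
next
  case (add p q)
  then obtain A B C A' B' C' where *: "mvars A \<subseteq> {0, 1}" "mvars B \<subseteq> {0, 1}" "mvars A' \<subseteq> {0, 1}" "mvars B' \<subseteq> {0, 1}"
    "\<And>y1 y2 d. meval p (pt3 (meval X1 (pt2 y1 y2)) (meval X2 (pt2 y1 y2)) d)
      = meval A (pt2 y1 y2) + d * meval B (pt2 y1 y2) + (d\<^sup>2 - meval D (pt2 y1 y2)) * meval C (pt3 y1 y2 d)"
    "\<And>y1 y2 d. meval q (pt3 (meval X1 (pt2 y1 y2)) (meval X2 (pt2 y1 y2)) d)
      = meval A' (pt2 y1 y2) + d * meval B' (pt2 y1 y2) + (d\<^sup>2 - meval D (pt2 y1 y2)) * meval C' (pt3 y1 y2 d)"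
    by metis
  have "mvars (A + A') \<subseteq> {0, 1}" "mvars (B + B') \<subseteq> {0, 1}"
    by (intro order.trans[OF mvars_add] Un_least *)+
  moreover have "meval (p + q) (pt3 (meval X1 (pt2 y1 y2)) (meval X2 (pt2 y1 y2)) d)
      = meval (A + A') (pt2 y1 y2) + d * meval (B + B') (pt2 y1 y2)
        + (d\<^sup>2 - meval D (pt2 y1 y2)) * meval (C + C') (pt3 y1 y2 d)" for y1 y2 d
    by (simp only: meval.hom_add *) (simp add: algebra_simps)
  ultimately show ?case by blast
next
  case (mult p q)
  then obtain A B C A' B' C' where *: "mvars A \<subseteq> {0, 1}" "mvars B \<subseteq> {0, 1}" "mvars A' \<subseteq> {0, 1}" "mvars B' \<subseteq> {0, 1}"
    "\<And>y1 y2 d. meval p (pt3 (meval X1 (pt2 y1 y2)) (meval X2 (pt2 y1 y2)) d)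
      = meval A (pt2 y1 y2) + d * meval B (pt2 y1 y2) + (d\<^sup>2 - meval D (pt2 y1 y2)) * meval C (pt3 y1 y2 d)"
    "\<And>y1 y2 d. meval q (pt3 (meval X1 (pt2 y1 y2)) (meval X2 (pt2 y1 y2)) d)
      = meval A' (pt2 y1 y2) + d * meval B' (pt2 y1 y2) + (d\<^sup>2 - meval D (pt2 y1 y2)) * meval C' (pt3 y1 y2 d)"
    by metis
  \<comment> \<open>Multiplication modulo d^2 - D: the product of the two parts linear in d is moved
    to the part free of d, with d^2 replaced by D.\<close>
  let ?A = "A * A' + D * (B * B')" and ?B = "A * B' + A' * B"
  let ?C = "B * B' + C * (A' + mVar 2 * B' + ((mVar 2)\<^sup>2 - D) * C') + C' * (A + mVar 2 * B)"
  have "mvars ?A \<subseteq> {0, 1}" "mvars ?B \<subseteq> {0, 1}"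
    by (intro order.trans[OF mvars_add] order.trans[OF mvars_mult] Un_least * assms)+
  moreover have "meval (p * q) (pt3 (meval X1 (pt2 y1 y2)) (meval X2 (pt2 y1 y2)) d)
      = meval ?A (pt2 y1 y2) + d * meval ?B (pt2 y1 y2)
        + (d\<^sup>2 - meval D (pt2 y1 y2)) * meval ?C (pt3 y1 y2 d)" for y1 y2 d
  proof -
    have d: "pt3 y1 y2 d 2 = d" by (simp add: pt3_def)
    show ?thesis
      by (simp only: meval.hom_add meval.hom_mult meval.hom_minus meval.hom_power meval_mVar * d
          meval_pt3_pt2[OF *(1)] meval_pt3_pt2[OF *(2)] meval_pt3_pt2[OF *(3)] meval_pt3_pt2[OF *(4)]
          meval_pt3_pt2[OF assms(4)])
        (simp add: algebra_simps power2_eq_square)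
  qed
  ultimately show ?case by blast
qed

section \<open>The parametrized offset and the gradient of a polynomial vanishing on it\<close>

context plane_curve
begin

text \<open>The incidence variety without the auxiliary u: the displacement from the foot is t times
  the normal (f1, f2), and either square root is allowed for d.\<close>

definition offset_point :: "complex \<Rightarrow> complex \<Rightarrow> complex \<Rightarrow> complex \<Rightarrow> bool" where
  "offset_point y1 y2 t d \<longleftrightarrow> fv y1 y2 = 0 \<and> sg y1 y2 \<noteq> 0 \<and> d\<^sup>2 = t\<^sup>2 * sg y1 y2"

abbreviation (input) offset_at :: "complex \<Rightarrow> complex \<Rightarrow> complex \<Rightarrow> complex \<Rightarrow> nat \<Rightarrow> complex" where
  "offset_at y1 y2 t d \<equiv> pt3 (y1 + t * f1 y1 y2) (y2 + t * f2 y1 y2) d"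

lemma offset_proj_eq:
  "(x1, x2, d) \<in> offset_proj f \<longleftrightarrow>
    (\<exists>y1 y2 t. offset_point y1 y2 t d \<and> x1 = y1 + t * f1 y1 y2 \<and> x2 = y2 + t * f2 y1 y2)"
proof
  assume "(x1, x2, d) \<in> offset_proj f"
  then obtain y1 y2 u where *: "fv y1 y2 = 0" "(x1 - y1)\<^sup>2 + (x2 - y2)\<^sup>2 - d\<^sup>2 = 0"
    "- f2 y1 y2 * (x1 - y1) + f1 y1 y2 * (x2 - y2) = 0" "u * sg y1 y2 - 1 = 0"
    unfolding offset_proj_def Omega_def by auto
  have s: "sg y1 y2 \<noteq> 0" using *(4) by auto
  \<comment> \<open>The coefficient of the projection of the displacement on the normal, whose
    squared length is invertible because of u.\<close>
  define t where "t = (f1 y1 y2 * (x1 - y1) + f2 y1 y2 * (x2 - y2)) / sg y1 y2"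
  have ts: "t * sg y1 y2 = f1 y1 y2 * (x1 - y1) + f2 y1 y2 * (x2 - y2)" using s by (simp add: t_def)
  have "(t * f1 y1 y2) * sg y1 y2 = (x1 - y1) * sg y1 y2" by (rule normal_displacement_identities[OF ts *(3)])
  hence 1: "t * f1 y1 y2 = x1 - y1" using s mult_right_cancel by blast
  have "(t * f2 y1 y2) * sg y1 y2 = (x2 - y2) * sg y1 y2" by (rule normal_displacement_identities[OF ts *(3)])
  hence 2: "t * f2 y1 y2 = x2 - y2" using s mult_right_cancel by blast
  have "d\<^sup>2 = t\<^sup>2 * sg y1 y2" using *(2) unfolding 1[symmetric] 2[symmetric] by (simp add: algebra_simps power_mult_distrib)
  thus "\<exists>y1 y2 t. offset_point y1 y2 t d \<and> x1 = y1 + t * f1 y1 y2 \<and> x2 = y2 + t * f2 y1 y2"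
    using *(1) s 1 2 unfolding offset_point_def by (metis add.commute diff_add_cancel)
next
  assume "\<exists>y1 y2 t. offset_point y1 y2 t d \<and> x1 = y1 + t * f1 y1 y2 \<and> x2 = y2 + t * f2 y1 y2"
  then obtain y1 y2 t where *: "offset_point y1 y2 t d" "x1 = y1 + t * f1 y1 y2" "x2 = y2 + t * f2 y1 y2"
    by blast
  have "fv y1 y2 = 0" "1 / sg y1 y2 * sg y1 y2 - 1 = 0"
    using *(1) by (simp_all add: offset_point_def)
  moreover have "(x1 - y1)\<^sup>2 + (x2 - y2)\<^sup>2 - d\<^sup>2 = 0"
    using * by (simp add: offset_point_def power_mult_distrib distrib_left)
  moreover have "- f2 y1 y2 * (x1 - y1) + f1 y1 y2 * (x2 - y2) = 0" using * by simp
  ultimately have "(y1, y2, x1, x2, d, 1 / sg y1 y2) \<in> Omega f"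
    unfolding Omega_def by blast
  thus "(x1, x2, d) \<in> offset_proj f" unfolding offset_proj_def by force
qed

end

locale offset_vanishing = plane_curve +
  fixes g :: mpoly
  assumes g_vars: "mvars g \<subseteq> {0, 1, 2}"
    and g_vanishes: "\<And>y1 y2 t d. offset_point y1 y2 t d \<Longrightarrow> meval g (offset_at y1 y2 t d) = 0"
begin

abbreviation g1 where "g1 \<equiv> meval (mpderiv 0 g)"
abbreviation g2 where "g2 \<equiv> meval (mpderiv 1 g)"
abbreviation gd where "gd \<equiv> meval (mpderiv 2 g)"

text \<open>The offset is a union of lines: (t, d) may be scaled by a common factor.\<close>

lemma gradient_ruling:
  assumes "offset_point y1 y2 t d"
  defines "p \<equiv> offset_at y1 y2 t d"
  shows "g1 p * (t * f1 y1 y2) + g2 p * (t * f2 y1 y2) + gd p * d = 0"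
proof -
  let ?c = "curve3 [:y1 + t * f1 y1 y2, t * f1 y1 y2:] [:y2 + t * f2 y1 y2, t * f2 y1 y2:] [:d, d:]"
  have "?c g = 0"
  proof (rule poly_eq_complexI)
    fix z
    have "offset_point y1 y2 (t * (1 + z)) (d * (1 + z))"
      using assms(1) by (simp add: offset_point_def power_mult_distrib)
    from g_vanishes[OF this] show "poly (?c g) z = poly 0 z" by (simp add: algebra_simps)
  qed
  hence "poly (pderiv (?c g)) 0 = 0" by simp
  thus ?thesis unfolding pderiv_curve3[OF g_vars] p_def by (simp add: pderiv_pCons mult_ac)
qed

text \<open>The Hessian form of \<open>f\<close> on the tangent vector (-f2, f1), written through
  the derivative of the normal along that vector. Where
  \<open>sg y1 y2 + t * hess_form y1 y2\<close> vanishes, the value t is focal: the moving offset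
  point has no velocity along the tangent.\<close>

abbreviation hess_form where
  "hess_form y1 y2 \<equiv> f1 y1 y2 * poly (pderiv (curve2 [:y1, - f2 y1 y2:] [:y2, f1 y1 y2:] (mpderiv 1 f))) 0
     - f2 y1 y2 * poly (pderiv (curve2 [:y1, - f2 y1 y2:] [:y2, f1 y1 y2:] (mpderiv 0 f))) 0"

text \<open>The foot moves along its tangent line, which leaves the curve only to second order, with
  t fixed and d replaced by a linear approximation. After substitution \<open>g\<close> is a
  combination of f and d^2 - t^2 sg, both of which vanish to second order along this motion, so the
  derivative of \<open>g\<close> along it is zero.\<close>

lemma gradient_tangent_nonfocal:
  assumes op: "offset_point y1 y2 t d" and t: "t \<noteq> 0"
  defines "p \<equiv> offset_at y1 y2 t d"
  shows "(g2 p * f1 y1 y2 - g1 p * f2 y1 y2) * (sg y1 y2 + t * hess_form y1 y2) = 0"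
proof -
  have fy: "fv y1 y2 = 0" and s: "sg y1 y2 \<noteq> 0" and d2: "d\<^sup>2 = t\<^sup>2 * sg y1 y2"
    using op by (auto simp: offset_point_def)
  have d0: "d \<noteq> 0" using d2 s t by auto
  define X1 where "X1 = mVar 0 + mConst t * mpderiv 0 f"
  define X2 where "X2 = mVar 1 + mConst t * mpderiv 1 f"
  define D where "D = mConst (t\<^sup>2) * ((mpderiv 0 f)\<^sup>2 + (mpderiv 1 f)\<^sup>2)"
  have vars: "mvars X1 \<subseteq> {0, 1}" "mvars X2 \<subseteq> {0, 1}" "mvars D \<subseteq> {0, 1}"
    unfolding X1_def X2_def D_def
    by (intro order.trans[OF mvars_add] Un_least order.trans[OF mvars_mult] order.trans[OF mvars_power]
        partial_vars; simp)+
  have X: "meval X1 (pt2 a b) = a + t * f1 a b" "meval X2 (pt2 a b) = b + t * f2 a b"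
    "meval D (pt2 a b) = t\<^sup>2 * sg a b" for a b
  proof -
    have "pt2 a b 0 = a" "pt2 a b 1 = b" by (simp_all add: pt2_def)
    thus "meval X1 (pt2 a b) = a + t * f1 a b" "meval X2 (pt2 a b) = b + t * f2 a b"
      "meval D (pt2 a b) = t\<^sup>2 * sg a b"
      by (simp_all only: X1_def X2_def D_def meval.hom_add meval.hom_mult meval.hom_power meval_mVar meval_mConst)
  qed
  obtain A B C where AB: "mvars A \<subseteq> {0, 1}" "mvars B \<subseteq> {0, 1}"
    and ABC: "\<And>a b e. meval g (pt3 (meval X1 (pt2 a b)) (meval X2 (pt2 a b)) e)
      = meval A (pt2 a b) + e * meval B (pt2 a b) + (e\<^sup>2 - meval D (pt2 a b)) * meval C (pt3 a b e)"
    using reduce_square[OF g_vars vars] by blast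
  \<comment> \<open>Both square roots \<open>e\<close> and \<open>- e\<close> give offset points, so
    the two parts of the remainder vanish separately.\<close>
  have van: "meval A (pt2 a b) = 0 \<and> meval B (pt2 a b) = 0" if ab: "fv a b = 0" "sg a b \<noteq> 0" for a b
  proof -
    define e where "e = csqrt (t\<^sup>2 * sg a b)"
    have e2: "e\<^sup>2 = t\<^sup>2 * sg a b" by (simp add: e_def)
    have e0: "e \<noteq> 0" using e2 ab t by auto
    have "offset_point a b t e" "offset_point a b t (- e)"
      using ab e2 by (auto simp: offset_point_def)
    from this[THEN g_vanishes] have "meval A (pt2 a b) + e * meval B (pt2 a b) = 0"
      "meval A (pt2 a b) + (- e) * meval B (pt2 a b) = 0"
      using ABC[of a b e] ABC[of a b "- e"] e2 by (simp_all add: X)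
    thus ?thesis using e0 by (simp add: add_eq_0_iff)
  qed
  have "f dvd A" by (rule dvd_if_vanishes_on_curve[OF AB(1) finite_sg_zeros]) (use van in auto)
  then obtain A' where A': "A = f * A'" by (elim dvdE)
  have "f dvd B" by (rule dvd_if_vanishes_on_curve[OF AB(2) finite_sg_zeros]) (use van in auto)
  then obtain B' where B': "B = f * B'" by (elim dvdE)
  define T1 where "T1 = - f2 y1 y2"
  define T2 where "T2 = f1 y1 y2"
  define c where "c = curve2 [:y1, T1:] [:y2, T2:]"
  define h1 where "h1 = poly (pderiv (c (mpderiv 0 f))) 0"
  define h2 where "h2 = poly (pderiv (c (mpderiv 1 f))) 0"
  \<comment> \<open>Chosen so that (d + d' z)^2 agrees with t^2 sg along the tangent line up to
    first order in z.\<close>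
  define d' where "d' = t\<^sup>2 * (f1 y1 y2 * h1 + f2 y1 y2 * h2) / d"
  define E where "E = [:d, d':]"
  define Y1 where "Y1 = [:y1, T1:] + Polynomial.smult t (c (mpderiv 0 f))"
  define Y2 where "Y2 = [:y2, T2:] + Polynomial.smult t (c (mpderiv 1 f))"
  define S where "S = Polynomial.smult (t\<^sup>2) ((c (mpderiv 0 f))\<^sup>2 + (c (mpderiv 1 f))\<^sup>2)"
  have eq: "curve3 Y1 Y2 E g = c f * (c A' + E * c B') + (E\<^sup>2 - S) * curve3 [:y1, T1:] [:y2, T2:] E C"
  proof (rule poly_eq_complexI)
    fix z
    show "poly (curve3 Y1 Y2 E g) z
      = poly (c f * (c A' + E * c B') + (E\<^sup>2 - S) * curve3 [:y1, T1:] [:y2, T2:] E C) z"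
      using ABC[of "y1 + z * T1" "y2 + z * T2" "d + z * d'"]
      by (simp add: X A' B' meval.hom_mult Y1_def Y2_def E_def S_def c_def algebra_simps)
  qed
  have c0: "poly (c q) 0 = meval q (pt2 y1 y2)" for q by (simp add: c_def)
  have "poly (pderiv (c f)) 0 = 0"
    unfolding c_def pderiv_curve2[OF f_vars] by (simp add: pderiv_pCons T1_def T2_def)
  moreover have "poly (pderiv (E\<^sup>2 - S)) 0 = 0"
    using d0 by (simp add: E_def S_def pderiv_diff pderiv_smult pderiv_add pderiv_power power2_eq_square
        pderiv_mult pderiv_pCons c0 flip: h1_def h2_def) (simp add: d'_def field_simps power2_eq_square)
  moreover have "poly (E\<^sup>2 - S) 0 = 0" using d2 by (simp add: E_def S_def c0)
  ultimately have "poly (pderiv (curve3 Y1 Y2 E g)) 0 = 0"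
    unfolding eq by (simp add: pderiv_mult pderiv_add c0 fy del: pderiv_diff)
  moreover have "poly (pderiv Y1) 0 = T1 + t * h1" "poly (pderiv Y2) 0 = T2 + t * h2"
    "poly (pderiv E) 0 = d'" "poly Y1 0 = y1 + t * f1 y1 y2" "poly Y2 0 = y2 + t * f2 y1 y2" "poly E 0 = d"
    by (simp_all add: Y1_def Y2_def E_def pderiv_add pderiv_smult pderiv_pCons h1_def h2_def c0)
  ultimately have 1: "g1 p * (T1 + t * h1) + g2 p * (T2 + t * h2) + gd p * d' = 0"
    unfolding pderiv_curve3[OF g_vars] by (simp add: p_def)
  have dd: "d' * d = t\<^sup>2 * (f1 y1 y2 * h1 + f2 y1 y2 * h2)" using d0 by (simp add: d'_def)
  have 2: "g1 p * (t * f1 y1 y2) + g2 p * (t * f2 y1 y2) + gd p * d = 0"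
    using gradient_ruling[OF op] by (simp add: p_def)
  let ?a = "f1 y1 y2" and ?b = "f2 y1 y2"
  have "t\<^sup>2 * ((g2 p * ?a - g1 p * ?b) * (sg y1 y2 + t * (?a * h2 - ?b * h1))) = 0"
    by (rule tangent_identity[OF _ 2 dd d2]) (use 1 in \<open>simp only: T1_def T2_def\<close>)
  hence "(g2 p * ?a - g1 p * ?b) * (sg y1 y2 + t * (?a * h2 - ?b * h1)) = 0" using t by simp
  thus ?thesis unfolding h1_def h2_def c_def T1_def T2_def .
qed

text \<open>Along the ruling over a fixed foot, where d is proportional to t, the previous relation
  is a polynomial identity in t. Its focal factor is linear with constant term \<open>sg\<close>,
  hence not the zero polynomial, and cancels; this includes the focal value of t.\<close>

lemma gradient_tangent:
  assumes op: "offset_point y1 y2 t d" and t: "t \<noteq> 0"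
  defines "p \<equiv> offset_at y1 y2 t d"
  shows "g2 p * f1 y1 y2 - g1 p * f2 y1 y2 = 0"
proof -
  have fy: "fv y1 y2 = 0" and s: "sg y1 y2 \<noteq> 0" and d2: "d\<^sup>2 = t\<^sup>2 * sg y1 y2"
    using op by (auto simp: offset_point_def)
  define \<rho> where "\<rho> = d / t"
  have r2: "\<rho>\<^sup>2 = sg y1 y2" using d2 t by (simp add: \<rho>_def power_divide)
  define c where "c = curve3 [:y1, f1 y1 y2:] [:y2, f2 y1 y2:] [:0, \<rho>:]"
  define H where "H = Polynomial.smult (f1 y1 y2) (c (mpderiv 1 g)) - Polynomial.smult (f2 y1 y2) (c (mpderiv 0 g))"
  have "[:0, 1:] * H * [:sg y1 y2, hess_form y1 y2:] = 0"
  proof (rule poly_eq_complexI)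
    fix z
    have "z * (poly H z * (sg y1 y2 + z * hess_form y1 y2)) = 0"
    proof (cases "z = 0")
      case False
      have "offset_point y1 y2 z (z * \<rho>)" using fy s r2 by (simp add: offset_point_def power_mult_distrib)
      from gradient_tangent_nonfocal[OF this False] show ?thesis
        by (simp add: H_def c_def mult_ac)
    qed simp
    moreover have "poly ([:0, 1:] * H * [:a, b:]) z = z * (poly H z * (a + z * b))" for a b
      by (simp add: algebra_simps)
    ultimately show "poly ([:0, 1:] * H * [:sg y1 y2, hess_form y1 y2:]) z = poly 0 z"
      by (simp only: poly_0)
  qed
  moreover have "[:sg y1 y2, hess_form y1 y2:] \<noteq> 0" using s by simp
  moreover have "[:0, 1::complex:] \<noteq> 0" by simp
  ultimately have "H = 0" by (metis mult_eq_0_iff)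
  hence "poly H t = 0" by simp
  thus ?thesis using t by (simp add: H_def c_def p_def \<rho>_def mult_ac)
qed

theorem gradient_normal:
  assumes "offset_point y1 y2 t d" "t \<noteq> 0"
  defines "p \<equiv> offset_at y1 y2 t d"
  shows "d * g1 p = - gd p * (t * f1 y1 y2)" "d * g2 p = - gd p * (t * f2 y1 y2)"
proof -
  note 1 = gradient_ruling[OF assms(1)] and 2 = gradient_tangent[OF assms(1,2)]
  have s: "sg y1 y2 \<noteq> 0" and d2: "d\<^sup>2 = t\<^sup>2 * sg y1 y2"
    using assms(1) by (auto simp: offset_point_def)
  have d0: "d \<noteq> 0" using d2 s assms(2) by auto
  from normal_identities[OF 1 d2 2]
  show "d * g1 p = - gd p * (t * f1 y1 y2)" "d * g2 p = - gd p * (t * f2 y1 y2)"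
    unfolding p_def using d0 mult_left_cancel by blast+
qed

end

section \<open>Generic parameters\<close>

text \<open>This order of quantifiers lets the finitely many excluded k depend on d. Such conditions
  are closed under conjunction, jointly satisfiable, and include the nonvanishing of any nonzero
  polynomial in d and k.\<close>

definition generic :: "(complex \<Rightarrow> complex \<Rightarrow> bool) \<Rightarrow> bool" where
  "generic P \<longleftrightarrow> (\<forall>\<^sub>F d in cofinite. \<forall>\<^sub>F k in cofinite. P d k)"

lemma generic_conj:
  assumes "generic P" "generic Q"
  shows "generic (\<lambda>d k. P d k \<and> Q d k)"
  using assms unfolding generic_def by eventually_elim (simp add: eventually_conj_iff)

lemma generic_mono:
  assumes "generic P" "\<And>d k. P d k \<Longrightarrow> Q d k"
  shows "generic Q"
  using assms(1) unfolding generic_def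
  by (rule eventually_mono) (rule eventually_mono, assumption, rule assms(2))

lemma generic_ex: assumes "generic P" obtains d k where "P d k"
proof -
  have *: "\<exists>x. Q x" if "\<forall>\<^sub>F x in cofinite. Q x" for Q :: "complex \<Rightarrow> bool"
  proof (rule ccontr)
    assume "\<not> (\<exists>x. Q x)"
    hence "{x. \<not> Q x} = UNIV" by auto
    thus False using that infinite_UNIV_char_0[where 'a = complex] by (simp add: eventually_cofinite)
  qed
  show ?thesis using *[OF assms[unfolded generic_def]] * that by blast
qed

lemma generic_fst: "(\<forall>\<^sub>F d in cofinite. P d) \<Longrightarrow> generic (\<lambda>d k. P d)"
  unfolding generic_def by (erule eventually_mono) simp

lemma generic_snd: "(\<And>d. \<forall>\<^sub>F k in cofinite. P d k) \<Longrightarrow> generic P"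
  unfolding generic_def by (rule always_eventually) blast

lemma eventually_cofinite_notin: "finite A \<Longrightarrow> \<forall>\<^sub>F x in cofinite. x \<notin> A"
  by (simp add: eventually_cofinite)

lemma generic_eval2_nonzero:
  assumes "r \<noteq> 0"
  shows "generic (\<lambda>d k. eval2 r d k \<noteq> 0)"
proof -
  have "inj (\<lambda>d::complex. [:d:])" by (auto simp: inj_def)
  from finite_vimageI[OF poly_roots_finite[OF assms] this]
  have "\<forall>\<^sub>F d in cofinite. poly r [:d:] \<noteq> 0"
    by (simp add: eventually_cofinite vimage_def)
  thus ?thesis unfolding generic_def eval2_def
    by (rule eventually_mono) (rule eventually_poly_nonzero)
qed

lemma generic_no_common_zero:
  assumes "degree (gcd G H) = 0" "G \<noteq> 0"
  shows "generic (\<lambda>d k. \<forall>x. \<not> (eval3 G x d k = 0 \<and> eval3 H x d k = 0))"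
proof -
  obtain r where r: "r \<noteq> 0" "\<And>(h :: complex poly poly \<Rightarrow> complex) x. comm_ring_hom h \<Longrightarrow>
      poly (map_poly h G) x = 0 \<Longrightarrow> poly (map_poly h H) x = 0 \<Longrightarrow> h r = 0"
    using eliminant_exists[OF assms] by blast
  show ?thesis
    by (rule generic_mono[OF generic_eval2_nonzero[OF r(1)]])
      (use r(2)[OF eval2_hom] in \<open>auto simp: eval3_map_poly\<close>)
qed

lemma generic_degree_slice:
  assumes "G \<noteq> 0"
  shows "generic (\<lambda>d k. degree (map_poly (\<lambda>c. eval2 c d k) G) = degree G)"
proof -
  have "lead_coeff G \<noteq> 0" using assms by simp
  from generic_eval2_nonzero[OF this] show ?thesis
  proof (rule generic_mono)
    fix d k assume *: "eval2 (lead_coeff G) d k \<noteq> 0"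
    have "eval2 0 d k = 0" by (simp add: eval2_def)
    hence "coeff (map_poly (\<lambda>c. eval2 c d k) G) (degree G) \<noteq> 0" using * by (simp add: coeff_map_poly)
    hence "degree G \<le> degree (map_poly (\<lambda>c. eval2 c d k) G)" by (rule le_degree)
    thus "degree (map_poly (\<lambda>c. eval2 c d k) G) = degree G"
      using degree_map_poly_le[of "\<lambda>c. eval2 c d k" G] by simp
  qed
qed

lemma generic_root:
  assumes "degree G \<noteq> 0"
  shows "generic (\<lambda>d k. \<exists>x. eval3 G x d k = 0)"
proof -
  have "G \<noteq> 0" using assms by auto
  from generic_degree_slice[OF this] show ?thesis
  proof (rule generic_mono)
    fix d k assume "degree (map_poly (\<lambda>c. eval2 c d k) G) = degree G"
    hence "\<not> constant (poly (map_poly (\<lambda>c. eval2 c d k) G))" using assms by (simp add: constant_degree)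
    thus "\<exists>x. eval3 G x d k = 0" unfolding eval3_map_poly using fundamental_theorem_of_algebra by blast
  qed
qed

lemma prime_factor_of_positive_degree:
  fixes p :: "'a::{factorial_ring_gcd,semiring_gcd_mult_normalize} poly"
  assumes "degree p \<noteq> 0"
  shows "\<exists>q. prime q \<and> q dvd p \<and> degree q \<noteq> 0"
  using assms
proof (induction p rule: prime_divisors_induct)
  case (unit x)
  thus ?case by (auto elim: is_unit_polyE)
next
  case (factor p x)
  show ?case
  proof (cases "degree p = 0")
    case True
    have "degree (p * x) \<le> degree p + degree x" by (rule degree_mult_le)
    hence "degree x \<noteq> 0" using True factor.prems by simp
    thus ?thesis using factor.IH by (meson dvd_mult)
  next
    case False
    thus ?thesis using factor.hyps by (meson dvd_triv_left)
  qed
qed simp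

lemma pderiv_slice:
  "pderiv (map_poly (\<lambda>c. eval2 c d k) G) = map_poly (\<lambda>c. eval2 c d k) (pderiv G)"
proof (rule poly_eqI)
  interpret comm_ring_hom "\<lambda>c. eval2 c d k" by (rule eval2_hom)
  fix n
  have "eval2 (of_nat (Suc n)) d k = of_nat (Suc n)" by (rule hom_of_nat)
  thus "coeff (pderiv (map_poly (\<lambda>c. eval2 c d k) G)) n = coeff (map_poly (\<lambda>c. eval2 c d k) (pderiv G)) n"
    by (simp add: coeff_pderiv coeff_map_poly hom_mult del: of_nat_Suc)
qed

lemma card_roots_complex:
  assumes "p \<noteq> 0" "\<And>x. poly p x = 0 \<Longrightarrow> poly (pderiv p) x \<noteq> 0"
  shows "card {x. poly p x = 0} = degree (p :: complex poly)"
proof -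
  have "degree p = size (proots p)" by (simp add: size_proots_complex)
  also have "\<dots> = (\<Sum>x\<in>set_mset (proots p). order x p)"
    unfolding size_multiset_overloaded_eq using assms(1) by simp
  also have "set_mset (proots p) = {x. poly p x = 0}" using assms(1) by simp
  also have "(\<Sum>x\<in>{x. poly p x = 0}. order x p) = (\<Sum>x\<in>{x. poly p x = 0}. 1)"
    by (rule sum.cong) (use assms order_eq_1I in auto)
  finally show ?thesis by simp
qed

lemma pt3_2 [simp]: "pt3 a b c 2 = c"
  by (simp add: pt3_def)

lemma generic_d_nonzero: "generic (\<lambda>d k. d \<noteq> 0)"
  by (rule generic_fst) (simp add: eventually_cofinite)

lemma mVar_nonzero: "mVar i \<noteq> 0"
proof
  assume "mVar i = 0"
  hence "meval (mVar i) (\<lambda>_. 1) = meval 0 (\<lambda>_. 1)" by simp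
  thus False by simp
qed

section \<open>Points of the offset on a generic line\<close>

locale generic_offset_eq = plane_curve +
  fixes g :: mpoly
  assumes g_eq: "is_generic_offset_eq f g"
begin

lemma zero_set_g: "{(a, b, c). meval g (pt3 a b c) = 0} = zariski_closure3 (offset_proj f)"
  using g_eq unfolding is_generic_offset_eq_def generic_offset_def by (elim conjE)

text \<open>Consequences of the parametrization reach all zeros of \<open>g\<close> through this
  lemma. The closure tests only polynomials in three variables, so the other variables of
  \<open>h\<close> are first set to 0, their value at \<open>pt3\<close>.\<close>

lemma vanishes_on_offset:
  assumes h: "\<And>y1 y2 t d. offset_point y1 y2 t d \<Longrightarrow> meval h (offset_at y1 y2 t d) = 0"
    and g: "meval g (pt3 a b c) = 0"
  shows "meval h (pt3 a b c) = 0"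
proof -
  define h' where "h' = mev mConst (\<lambda>i. if i \<in> {0, 1, 2} then mVar i else 0) h"
  have vars: "mvars h' \<subseteq> {0, 1, 2}" unfolding h'_def by (rule mvars_mev) simp
  have eq: "meval h' (pt3 a b c) = meval h (pt3 a b c)" for a b c
    unfolding h'_def meval_mev_mConst
    by (rule arg_cong[where f = "meval h"], rule ext) (simp add: pt3_def)
  have "(a, b, c) \<in> {(a, b, c). meval g (pt3 a b c) = 0}" using g by simp
  hence "\<forall>h. mvars h \<subseteq> {0, 1, 2} \<longrightarrow>
      (\<forall>(a', b', c')\<in>offset_proj f. meval h (pt3 a' b' c') = 0) \<longrightarrow> meval h (pt3 a b c) = 0"
    unfolding zero_set_g zariski_closure3_def by simp
  moreover have "\<forall>(a', b', c')\<in>offset_proj f. meval h' (pt3 a' b' c') = 0"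
  proof (rule ballI, clarify)
    fix a' b' c' assume "(a', b', c') \<in> offset_proj f"
    then obtain y1 y2 t where "offset_point y1 y2 t c'" "a' = y1 + t * f1 y1 y2" "b' = y2 + t * f2 y1 y2"
      unfolding offset_proj_eq by (elim exE conjE)
    thus "meval h' (pt3 a' b' c') = 0" by (simp add: eq h)
  qed
  ultimately have "meval h' (pt3 a b c) = 0" using vars by (elim allE impE) assumption+
  thus ?thesis by (simp add: eq)
qed

sublocale offset_vanishing f g
proof
  show "mvars g \<subseteq> {0, 1, 2}" using g_eq unfolding is_generic_offset_eq_def by (elim conjE)
  fix y1 y2 t d assume "offset_point y1 y2 t d"
  hence *: "(y1 + t * f1 y1 y2, y2 + t * f2 y1 y2, d) \<in> offset_proj f"
    unfolding offset_proj_eq by (intro exI conjI) (assumption, rule refl, rule refl)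
  have "(y1 + t * f1 y1 y2, y2 + t * f2 y1 y2, d) \<in> zariski_closure3 (offset_proj f)"
    unfolding zariski_closure3_def mem_Collect_eq prod.case
  proof (intro allI impI)
    fix h
    assume "\<forall>(a', b', c')\<in>offset_proj f. meval h (pt3 a' b' c') = 0"
    from bspec[OF this *] show "meval h (pt3 (y1 + t * f1 y1 y2) (y2 + t * f2 y1 y2) d) = 0" by simp
  qed
  thus "meval g (offset_at y1 y2 t d) = 0"
    unfolding zero_set_g[symmetric] by simp
qed

abbreviation G where "G \<equiv> to_poly3 g"

lemma g_squarefree:
  assumes "q * q dvd g"
  shows "q dvd 1"
proof -
  have "\<forall>q. q * q dvd g \<longrightarrow> q dvd 1"
    using g_eq unfolding is_generic_offset_eq_def by (elim conjE)
  thus ?thesis using assms by blast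
qed

lemma g_nonzero: "g \<noteq> 0"
proof
  assume "g = 0"
  hence "(0::mpoly) dvd 1" using g_squarefree[of 0] by simp
  thus False by simp
qed

lemma of_G: "of_poly3 G = g"
  by (rule of_poly3_to_poly3[OF g_vars])

lemma G_nonzero: "G \<noteq> 0"
proof
  assume "G = 0"
  hence "of_poly3 G = 0" by simp
  thus False unfolding of_G using g_nonzero by simp
qed

lemma slice_G: "map_poly (\<lambda>c. eval2 c d k) G = curve3 [:0, 1:] [:k:] [:d:] g"
  by (rule poly_eq_complexI) (simp only: eval3_map_poly[symmetric] eval3_to_poly3 poly_curve3, simp)

lemma eval_pderiv_G: "eval3 (pderiv G) x d k = g1 (pt3 x k d)"
proof -
  have "eval3 (pderiv G) x d k = poly (pderiv (curve3 [:0, 1:] [:k:] [:d:] g)) x"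
    unfolding eval3_map_poly pderiv_slice[symmetric] slice_G ..
  thus ?thesis unfolding pderiv_curve3[OF g_vars] by (simp add: pderiv_pCons)
qed

text \<open>A prime factor of positive degree in x1 shared with the derivative would divide
  \<open>G\<close> twice, against square-freeness. A gcd of degree 0 in x1 suffices, because the
  eliminant is then a nonzero polynomial in d and k.\<close>

lemma generic_simple_roots: "generic (\<lambda>d k. \<forall>x. meval g (pt3 x k d) = 0 \<longrightarrow> g1 (pt3 x k d) \<noteq> 0)"
proof -
  have "degree (gcd G (pderiv G)) = 0"
  proof (rule ccontr)
    assume "degree (gcd G (pderiv G)) \<noteq> 0"
    then obtain h where h: "prime h" "h dvd gcd G (pderiv G)" "degree h \<noteq> 0"
      using prime_factor_of_positive_degree by blast
    have "h dvd G" using h(2) by auto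
    then obtain q where q: "G = h * q" by (elim dvdE)
    have "h dvd pderiv G" using h(2) by auto
    hence "h dvd h * pderiv q + q * pderiv h" by (simp add: q pderiv_mult)
    hence "h dvd q * pderiv h" using dvd_add_right_iff[of h "h * pderiv q"] by simp
    moreover have "\<not> h dvd pderiv h" using h(3) by (rule not_dvd_pderiv)
    ultimately have "h dvd q" using h(1) by (meson prime_dvd_multD)
    hence "h * h dvd G" unfolding q by (rule mult_dvd_mono[OF dvd_refl])
    then obtain r where "G = h * h * r" by (elim dvdE)
    hence "of_poly3 G = of_poly3 h * of_poly3 h * of_poly3 r" by (simp add: of_poly3.hom_mult)
    hence "g = of_poly3 h * of_poly3 h * of_poly3 r" unfolding of_G .
    hence "of_poly3 h dvd 1" using g_squarefree by simp
    then obtain s where "1 = of_poly3 h * s" by (elim dvdE)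
    from arg_cong[OF this, of to_poly3] have "1 = h * to_poly3 s"
      by (simp add: to_poly3.hom_mult to_poly3_of_poly3)
    hence "h dvd 1" by (rule dvdI)
    thus False using h(1) by auto
  qed
  from generic_no_common_zero[OF this G_nonzero] show ?thesis
    by (rule generic_mono) (simp add: eval3_to_poly3 eval_pderiv_G)
qed

text \<open>The inverse of the parametrization: where the d-derivative of g does not vanish, the foot point
  of a point of the offset is read off the gradient of g.\<close>

definition foot1 where "foot1 a = a 0 + a 2 * g1 a / gd a"
definition foot2 where "foot2 a = a 1 + a 2 * g2 a / gd a"

lemma foot_offset_at:
  assumes op: "offset_point y1 y2 t d" and nz: "gd (offset_at y1 y2 t d) \<noteq> 0"
  shows "foot1 (offset_at y1 y2 t d) = y1" "foot2 (offset_at y1 y2 t d) = y2"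
proof -
  let ?p = "offset_at y1 y2 t d"
  have p: "?p 0 = y1 + t * f1 y1 y2" "?p 1 = y2 + t * f2 y1 y2" "?p 2 = d" by (simp_all add: pt3_def)
  have "d * g1 ?p / gd ?p = - t * f1 y1 y2 \<and> d * g2 ?p / gd ?p = - t * f2 y1 y2"
  proof (cases "t = 0")
    case True
    hence "d = 0" using op by (simp add: offset_point_def)
    thus ?thesis using True by simp
  next
    case False
    show ?thesis unfolding gradient_normal[OF op False] using nz by simp
  qed
  thus "foot1 ?p = y1" "foot2 ?p = y2" unfolding foot1_def foot2_def p by auto
qed

text \<open>Clears denominators, so that statements about the rational foot point become polynomial
  and pass to the closure. The positive exponent makes both sides vanish where \<open>gd\<close>
  does; there the foot is only a default value of division by zero.\<close>

lemma foot_substitution: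
  assumes "mvars q \<subseteq> {0, 1}"
  shows "\<exists>N Q. \<forall>a. meval Q a = gd a ^ Suc N * meval q (pt2 (foot1 a) (foot2 a))"
proof -
  have pw: "w ^ Suc (Suc (N + M)) = w ^ Suc N * w ^ Suc M" for w :: complex and N M
    by (simp add: power_add mult_ac)
  show ?thesis using assms
proof (induction rule: mpoly_vars_induct)
  case (const c)
  show ?case by (rule exI[of _ 0], rule exI[of _ "mConst c * mpderiv 2 g"]) (simp add: meval.hom_mult)
next
  case (var i)
  have e: "w * (x + d * u / w) * w = w * (x * w + d * u)" for w x d u :: complex
    by (cases "w = 0") (simp_all add: distrib_right mult.assoc)
  from var consider "i = 0" | "i = 1" by auto
  thus ?case
  proof cases
    case 1
    have "meval (mpderiv 2 g * (mVar 0 * mpderiv 2 g + mVar 2 * mpderiv 0 g)) a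
      = gd a * (a 0 * gd a + a 2 * g1 a)" for a by (simp add: meval.hom_mult meval.hom_add)
    hence "meval (mpderiv 2 g * (mVar 0 * mpderiv 2 g + mVar 2 * mpderiv 0 g)) a
      = gd a ^ Suc 1 * meval (mVar i) (pt2 (foot1 a) (foot2 a))" for a
      unfolding e[symmetric] by (simp add: 1 pt2_def foot1_def One_nat_def)
    thus ?thesis by blast
  next
    case 2
    have "meval (mpderiv 2 g * (mVar 1 * mpderiv 2 g + mVar 2 * mpderiv 1 g)) a
      = gd a * (a 1 * gd a + a 2 * g2 a)" for a by (simp add: meval.hom_mult meval.hom_add)
    hence "meval (mpderiv 2 g * (mVar 1 * mpderiv 2 g + mVar 2 * mpderiv 1 g)) a
      = gd a ^ Suc 1 * meval (mVar i) (pt2 (foot1 a) (foot2 a))" for a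
      unfolding e[symmetric] by (simp add: 2 pt2_def foot2_def One_nat_def)
    thus ?thesis by blast
  qed
next
  case (add p q)
  then obtain N P M Q where *: "\<And>a. meval P a = gd a ^ Suc N * meval p (pt2 (foot1 a) (foot2 a))"
    "\<And>a. meval Q a = gd a ^ Suc M * meval q (pt2 (foot1 a) (foot2 a))" by metis
  have "meval (P * mpderiv 2 g ^ Suc M + Q * mpderiv 2 g ^ Suc N) a
    = gd a ^ Suc (Suc (N + M)) * meval (p + q) (pt2 (foot1 a) (foot2 a))" for a
    by (simp only: meval.hom_add meval.hom_mult meval.hom_power * pw distrib_left mult_ac)
  thus ?case by blast
next
  case (mult p q)
  then obtain N P M Q where *: "\<And>a. meval P a = gd a ^ Suc N * meval p (pt2 (foot1 a) (foot2 a))"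
    "\<And>a. meval Q a = gd a ^ Suc M * meval q (pt2 (foot1 a) (foot2 a))" by metis
  have "meval (P * Q) a = gd a ^ Suc (Suc (N + M)) * meval (p * q) (pt2 (foot1 a) (foot2 a))" for a
    by (simp only: meval.hom_mult * pw mult_ac)
  thus ?case by blast
qed
qed

text \<open>At parametrized points with \<open>gd\<close> nonzero the foot is the original curve
  point, and where \<open>gd\<close> is zero the cleared polynomial vanishes anyway. So it vanishes
  at every zero of \<open>g\<close>.\<close>

lemma foot_on_curve:
  assumes "meval g (pt3 x k d) = 0" "gd (pt3 x k d) \<noteq> 0"
  shows "fv (foot1 (pt3 x k d)) (foot2 (pt3 x k d)) = 0"
proof -
  obtain N Q where Q: "\<And>a. meval Q a = gd a ^ Suc N * meval f (pt2 (foot1 a) (foot2 a))"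
    using foot_substitution[OF f_vars] by blast
  have "meval Q (pt3 x k d) = 0"
  proof (rule vanishes_on_offset[OF _ assms(1)])
    fix y1 y2 t d assume op: "offset_point y1 y2 t d"
    show "meval Q (offset_at y1 y2 t d) = 0"
    proof (cases "gd (offset_at y1 y2 t d) = 0")
      case False
      have "fv y1 y2 = 0" using op by (simp add: offset_point_def)
      thus ?thesis by (simp add: Q foot_offset_at[OF op False])
    qed (simp add: Q)
  qed
  thus ?thesis using assms(2) by (simp add: Q)
qed

lemma foot_normal:
  assumes "meval g (pt3 x k d) = 0" "gd (pt3 x k d) \<noteq> 0" "d \<noteq> 0"
  defines "y1 \<equiv> foot1 (pt3 x k d)" and "y2 \<equiv> foot2 (pt3 x k d)"
  shows "f2 y1 y2 * g1 (pt3 x k d) = f1 y1 y2 * g2 (pt3 x k d)"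
proof -
  obtain N Q where Q: "\<And>a. meval Q a = gd a ^ Suc N * meval (mpderiv 0 f) (pt2 (foot1 a) (foot2 a))"
    using foot_substitution[OF partial_vars] by blast
  obtain M R where R: "\<And>a. meval R a = gd a ^ Suc M * meval (mpderiv 1 f) (pt2 (foot1 a) (foot2 a))"
    using foot_substitution[OF partial_vars] by blast
  define E where "E = mVar 2 * (R * mpderiv 2 g ^ Suc N * mpderiv 0 g - Q * mpderiv 2 g ^ Suc M * mpderiv 1 g)"
  have E: "meval E a = a 2 * gd a ^ Suc N * gd a ^ Suc M *
      (f2 (foot1 a) (foot2 a) * g1 a - f1 (foot1 a) (foot2 a) * g2 a)" for a
    by (simp add: E_def meval.hom_mult meval.hom_minus meval.hom_power Q R algebra_simps)
  have "meval E (pt3 x k d) = 0"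
  proof (rule vanishes_on_offset[OF _ assms(1)])
    fix y1 y2 t d assume op: "offset_point y1 y2 t d"
    let ?p = "offset_at y1 y2 t d"
    show "meval E ?p = 0"
    proof (cases "gd ?p = 0 \<or> t = 0")
      case False
      hence "f2 y1 y2 * g1 ?p - f1 y1 y2 * g2 ?p = 0" using gradient_tangent[OF op] by (simp add: mult_ac)
      thus ?thesis using False by (simp add: E foot_offset_at[OF op])
    next
      case True
      have "t = 0 \<Longrightarrow> d = 0" using op by (simp add: offset_point_def)
      hence "gd ?p = 0 \<or> ?p 2 = 0" using True by (auto simp: pt3_def)
      thus ?thesis by (auto simp: E)
    qed
  qed
  moreover have "pt3 x k d 2 = d" by (simp add: pt3_def)
  ultimately show ?thesis using assms(2,3) by (simp add: E y1_def y2_def)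
qed

text \<open>An eikonal equation: by normality d times the planar gradient is - gd times the
  displacement, whose squared length is d^2. The factor d^2 in \<open>E\<close> covers the points
  with t = 0.\<close>

lemma gradient_length:
  assumes "meval g (pt3 x k d) = 0" "gd (pt3 x k d) \<noteq> 0" "d \<noteq> 0"
  shows "(g1 (pt3 x k d))\<^sup>2 + (g2 (pt3 x k d))\<^sup>2 = (gd (pt3 x k d))\<^sup>2"
proof -
  define E where "E = (mVar 2)\<^sup>2 * ((mpderiv 0 g)\<^sup>2 + (mpderiv 1 g)\<^sup>2 - (mpderiv 2 g)\<^sup>2)"
  have E: "meval E a = (a 2 * g1 a)\<^sup>2 + (a 2 * g2 a)\<^sup>2 - (a 2 * gd a)\<^sup>2" for a
    by (simp add: E_def meval.hom_mult meval.hom_minus meval.hom_add meval.hom_power algebra_simps power_mult_distrib)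
  have "meval E (pt3 x k d) = 0"
  proof (rule vanishes_on_offset[OF _ assms(1)])
    fix y1 y2 t d assume op: "offset_point y1 y2 t d"
    let ?p = "offset_at y1 y2 t d"
    have p2: "?p 2 = d" by (simp add: pt3_def)
    have d2: "d\<^sup>2 = t\<^sup>2 * sg y1 y2" using op by (simp add: offset_point_def)
    show "meval E ?p = 0"
    proof (cases "t = 0")
      case True
      thus ?thesis using d2 by (simp add: E p2)
    next
      case False
      have "meval E ?p = (gd ?p)\<^sup>2 * (t\<^sup>2 * sg y1 y2 - d\<^sup>2)"
        unfolding E p2 gradient_normal[OF op False] by (simp add: algebra_simps power_mult_distrib)
      thus ?thesis using d2 by simp
    qed
  qed
  moreover have "pt3 x k d 2 = d" by (simp add: pt3_def)
  ultimately have "d\<^sup>2 * ((g1 (pt3 x k d))\<^sup>2 + (g2 (pt3 x k d))\<^sup>2 - (gd (pt3 x k d))\<^sup>2) = 0"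
    by (simp add: E algebra_simps power_mult_distrib)
  thus ?thesis using assms(3) by simp
qed

text \<open>A component of the offset on which sg vanishes at the foot point would be disjoint from the
  parametrized points off the locus of vanishing gradient; but the offset is the closure of those points.\<close>

lemma generic_regular_roots:
  "generic (\<lambda>d k. \<forall>x. meval g (pt3 x k d) = 0 \<longrightarrow> gd (pt3 x k d) \<noteq> 0 \<and>
     sg (foot1 (pt3 x k d)) (foot2 (pt3 x k d)) \<noteq> 0)"
proof -
  have "mvars ((mpderiv 0 f)\<^sup>2 + (mpderiv 1 f)\<^sup>2) \<subseteq> {0, 1}"
    by (intro order.trans[OF mvars_add] Un_least order.trans[OF mvars_power] partial_vars)
  \<comment> \<open>The polynomial \<open>Q\<close> is nonzero exactly where both conditions of the
    conclusion hold.\<close>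
  then obtain N Q where Q': "\<And>a. meval Q a
      = gd a ^ Suc N * meval ((mpderiv 0 f)\<^sup>2 + (mpderiv 1 f)\<^sup>2) (pt2 (foot1 a) (foot2 a))"
    using foot_substitution by blast
  have Q: "meval Q a = gd a ^ Suc N * sg (foot1 a) (foot2 a)" for a
    by (simp add: Q' meval.hom_add meval.hom_power)
  have "degree (gcd G (to_poly3 Q)) = 0"
  proof (rule ccontr)
    assume deg: "degree (gcd G (to_poly3 Q)) \<noteq> 0"
    define p where "p = gcd G (to_poly3 Q)"
    obtain q where q: "G = p * q" using gcd_dvd1[of G "to_poly3 Q"] unfolding p_def by (elim dvdE)
    obtain r where r: "to_poly3 Q = p * r" using gcd_dvd2[of G "to_poly3 Q"] unfolding p_def by (elim dvdE)
    have gpq: "meval g (pt3 x k d) = eval3 p x d k * eval3 q x d k" for x k d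
      using eval3_to_poly3[of g x d k] by (simp add: q eval3_def)
    have Qp: "meval Q (pt3 x k d) = eval3 p x d k * eval3 r x d k" for x k d
      using eval3_to_poly3[of Q x d k] by (simp add: r eval3_def)
    \<comment> \<open>This product vanishes on the whole offset. At a parametrized point with
      \<open>p\<close> zero, \<open>gd\<close> is zero since \<open>sg\<close> is nonzero at the
      true foot, and normality gives d g1 = 0; if \<open>p\<close> is nonzero, its cofactor
      \<open>q\<close> is zero.\<close>
    define h where "h = mVar 2 * of_poly3 q * mpderiv 0 g"
    have h: "meval h (pt3 x k d) = d * eval3 q x d k * g1 (pt3 x k d)" for x k d
    proof -
      have "pt3 x k d 2 = d" by (simp add: pt3_def)
      moreover have "meval (of_poly3 q) (pt3 x k d) = eval3 q x d k"
        using eval3_to_poly3[of "of_poly3 q" x d k] by (simp add: to_poly3_of_poly3)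
      ultimately show ?thesis by (simp add: h_def meval.hom_mult)
    qed
    have van: "meval h (pt3 x k d) = 0" if "meval g (pt3 x k d) = 0" for x k d
    proof (rule vanishes_on_offset[OF _ that])
      fix y1 y2 t d assume op: "offset_point y1 y2 t d"
      let ?x = "y1 + t * f1 y1 y2" and ?k = "y2 + t * f2 y1 y2"
      let ?p = "pt3 ?x ?k d"
      show "meval h ?p = 0"
      proof (cases "eval3 p ?x d ?k = 0")
        case True
        hence "meval Q ?p = 0" by (simp add: Qp)
        moreover have "gd ?p \<noteq> 0 \<Longrightarrow> meval Q ?p \<noteq> 0"
          using op by (simp add: Q foot_offset_at[OF op] offset_point_def)
        ultimately have gd0: "gd ?p = 0" by blast
        have "d * g1 ?p = 0"
        proof (cases "t = 0")
          case True
          thus ?thesis using op by (simp add: offset_point_def)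
        next
          case False
          show ?thesis unfolding gradient_normal[OF op False] by (simp add: gd0)
        qed
        thus ?thesis by (auto simp: h)
      next
        case False
        hence "eval3 q ?x d ?k = 0" using g_vanishes[OF op] by (simp add: gpq)
        thus ?thesis by (simp add: h)
      qed
    qed
    have "degree p \<noteq> 0" using deg by (simp add: p_def)
    from generic_conj[OF generic_conj[OF generic_root[OF this] generic_simple_roots]
        generic_d_nonzero]
    obtain d k x where x: "eval3 p x d k = 0" "d \<noteq> 0"
      and simple: "\<And>x. meval g (pt3 x k d) = 0 \<Longrightarrow> g1 (pt3 x k d) \<noteq> 0"
      by (rule generic_ex) auto
    have g0: "meval g (pt3 x k d) = 0" by (simp add: gpq x)
    have "eval3 q x d k = 0" using van[OF g0] simple[OF g0] x(2) by (simp add: h)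
    \<comment> \<open>With \<open>p\<close> and its cofactor both zero at x, the root would be
      multiple.\<close>
    moreover have "g1 (pt3 x k d) = eval3 p x d k * eval3 (pderiv q) x d k + eval3 q x d k * eval3 (pderiv p) x d k"
      unfolding eval_pderiv_G[symmetric] q pderiv_mult by (simp add: eval3_def)
    ultimately show False using simple[OF g0] x(1) by simp
  qed
  from generic_no_common_zero[OF this G_nonzero] show ?thesis
    by (rule generic_mono) (auto simp: eval3_to_poly3 Q)
qed

end

section \<open>Roots of the offset equation at height k and their feet\<close>

context plane_curve
begin

text \<open>The condition on \<open>f2\<close> gives the normal at the foot exactly one point of
  height k, reached for t = (k - y2) / f2.\<close>

definition line_feet :: "complex \<Rightarrow> complex \<Rightarrow> (complex \<times> complex) set" where
  "line_feet d k = {(y1, y2). fv y1 y2 = 0 \<and> f2 y1 y2 \<noteq> 0 \<and> sg y1 y2 \<noteq> 0 \<and>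
     sg y1 y2 * (y2 - k)\<^sup>2 = (f2 y1 y2)\<^sup>2 * d\<^sup>2}"

end

context generic_offset_eq
begin

lemma line_feet_offset_point:
  assumes "(y1, y2) \<in> line_feet d k"
  defines "t \<equiv> (k - y2) / f2 y1 y2"
  shows "offset_point y1 y2 t d" "k = y2 + t * f2 y1 y2"
proof -
  have *: "fv y1 y2 = 0" "f2 y1 y2 \<noteq> 0" "sg y1 y2 \<noteq> 0"
    "sg y1 y2 * (y2 - k)\<^sup>2 = (f2 y1 y2)\<^sup>2 * d\<^sup>2"
    using assms(1) by (auto simp: line_feet_def)
  show "k = y2 + t * f2 y1 y2" using *(2) by (simp add: t_def)
  have "(f2 y1 y2)\<^sup>2 * t\<^sup>2 = (y2 - k)\<^sup>2"
    using *(2) by (simp add: t_def power_divide power2_commute)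
  hence "(f2 y1 y2)\<^sup>2 * d\<^sup>2 = (f2 y1 y2)\<^sup>2 * (t\<^sup>2 * sg y1 y2)"
    by (metis *(4) mult.assoc mult.commute)
  thus "offset_point y1 y2 t d" using *(1-3) by (simp add: offset_point_def)
qed

theorem generic_card_line_feet: "generic (\<lambda>d k. card (line_feet d k) = degree G)"
proof -
  \<comment> \<open>These are the heights of curve points with horizontal normal, to be avoided by
    k: a root whose foot is such a point would lie at the height of that foot.\<close>
  have fin: "finite (snd ` {(y1, y2). fv y1 y2 = 0 \<and> f2 y1 y2 = 0})"
    using finite_f2_zeros by simp
  from generic_conj[OF generic_conj[OF generic_conj[OF generic_simple_roots generic_regular_roots]
    generic_conj[OF generic_degree_slice[OF G_nonzero] generic_d_nonzero]]
    generic_snd[OF eventually_cofinite_notin[OF fin]]]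
  show ?thesis
  proof (rule generic_mono)
    fix d k
    assume "(((\<forall>x. meval g (pt3 x k d) = 0 \<longrightarrow> g1 (pt3 x k d) \<noteq> 0) \<and>
      (\<forall>x. meval g (pt3 x k d) = 0 \<longrightarrow> gd (pt3 x k d) \<noteq> 0 \<and> sg (foot1 (pt3 x k d)) (foot2 (pt3 x k d)) \<noteq> 0)) \<and>
      degree (map_poly (\<lambda>c. eval2 c d k) G) = degree G \<and> d \<noteq> 0) \<and>
      k \<notin> snd ` {(y1, y2). fv y1 y2 = 0 \<and> f2 y1 y2 = 0}"
    hence simple: "\<And>x. meval g (pt3 x k d) = 0 \<Longrightarrow> g1 (pt3 x k d) \<noteq> 0"
      and reg: "\<And>x. meval g (pt3 x k d) = 0 \<Longrightarrow> gd (pt3 x k d) \<noteq> 0"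
        "\<And>x. meval g (pt3 x k d) = 0 \<Longrightarrow> sg (foot1 (pt3 x k d)) (foot2 (pt3 x k d)) \<noteq> 0"
      and deg: "degree (map_poly (\<lambda>c. eval2 c d k) G) = degree G" and d0: "d \<noteq> 0"
      and k: "k \<notin> snd ` {(y1, y2). fv y1 y2 = 0 \<and> f2 y1 y2 = 0}" by blast+
    let ?u = "map_poly (\<lambda>c. eval2 c d k) G"
    let ?R = "{x. meval g (pt3 x k d) = 0}"
    have u: "poly ?u x = meval g (pt3 x k d)" for x
      by (simp add: eval3_to_poly3 flip: eval3_map_poly)
    have du: "poly (pderiv ?u) x = g1 (pt3 x k d)" for x
      by (simp add: pderiv_slice eval_pderiv_G flip: eval3_map_poly)
    have "?u \<noteq> 0" using simple u du by (metis pderiv_0 poly_0)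
    hence cardR: "card ?R = degree G"
      using card_roots_complex[of ?u] simple by (simp add: u du deg)
    define \<phi> where "\<phi> = (\<lambda>(y1, y2). y1 + (k - y2) / f2 y1 y2 * f1 y1 y2)"
    define \<psi> where "\<psi> = (\<lambda>x. (foot1 (pt3 x k d), foot2 (pt3 x k d)))"
    have "bij_betw \<phi> (line_feet d k) ?R"
    proof (rule bij_betw_byWitness[where f' = \<psi>])
      have A: "\<phi> y \<in> ?R \<and> \<psi> (\<phi> y) = y" if y: "y \<in> line_feet d k" for y
      proof -
        obtain y1 y2 where y12: "y = (y1, y2)" by (cases y)
        define t where "t = (k - y2) / f2 y1 y2"
        have op: "offset_point y1 y2 t d" and kk: "k = y2 + t * f2 y1 y2"
          using line_feet_offset_point[of y1 y2 d k] y y12 by (simp_all add: t_def)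
        have ph: "\<phi> y = y1 + t * f1 y1 y2" by (simp add: \<phi>_def y12 t_def)
        have pt: "pt3 (\<phi> y) k d = offset_at y1 y2 t d" unfolding ph by (subst kk) simp
        have 0: "meval g (pt3 (\<phi> y) k d) = 0" unfolding pt by (rule g_vanishes[OF op])
        have "gd (offset_at y1 y2 t d) \<noteq> 0" using reg(1)[OF 0] unfolding pt .
        from foot_offset_at[OF op this] have "\<psi> (\<phi> y) = y" unfolding \<psi>_def pt by (simp add: y12)
        thus ?thesis using 0 by simp
      qed
      have B: "\<psi> x \<in> line_feet d k \<and> \<phi> (\<psi> x) = x" if x: "x \<in> ?R" for x
      proof -
        have g0: "meval g (pt3 x k d) = 0" using x by simp
        let ?p = "pt3 x k d"
        define y1 y2 where "y1 = foot1 ?p" and "y2 = foot2 ?p"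
        note gdn = reg(1)[OF g0]
        have fy: "fv y1 y2 = 0" unfolding y1_def y2_def by (rule foot_on_curve[OF g0 gdn])
        have sy: "sg y1 y2 \<noteq> 0" unfolding y1_def y2_def by (rule reg(2)[OF g0])
        have nrm: "f2 y1 y2 * g1 ?p = f1 y1 y2 * g2 ?p"
          unfolding y1_def y2_def by (rule foot_normal[OF g0 gdn d0])
        have len: "(g1 ?p)\<^sup>2 + (g2 ?p)\<^sup>2 = (gd ?p)\<^sup>2" by (rule gradient_length[OF g0 gdn d0])
        have p: "?p 0 = x" "?p 1 = k" "?p 2 = d" by (simp_all add: pt3_def)
        define v1 v2 where "v1 = x - y1" and "v2 = k - y2"
        have v: "v1 = - d * g1 ?p / gd ?p" "v2 = - d * g2 ?p / gd ?p"
          unfolding v1_def v2_def y1_def y2_def foot1_def foot2_def p by simp_all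
        have vn: "f2 y1 y2 * v1 = f1 y1 y2 * v2" unfolding v using nrm by (simp add: field_simps)
        have "v1\<^sup>2 + v2\<^sup>2 = d\<^sup>2 * ((g1 ?p)\<^sup>2 + (g2 ?p)\<^sup>2) / (gd ?p)\<^sup>2"
          unfolding v by (simp add: power_divide power_mult_distrib distrib_left add_divide_distrib)
        hence vl: "v1\<^sup>2 + v2\<^sup>2 = d\<^sup>2" unfolding len using gdn by simp
        have f2n: "f2 y1 y2 \<noteq> 0"
        proof
          assume 0: "f2 y1 y2 = 0"
          hence "f1 y1 y2 \<noteq> 0" using sy by auto
          hence "k = y2" using vn 0 by (simp add: v2_def)
          thus False using k fy 0 by force
        qed
        have "sg y1 y2 * v2\<^sup>2 = (f1 y1 y2 * v2)\<^sup>2 + (f2 y1 y2 * v2)\<^sup>2"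
          by (simp add: algebra_simps power_mult_distrib)
        also have "\<dots> = (f2 y1 y2)\<^sup>2 * (v1\<^sup>2 + v2\<^sup>2)"
          unfolding vn[symmetric] by (simp add: algebra_simps power_mult_distrib)
        finally have "sg y1 y2 * (y2 - k)\<^sup>2 = (f2 y1 y2)\<^sup>2 * d\<^sup>2"
          unfolding vl by (simp add: v2_def power2_commute[of k])
        hence mem: "(y1, y2) \<in> line_feet d k" using fy f2n sy by (simp add: line_feet_def)
        have "v2 / f2 y1 y2 * f1 y1 y2 = v1" using vn f2n by (simp add: field_simps)
        hence "\<phi> (y1, y2) = x" by (simp add: \<phi>_def v1_def v2_def)
        thus ?thesis using mem by (simp add: \<psi>_def y1_def y2_def)
      qed
      show "\<forall>y\<in>line_feet d k. \<psi> (\<phi> y) = y" "\<phi> ` line_feet d k \<subseteq> ?R" using A by blast+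
      show "\<forall>x\<in>?R. \<phi> (\<psi> x) = x" "\<psi> ` ?R \<subseteq> line_feet d k" using B by blast+
    qed
    from bij_betw_same_card[OF this] show "card (line_feet d k) = degree G" using cardR by simp
  qed
qed

end

text \<open>Scaling x1 leaves the inner variables alone, so corresponding coefficients of the two
  univariate polynomials differ, after transport by \<open>of_poly2 2 1\<close>, by the nonzero
  factor \<open>mVar 0 ^ n\<close> and vanish together.\<close>

lemma degree_to_poly3:
  assumes "mvars g \<subseteq> {0, 1, 2}"
  shows "degree (to_poly3 g) = mdegV {0} g"
proof -
  have c: "scale_poly {0} q = [:q:]" if "mvars q \<subseteq> {1, 2}" for q
    by (rule comm_ring_hom_unique_on_mpoly[OF scale_poly_hom const_poly_hom that]) auto
  have "scale_poly {0} (of_poly3 Q) = (\<Sum>i\<le>degree Q. monom (of_poly2 2 1 (coeff Q i) * mVar 0 ^ i) i)" for Q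
  proof -
    have "of_poly3 Q = (\<Sum>i\<le>degree Q. of_poly2 2 1 (coeff Q i) * mVar 0 ^ i)"
    proof -
      have m: "of_poly3 (monom c i) = of_poly2 2 1 c * mVar 0 ^ i" for c i
      proof -
        have "monom c i = [:c:] * [:0, 1:] ^ i" by (simp add: monom_altdef)
        thus ?thesis by (simp only: of_poly3.hom_mult of_poly3.hom_power of_poly3_simps)
      qed
      have "of_poly3 Q = of_poly3 (\<Sum>i\<le>degree Q. monom (coeff Q i) i)"
        by (simp add: poly_as_sum_of_monoms)
      thus ?thesis by (simp only: of_poly3.hom_sum m)
    qed
    moreover have "scale_poly {0} (of_poly2 2 1 q) = [:of_poly2 2 1 q:]" for q
      by (rule c) (use mvars_of_poly2[of 2 1 q] in auto)
    moreover have "[:0, mVar 0:] ^ i = monom (mVar 0 ^ i) i" for i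
      by (induction i) (auto simp: monom_Suc smult_monom simp flip: one_pCons)
    ultimately show ?thesis
      by (simp add: scale_poly.hom_sum scale_poly.hom_mult scale_poly.hom_power smult_monom)
  qed
  hence co: "coeff (scale_poly {0} (of_poly3 Q)) n = of_poly2 2 1 (coeff Q n) * mVar 0 ^ n" for Q n
    by (simp add: coeff_sum coeff_eq_0)
  have inj: "of_poly2 2 1 q = 0 \<longleftrightarrow> q = 0" for q
  proof
    assume "of_poly2 2 1 q = 0"
    hence "of_poly3 [:q:] = 0" by simp
    thus "q = 0" using to_poly3_of_poly3[of "[:q:]"] by simp
  qed simp
  have "mVar 0 \<noteq> 0" by (rule mVar_nonzero)
  hence "coeff (scale_poly {0} (of_poly3 Q)) n = 0 \<longleftrightarrow> coeff Q n = 0" for Q n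
    by (simp add: co inj)
  hence "degree (scale_poly {0} (of_poly3 Q)) = degree Q" for Q
    unfolding degree_def by simp
  from this[of "to_poly3 g"] show ?thesis
    by (simp add: of_poly3_to_poly3[OF assms] degree_scale_poly)
qed

section \<open>The resultant\<close>

lemma meval_single: "meval (single m c) a = c * mmon a m"
proof -
  interpret mev_hom "\<lambda>c. c" a unfolding mev_hom_def by (rule comm_ring_hom_id)
  show ?thesis unfolding meval_mev by (rule mev_single)
qed

lemma mvars_det:
  fixes A :: "mpoly mat"
  assumes "\<And>i j. i < dim_row A \<Longrightarrow> j < dim_col A \<Longrightarrow> mvars (A $$ (i, j)) \<subseteq> V"
  shows "mvars (det A) \<subseteq> V"
proof (cases "dim_row A = dim_col A")
  case True
  have s: "mvars (signof p :: mpoly) = {}" for p :: "nat \<Rightarrow> nat"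
    by (cases p rule: sign_cases) simp_all
  define h where "h = (\<lambda>p. signof p * (\<Prod>i = 0..<dim_row A. A $$ (i, p i)))"
  have "mvars (h p) \<subseteq> V" if "p permutes {0..<dim_row A}" for p
  proof -
    have "mvars (A $$ (i, p i)) \<subseteq> V" if i: "i \<in> {0..<dim_row A}" for i
    proof -
      have "p i \<in> {0..<dim_row A}" using \<open>p permutes {0..<dim_row A}\<close> i permutes_in_image by metis
      thus ?thesis using i True by (intro assms) simp_all
    qed
    hence "(\<Union>i\<in>{0..<dim_row A}. mvars (A $$ (i, p i))) \<subseteq> V" by (rule UN_least)
    hence "mvars (\<Prod>i = 0..<dim_row A. A $$ (i, p i)) \<subseteq> V"
      by (rule order.trans[OF mvars_prod])
    hence "mvars (signof p) \<union> mvars (\<Prod>i = 0..<dim_row A. A $$ (i, p i)) \<subseteq> V"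
      unfolding s by simp
    thus ?thesis unfolding h_def by (rule order.trans[OF mvars_mult])
  qed
  hence "(\<Union>p\<in>{p. p permutes {0..<dim_row A}}. mvars (h p)) \<subseteq> V"
    by (intro UN_least) (rule CollectE)
  hence "mvars (\<Sum>p\<in>{p. p permutes {0..<dim_row A}}. h p) \<subseteq> V"
    by (rule order.trans[OF mvars_sum])
  moreover have "det A = (\<Sum>p\<in>{p. p permutes {0..<dim_row A}}. h p)"
    unfolding det_def h_def using True by simp
  ultimately show ?thesis by simp
qed (simp add: det_def)

lemma mvars_mres:
  assumes "mvars p \<subseteq> insert i V" "mvars q \<subseteq> insert i V"
  shows "mvars (mres i p q) \<subseteq> V"
  unfolding mres_def resultant_def
  by (rule mvars_det) (use assms in \<open>auto simp: sylvester_index_mat dest: subsetD[OF mvars_coeff_mto_upoly]\<close>)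

definition pt5 :: "complex \<Rightarrow> complex \<Rightarrow> complex \<Rightarrow> complex \<Rightarrow> complex \<Rightarrow> nat \<Rightarrow> complex" where
  "pt5 a b z d k = (\<lambda>i. if i = 0 then a else if i = 1 then b else if i = 2 then z
     else if i = 3 then d else if i = 4 then k else 0)"

lemma pt5_simps [simp]: "pt5 a b z d k 0 = a" "pt5 a b z d k 1 = b" "pt5 a b z d k 2 = z"
  "pt5 a b z d k 3 = d" "pt5 a b z d k 4 = k"
  by (simp_all add: pt5_def)

lemma pt5_upd: "(pt5 a b z d k)(2 := w) = pt5 a b w d k"
  by (rule ext) (simp add: pt5_def)

lemma meval_pt5_pt3: "mvars q \<subseteq> {0, 1, 2} \<Longrightarrow> meval q (pt5 a b z d k) = meval q (pt3 a b z)"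
  by (rule meval_cong) (auto simp: pt5_def pt3_def)

lemma eventually_all_finite:
  "finite A \<Longrightarrow> (\<And>x. x \<in> A \<Longrightarrow> eventually (P x) F) \<Longrightarrow> eventually (\<lambda>y. \<forall>x\<in>A. P x y) F"
  by (simp add: eventually_ball_finite)

section \<open>Homogenization and the resultant over a fixed slope\<close>

context plane_curve
begin

abbreviation (input) n where "n \<equiv> mtdeg f"
abbreviation (input) F where "F \<equiv> homog f"

text \<open>Ensures that the exponent of y3 in \<open>homog\<close>, a difference of natural
  numbers, is not truncated.\<close>

lemma key_degree_le:
  assumes "m \<in> keys f"
  shows "lookup m 0 + lookup m 1 \<le> n"
proof -
  have "n = mdegV {0, 1} f" by (rule mtdeg_eq_mdegV) (use f_vars in auto)
  moreover have "(\<Sum>i\<in>{0, 1}. lookup m i) \<le> mdegV {0, 1} f"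
    unfolding mdegV_def using assms by (intro Max_ge) auto
  ultimately show ?thesis by simp
qed

lemma mmon_key:
  assumes "m \<in> keys f"
  shows "mmon a m = (a 0 ^ lookup m 0 * a 1 ^ lookup m 1 :: complex)"
proof -
  have "keys m \<subseteq> {0, 1}" using assms f_vars unfolding mvars_def by blast
  from mmon_superset[OF _ this, of a] show ?thesis by simp
qed

lemma f_eval: "meval f a = (\<Sum>m\<in>keys f. lookup f m *
    (a 0 ^ lookup m 0 * a 1 ^ lookup m 1))"
  unfolding meval_mev mev_def by (rule sum.cong) (simp_all add: mmon_key)

lemma homog_eval: "meval F a = (\<Sum>m\<in>keys f. lookup f m *
    (a 0 ^ lookup m 0 * a 1 ^ lookup m 1
      * a 2 ^ (n - lookup m 0 - lookup m 1)))"
  unfolding homog_def meval.hom_sum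
  by (rule sum.cong) (simp_all add: meval_single mmon_add mmon_single mmon_key)

lemma homog_vars: "mvars F \<subseteq> {0, 1, 2}"
proof -
  have "mvars (single (m + single 2 j) c) \<subseteq> {0, 1, 2}"
    if "m \<in> keys f" for m j c
  proof -
    have "keys m \<subseteq> {0, 1}" using that f_vars unfolding mvars_def by blast
    moreover have "keys (single (2::nat) j) \<subseteq> {2}" by simp
    ultimately have "keys (m + single 2 j) \<subseteq> {0, 1, 2}"
      using keys_add[of m "single 2 j"] by blast
    thus ?thesis by (simp add: mvars_def)
  qed
  hence "(\<Union>m\<in>keys f. mvars (single
     (m + single 2 (n - lookup m 0 - lookup m 1))
     (lookup f m))) \<subseteq> {0, 1, 2}" by (intro UN_least)
  with mvars_sum show ?thesis unfolding homog_def by (rule order.trans)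
qed

lemma homog_scale: "meval F (pt3 (s * a) (s * b) (s * z)) = s ^ n * meval F (pt3 a b z)"
proof -
  have e: "s ^ n = s ^ i * s ^ j * s ^ (n - i - j)" if "i + j \<le> n" for i j
    using that by (simp flip: power_add)
  thus ?thesis
    unfolding homog_eval sum_distrib_left
  proof (intro sum.cong refl)
    fix m assume m: "m \<in> keys f"
    let ?i = "lookup m 0" and ?j = "lookup m 1"
    show "lookup f m * (pt3 (s * a) (s * b) (s * z) 0 ^ ?i * pt3 (s * a) (s * b) (s * z) 1 ^ ?j
        * pt3 (s * a) (s * b) (s * z) 2 ^ (n - ?i - ?j))
      = s ^ n * (lookup f m * (pt3 a b z 0 ^ ?i * pt3 a b z 1 ^ ?j * pt3 a b z 2 ^ (n - ?i - ?j)))"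
      unfolding e[OF key_degree_le[OF m]] by (simp add: pt3_def power_mult_distrib mult_ac)
  qed
qed

lemma homog_dehomog:
  assumes "z \<noteq> 0"
  shows "meval F (pt3 a b z) = z ^ n * fv (a / z) (b / z)"
proof -
  have "meval F (pt3 (a / z) (b / z) 1) = fv (a / z) (b / z)"
    unfolding homog_eval f_eval by (simp add: pt3_def pt2_def)
  thus ?thesis using homog_scale[of z "a / z" "b / z" 1] assms by simp
qed

text \<open>The extra factor z keeps the exponent at n instead of n - 1. Each term of
  \<open>S_poly\<close> has a z^2 to spare for it, once y2 is written as z times the affine
  ordinate.\<close>

lemma homog_partials:
  assumes "z \<noteq> 0"
  shows "meval (mpderiv 0 F) (pt3 a b z) * z = z ^ n * f1 (a / z) (b / z)"
    and "meval (mpderiv 1 F) (pt3 a b z) * z = z ^ n * f2 (a / z) (b / z)"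
proof -
  have "curve3 [:a, 1:] [:b:] [:z:] F = Polynomial.smult (z ^ n) (curve2 [:a / z, 1 / z:] [:b / z:] f)"
    by (rule poly_eq_complexI) (simp add: homog_dehomog[OF assms] add_divide_distrib)
  from arg_cong[OF this, of "\<lambda>p. poly (pderiv p) 0"]
  have "meval (mpderiv 0 F) (pt3 a b z) = z ^ n * (f1 (a / z) (b / z) / z)"
    unfolding pderiv_curve3[OF homog_vars] pderiv_smult pderiv_curve2[OF f_vars]
    by (simp add: pderiv_pCons)
  thus "meval (mpderiv 0 F) (pt3 a b z) * z = z ^ n * f1 (a / z) (b / z)" using assms by simp
  have "curve3 [:a:] [:b, 1:] [:z:] F = Polynomial.smult (z ^ n) (curve2 [:a / z:] [:b / z, 1 / z:] f)"
    by (rule poly_eq_complexI) (simp add: homog_dehomog[OF assms] add_divide_distrib)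
  from arg_cong[OF this, of "\<lambda>p. poly (pderiv p) 0"]
  have "meval (mpderiv 1 F) (pt3 a b z) = z ^ n * (f2 (a / z) (b / z) / z)"
    unfolding pderiv_curve3[OF homog_vars] pderiv_smult pderiv_curve2[OF f_vars]
    by (simp add: pderiv_pCons)
  thus "meval (mpderiv 1 F) (pt3 a b z) * z = z ^ n * f2 (a / z) (b / z)" using assms by simp
qed

lemma homog_euler:
  "a * meval (mpderiv 0 F) (pt3 a b z) + b * meval (mpderiv 1 F) (pt3 a b z)
    + z * meval (mpderiv 2 F) (pt3 a b z) = of_nat n * meval F (pt3 a b z)"
proof -
  have "curve3 [:a, a:] [:b, b:] [:z, z:] F = Polynomial.smult (meval F (pt3 a b z)) ([:1, 1:] ^ n)"
  proof (rule poly_eq_complexI)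
    fix s
    show "poly (curve3 [:a, a:] [:b, b:] [:z, z:] F) s
      = poly (Polynomial.smult (meval F (pt3 a b z)) ([:1, 1:] ^ n)) s"
      using homog_scale[of "1 + s" a b z] by (simp add: distrib_right distrib_left poly_power mult_ac)
  qed
  from arg_cong[OF this, of "\<lambda>p. poly (pderiv p) 0"] show ?thesis
    unfolding pderiv_curve3[OF homog_vars] pderiv_smult pderiv_power
    by (simp add: pderiv_pCons mult_ac)
qed

definition sfun :: "complex \<times> complex \<Rightarrow> complex \<Rightarrow> complex \<Rightarrow> complex" where
  "sfun y d k = sg (fst y) (snd y) * (snd y - k)\<^sup>2 - (f2 (fst y) (snd y))\<^sup>2 * d\<^sup>2"

lemma S_poly_vars: "mvars (S_poly f) \<subseteq> insert 2 {0, 1, 3, 4}"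
proof -
  have p: "mvars (mpderiv i F) \<subseteq> insert 2 {0, 1, 3, 4}" for i
    using mvars_mpderiv[of i F] homog_vars by blast
  show ?thesis unfolding S_poly_def Let_def
    by (intro order.trans[OF mvars_diff] order.trans[OF mvars_add] order.trans[OF mvars_mult]
        order.trans[OF mvars_power] Un_least p) simp_all
qed

lemma S_poly_dehomog:
  assumes "z \<noteq> 0"
  shows "meval (S_poly f) (pt5 a b z d k) = z ^ (2 * n) * sfun (a / z, b / z) d k"
proof -
  let ?F1 = "meval (mpderiv 0 F) (pt3 a b z)" and ?F2 = "meval (mpderiv 1 F) (pt3 a b z)"
  have v: "mvars (mpderiv i F) \<subseteq> {0, 1, 2}" for i using mvars_mpderiv[of i F] homog_vars by blast
  have "meval (S_poly f) (pt5 a b z d k) = (?F1\<^sup>2 + ?F2\<^sup>2) * (b - k * z)\<^sup>2 - ?F2\<^sup>2 * z\<^sup>2 * d\<^sup>2"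
    unfolding S_poly_def Let_def
    by (simp only: meval.hom_minus meval.hom_add meval.hom_mult meval.hom_power meval_mVar pt5_simps
        meval_pt5_pt3[OF v])
  also have "\<dots> = ((?F1 * z)\<^sup>2 + (?F2 * z)\<^sup>2) * (b / z - k)\<^sup>2 - (?F2 * z)\<^sup>2 * d\<^sup>2"
  proof -
    have "(b - k * z)\<^sup>2 = z\<^sup>2 * (b / z - k)\<^sup>2"
      using assms by (simp add: right_diff_distrib mult.commute flip: power_mult_distrib)
    thus ?thesis by (simp only: power_mult_distrib distrib_right distrib_left mult_ac)
  qed
  also have "\<dots> = z ^ (2 * n) * sfun (a / z, b / z) d k"
    unfolding homog_partials[OF assms] sfun_def
    by (simp add: power_mult_distrib power_mult mult.commute[of 2] right_diff_distrib distrib_left distrib_right mult_ac)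
  finally show ?thesis .
qed

abbreviation (input) Fz where "Fz \<equiv> mto_upoly 2 F"
abbreviation (input) LF where "LF \<equiv> lead_coeff Fz"
abbreviation (input) NS where "NS \<equiv> degree (mto_upoly 2 (S_poly f))"

lemma LF_vars: "mvars LF \<subseteq> {0, 1}"
  by (rule mvars_coeff_mto_upoly) (use homog_vars in blast)

lemma res_FS_vars: "mvars (res_FS f) \<subseteq> {0, 1, 3, 4}"
  unfolding res_FS_def by (rule mvars_mres) (use homog_vars S_poly_vars in blast)+

lemma f_nonzero: "f \<noteq> 0"
  using f_irred by (auto simp: irreducible_def)

text \<open>At y3 = 0 only the monomials of full degree survive, and the top form of
  \<open>f\<close> is not zero.\<close>

lemma homog_at_infinity_nonzero: "\<exists>a b. b \<noteq> 0 \<and> meval F (pt3 a b 0) \<noteq> 0"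
proof -
  let ?top = "coeff (scale_poly {0, 1} f) n"
  have n: "n = mdegV {0, 1} f" by (rule mtdeg_eq_mdegV) (use f_vars in auto)
  have "scale_poly {0, 1} f \<noteq> 0"
  proof
    assume "scale_poly {0, 1} f = 0"
    moreover have "(\<lambda>i. if i \<in> {0, 1} then 1 * a i else a i) = a" for a :: "nat \<Rightarrow> complex" by auto
    ultimately have "meval f a = 0" for a
      using scale_poly_eval[of a "{0, 1}" f 1] by (simp only: map_poly_0 poly_0)
    thus False using mpoly_eq_0I f_nonzero by blast
  qed
  hence "?top \<noteq> 0" unfolding n degree_scale_poly[symmetric, OF finite.insertI[OF finite.insertI[OF finite.emptyI]]]
    by simp
  \<comment> \<open>The factor \<open>mVar 1\<close> forces the point found next to have nonzero
    second coordinate, so that it has a slope.\<close>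
  hence "?top * mVar 1 \<noteq> 0" using mVar_nonzero by simp
  then obtain x where x: "meval (?top * mVar 1) x \<noteq> 0" using mpoly_eq_0I by blast
  have "meval ?top x = meval F (pt3 (x 0) (x 1) 0)"
  proof -
    have "meval ?top x = (\<Sum>m\<in>keys f. meval (coeff (monom (single m (lookup f m))
        (\<Sum>i\<in>{0, 1}. lookup m i)) n) x)"
      by (subst scale_poly_sum) (simp_all only: coeff_sum meval.hom_sum finite.intros)
    also have "\<dots> = meval F (pt3 (x 0) (x 1) 0)"
      unfolding homog_eval
    proof (rule sum.cong[OF refl])
      fix m assume m: "m \<in> keys f"
      show "meval (coeff (monom (single m (lookup f m))
        (\<Sum>i\<in>{0, 1}. lookup m i)) n) x = lookup f m *
          (pt3 (x 0) (x 1) 0 0 ^ lookup m 0 * pt3 (x 0) (x 1) 0 1 ^ lookup m 1 *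
          pt3 (x 0) (x 1) 0 2 ^ (n - lookup m 0 - lookup m 1))"
        using key_degree_le[OF m] mmon_key[OF m, of x]
        by (cases "lookup m 0 + lookup m 1 = n")
          (simp_all add: meval_single pt3_def power_0_left)
    qed
    finally show ?thesis .
  qed
  thus ?thesis using x by (intro exI[of _ "x 0"] exI[of _ "x 1"]) (auto simp: meval.hom_mult)
qed

lemma Fz_eval: "poly (map_poly (\<lambda>c. meval c (pt5 a b z0 d k)) Fz) z = meval F (pt3 a b z)"
  unfolding meval_mto_upoly pt5_upd by (rule meval_pt5_pt3[OF homog_vars])

text \<open>Compares top coefficients in y3 on both sides of the homogeneity of \<open>F\<close>.
  The degree of \<open>Fz\<close> appears as an exponent on the left to avoid a subtraction on the
  right.\<close>

lemma LF_scale: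
  assumes "s \<noteq> 0"
  shows "meval LF (pt2 (s * a) (s * b)) * s ^ degree Fz = s ^ n * meval LF (pt2 a b)"
proof -
  let ?p = "\<lambda>a b. map_poly (\<lambda>c. meval c (pt5 a b 0 0 0)) Fz"
  have L: "coeff (?p a b) (degree Fz) = meval LF (pt2 a b)" for a b
    by (simp add: coeff_map_poly) (rule meval_cong, use LF_vars in \<open>auto simp: pt5_def pt2_def\<close>)
  have "?p (s * a) (s * b) \<circ>\<^sub>p [:0, s:] = Polynomial.smult (s ^ n) (?p a b)"
    by (rule poly_eq_complexI) (simp add: poly_pcompose Fz_eval mult.commute[of _ s] homog_scale)
  from arg_cong[OF this, of "\<lambda>p. coeff p (degree Fz)"] show ?thesis
    unfolding coeff_pcompose_linear coeff_smult L by (simp add: mult.commute)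
qed

lemma eventually_LF_nonzero: "\<forall>\<^sub>F t in cofinite. meval LF (pt2 t 1) \<noteq> 0"
proof -
  have "F \<noteq> 0" using homog_at_infinity_nonzero by auto
  hence "Fz \<noteq> 0" using poly_mto_upoly_mVar[of 2 F] by auto
  hence "LF * mVar 1 \<noteq> 0" using mVar_nonzero by simp
  then obtain x where x: "meval (LF * mVar 1) x \<noteq> 0" using mpoly_eq_0I by blast
  have "meval LF x = meval LF (pt2 (x 0) (x 1))"
    by (rule meval_cong) (use LF_vars in \<open>auto simp: pt2_def\<close>)
  hence "x 1 \<noteq> 0" "meval LF (pt2 (x 0) (x 1)) \<noteq> 0" using x by (auto simp: meval.hom_mult)
  hence "meval LF (pt2 (x 0 / x 1) 1) \<noteq> 0"
    using LF_scale[of "1 / x 1" "x 0" "x 1"] by auto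
  hence "poly (curve2 [:0, 1:] 1 LF) (x 0 / x 1) \<noteq> 0" by simp
  hence "curve2 [:0, 1:] 1 LF \<noteq> 0" by (rule contrapos_nn) (simp only: poly_0)
  from eventually_poly_nonzero[OF this] show ?thesis by simp
qed

lemma eventually_no_root_0: "\<forall>\<^sub>F t in cofinite. meval F (pt3 t 1 0) \<noteq> 0"
proof -
  obtain a b where ab: "b \<noteq> 0" "meval F (pt3 a b 0) \<noteq> 0" using homog_at_infinity_nonzero by blast
  hence "meval F (pt3 (a / b) 1 0) \<noteq> 0" using homog_scale[of b "a / b" 1 0] by auto
  hence "poly (curve3 [:0, 1:] 1 0 F) (a / b) \<noteq> 0" by simp
  hence "curve3 [:0, 1:] 1 0 F \<noteq> 0" by (rule contrapos_nn) (simp only: poly_0)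
  from eventually_poly_nonzero[OF this] show ?thesis by simp
qed

lemma LF_pt5: "meval LF (pt5 a b z d k) = meval LF (pt2 a b)"
  by (rule meval_cong) (use LF_vars in \<open>auto simp: pt5_def pt2_def\<close>)

lemma res_FS_product:
  assumes "\<And>z. meval F (pt3 a b z) = meval LF (pt2 a b) * (\<Prod>\<alpha>\<leftarrow>as. z - \<alpha>)" "length as = degree Fz"
  shows "meval (res_FS f) (pt5 a b 0 d k)
    = meval LF (pt2 a b) ^ NS * (\<Prod>\<alpha>\<leftarrow>as. meval (S_poly f) (pt5 a b \<alpha> d k))"
proof -
  have "map_poly (\<lambda>c. meval c (pt5 a b 0 d k)) Fz
     = Polynomial.smult (meval LF (pt5 a b 0 d k)) (\<Prod>\<alpha>\<leftarrow>as. [:-\<alpha>, 1:])"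
    by (rule poly_eq_complexI) (simp add: Fz_eval assms(1) LF_pt5 poly_prod_list o_def)
  from hom_resultant_split[OF meval_comm_ring_hom this assms(2), of "mto_upoly 2 (S_poly f)"] show ?thesis
    unfolding res_FS_def mres_def LF_pt5 meval_mto_upoly pt5_upd .
qed

lemma homog_roots:
  assumes "meval LF (pt2 a b) \<noteq> 0"
  shows "\<exists>as. (\<forall>z. meval F (pt3 a b z) = meval LF (pt2 a b) * (\<Prod>\<alpha>\<leftarrow>as. z - \<alpha>)) \<and> length as = degree Fz"
proof -
  have "meval LF (pt5 a b 0 0 0) \<noteq> 0" using assms by (simp add: LF_pt5)
  from complex_hom_split[OF meval_comm_ring_hom this]
  obtain as where as: "map_poly (\<lambda>c. meval c (pt5 a b 0 0 0)) Fz
     = Polynomial.smult (meval LF (pt5 a b 0 0 0)) (\<Prod>\<alpha>\<leftarrow>as. [:-\<alpha>, 1:])" "length as = degree Fz" .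
  have "meval F (pt3 a b z) = meval LF (pt2 a b) * (\<Prod>\<alpha>\<leftarrow>as. z - \<alpha>)" for z
    using arg_cong[OF as(1), of "\<lambda>p. poly p z"]
    by (simp add: Fz_eval LF_pt5 poly_prod_list o_def)
  thus ?thesis using as(2) by blast
qed

text \<open>The roots in y3 scale with (a, b), each value of \<open>S_poly\<close> gains s^(2n), and
  the leading coefficient follows \<open>LF_scale\<close>; the power on the left again avoids a
  subtraction. The value at y3 = 0 is assumed nonzero so that no root is 0 and
  \<open>S_poly_dehomog\<close> applies.\<close>

lemma res_FS_scale:
  assumes L: "meval LF (pt2 a b) \<noteq> 0" and F0: "meval F (pt3 a b 0) \<noteq> 0" and s: "s \<noteq> 0"
  shows "s ^ (degree Fz * NS) * meval (res_FS f) (pt5 (s * a) (s * b) 0 d k)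
    = s ^ (n * NS + 2 * n * degree Fz) * meval (res_FS f) (pt5 a b 0 d k)"
proof -
  let ?m = "degree Fz" and ?L = "meval LF (pt2 a b)" and ?L' = "meval LF (pt2 (s * a) (s * b))"
  obtain as where as: "\<And>z. meval F (pt3 a b z) = ?L * (\<Prod>\<alpha>\<leftarrow>as. z - \<alpha>)" and len: "length as = ?m"
    using homog_roots[OF L] by blast
  have nz: "\<alpha> \<noteq> 0" if "\<alpha> \<in> set as" for \<alpha>
  proof
    assume "\<alpha> = 0"
    hence "(\<Prod>\<alpha>\<leftarrow>as. 0 - \<alpha>) = 0" using that by (force simp: prod_list_zero_iff)
    thus False using F0 as[of 0] by simp
  qed
  have LL: "?L' * s ^ ?m = s ^ n * ?L" by (rule LF_scale[OF s])
  have pl: "(\<Prod>\<alpha>\<leftarrow>xs. s * h \<alpha>) = s ^ length xs * (\<Prod>\<alpha>\<leftarrow>xs. h \<alpha>)" for h :: "complex \<Rightarrow> complex" and xs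
    by (induction xs) (simp_all add: mult_ac)
  have "meval F (pt3 (s * a) (s * b) z) = ?L' * (\<Prod>\<alpha>\<leftarrow>map ((*) s) as. z - \<alpha>)" for z
  proof -
    have "meval F (pt3 (s * a) (s * b) z) = s ^ n * meval F (pt3 a b (z / s))"
      using homog_scale[of s a b "z / s"] s by simp
    also have "\<dots> = s ^ n * ?L * (\<Prod>\<alpha>\<leftarrow>as. z / s - \<alpha>)" by (simp add: as)
    also have "\<dots> = ?L' * (s ^ ?m * (\<Prod>\<alpha>\<leftarrow>as. z / s - \<alpha>))" by (simp add: LL[symmetric])
    also have "s ^ ?m * (\<Prod>\<alpha>\<leftarrow>as. z / s - \<alpha>) = (\<Prod>\<alpha>\<leftarrow>as. s * (z / s - \<alpha>))" by (simp add: pl len)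
    also have "\<dots> = (\<Prod>\<alpha>\<leftarrow>map ((*) s) as. z - \<alpha>)" using s by (simp add: o_def right_diff_distrib)
    finally show ?thesis .
  qed
  from res_FS_product[OF this]
  have "meval (res_FS f) (pt5 (s * a) (s * b) 0 d k)
    = ?L' ^ NS * (\<Prod>\<alpha>\<leftarrow>as. meval (S_poly f) (pt5 (s * a) (s * b) (s * \<alpha>) d k))"
    by (simp add: len o_def)
  also have "(\<Prod>\<alpha>\<leftarrow>as. meval (S_poly f) (pt5 (s * a) (s * b) (s * \<alpha>) d k))
    = (\<Prod>\<alpha>\<leftarrow>as. s ^ (2 * n) * meval (S_poly f) (pt5 a b \<alpha> d k))"
  proof (rule arg_cong[where f = prod_list], rule map_cong[OF refl])
    fix \<alpha> assume "\<alpha> \<in> set as"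
    hence "\<alpha> \<noteq> 0" by (rule nz)
    thus "meval (S_poly f) (pt5 (s * a) (s * b) (s * \<alpha>) d k) = s ^ (2 * n) * meval (S_poly f) (pt5 a b \<alpha> d k)"
      using s by (simp add: S_poly_dehomog power_mult_distrib)
  qed
  also have "\<dots> = s ^ (2 * n * ?m) * (\<Prod>\<alpha>\<leftarrow>as. meval (S_poly f) (pt5 a b \<alpha> d k))"
  proof -
    have "(\<Prod>\<alpha>\<leftarrow>xs. w * h \<alpha>) = w ^ length xs * (\<Prod>\<alpha>\<leftarrow>xs. h \<alpha>)" for w and h :: "complex \<Rightarrow> complex" and xs
      by (induction xs) (simp_all add: mult_ac)
    thus ?thesis by (simp add: len power_mult)
  qed
  finally have A: "meval (res_FS f) (pt5 (s * a) (s * b) 0 d k)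
    = ?L' ^ NS * (s ^ (2 * n * ?m) * (\<Prod>\<alpha>\<leftarrow>as. meval (S_poly f) (pt5 a b \<alpha> d k)))" .
  have "s ^ (?m * NS) * meval (res_FS f) (pt5 (s * a) (s * b) 0 d k)
    = (?L' * s ^ ?m) ^ NS * (s ^ (2 * n * ?m) * (\<Prod>\<alpha>\<leftarrow>as. meval (S_poly f) (pt5 a b \<alpha> d k)))"
    unfolding A power_mult_distrib power_mult[of s ?m NS] by (simp only: mult_ac)
  also have "\<dots> = s ^ (n * NS + 2 * n * ?m) * (?L ^ NS * (\<Prod>\<alpha>\<leftarrow>as. meval (S_poly f) (pt5 a b \<alpha> d k)))"
    unfolding LL by (simp add: power_mult_distrib power_mult power_add mult_ac)
  also have "?L ^ NS * (\<Prod>\<alpha>\<leftarrow>as. meval (S_poly f) (pt5 a b \<alpha> d k)) = meval (res_FS f) (pt5 a b 0 d k)"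
    by (rule res_FS_product[OF as len, symmetric])
  finally show ?thesis .
qed

definition fiber :: "complex \<Rightarrow> (complex \<times> complex) set" where
  "fiber t = {(y1, y2). fv y1 y2 = 0 \<and> y2 \<noteq> 0 \<and> y1 = t * y2}"

text \<open>The first set marks loss of degree in y3, the second a root y3 = 0, and the last a line
  through the origin that does not cross the curve transversally. Where \<open>sg\<close> or
  \<open>f2\<close> vanishes, the quadratic \<open>sfun\<close> in k degenerates. Points with y2 = 0
  are sent to 0 by division by zero, which adds at most one slope.\<close>

definition bad_slopes :: "complex set" where
  "bad_slopes = {t. meval LF (pt2 t 1) = 0} \<union> {t. meval F (pt3 t 1 0) = 0} \<union>
     (\<lambda>(y1, y2). y1 / y2) ` ({(y1, y2). fv y1 y2 = 0 \<and> sg y1 y2 = 0} \<union> {(y1, y2). fv y1 y2 = 0 \<and> f2 y1 y2 = 0} \<union>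
       {(y1, y2). fv y1 y2 = 0 \<and> y1 * f1 y1 y2 + y2 * f2 y1 y2 = 0})"

lemma finite_bad_slopes: "finite bad_slopes"
  using eventually_LF_nonzero eventually_no_root_0 finite_sg_zeros finite_f2_zeros finite_euler_zeros
  unfolding bad_slopes_def by (simp add: eventually_cofinite)

lemma fiber_regular:
  assumes "t \<notin> bad_slopes" "(y1, y2) \<in> fiber t"
  shows "sg y1 y2 \<noteq> 0" "f2 y1 y2 \<noteq> 0" "y1 * f1 y1 y2 + y2 * f2 y1 y2 \<noteq> 0"
proof -
  have y: "fv y1 y2 = 0" "y1 / y2 = t" using assms(2) by (auto simp: fiber_def)
  have "t \<in> bad_slopes" if "sg y1 y2 = 0 \<or> f2 y1 y2 = 0 \<or> y1 * f1 y1 y2 + y2 * f2 y1 y2 = 0"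
    unfolding bad_slopes_def
    by (rule UnI2, rule image_eqI[of _ _ "(y1, y2)"]) (use y that in auto)
  thus "sg y1 y2 \<noteq> 0" "f2 y1 y2 \<noteq> 0" "y1 * f1 y1 y2 + y2 * f2 y1 y2 \<noteq> 0" using assms(1) by blast+
qed

lemma finite_fiber: "finite (fiber t)"
proof (rule finite_subset[OF _ finite_curve_inter_line[of t 1 0 0]])
  show "fiber t \<subseteq> {(y1, y2). fv y1 y2 = 0 \<and> (\<exists>s. y1 = 0 + s * t \<and> y2 = 0 + s * 1)}"
    by (auto simp: fiber_def)
qed simp

text \<open>Away from finitely many slopes, the roots in y3 are simple and correspond to the points of the fiber.\<close>

lemma res_FS_fiber:
  assumes t: "t \<notin> bad_slopes"
  shows "\<exists>C. C \<noteq> 0 \<and> (\<forall>d k. meval (res_FS f) (pt5 t 1 0 d k) = C * (\<Prod>y\<in>fiber t. sfun y d k))"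
proof -
  have L: "meval LF (pt2 t 1) \<noteq> 0" and F0: "meval F (pt3 t 1 0) \<noteq> 0"
    using t by (auto simp: bad_slopes_def)
  obtain as where as: "\<And>z. meval F (pt3 t 1 z) = meval LF (pt2 t 1) * (\<Prod>\<alpha>\<leftarrow>as. z - \<alpha>)"
    and len: "length as = degree Fz" using homog_roots[OF L] by blast
  define u where "u = curve3 [:t:] 1 [:0, 1:] F"
  have u: "poly u z = meval F (pt3 t 1 z)" for z by (simp add: u_def)
  have us: "u = Polynomial.smult (meval LF (pt2 t 1)) (\<Prod>\<alpha>\<leftarrow>as. [:-\<alpha>, 1:])"
    by (rule poly_eq_complexI) (simp add: u as poly_prod_list o_def)
  have roots: "set as = {z. poly u z = 0}" using L by (auto simp: u as prod_list_zero_iff)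
  have nz: "\<alpha> \<noteq> 0" if "\<alpha> \<in> set as" for \<alpha> using that F0 unfolding roots by (auto simp: u)
  have fib: "(t / \<alpha>, 1 / \<alpha>) \<in> fiber t" if "\<alpha> \<in> set as" for \<alpha>
  proof -
    have "poly u \<alpha> = 0" using that roots by auto
    hence "fv (t / \<alpha>) (1 / \<alpha>) = 0" using nz[OF that] by (simp add: u homog_dehomog)
    thus ?thesis using nz[OF that] by (simp add: fiber_def)
  qed
  have simple: "poly (pderiv u) \<alpha> \<noteq> 0" if "poly u \<alpha> = 0" for \<alpha>
  proof
    have \<alpha>: "\<alpha> \<in> set as" using that roots by auto
    assume "poly (pderiv u) \<alpha> = 0"
    hence "meval (mpderiv 2 F) (pt3 t 1 \<alpha>) = 0"
      unfolding u_def pderiv_curve3[OF homog_vars] by (simp add: pderiv_pCons)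
    \<comment> \<open>Euler's relation turns a vanishing derivative in y3 at a root into a vanishing
      Euler expression at the corresponding curve point.\<close>
    hence "t * meval (mpderiv 0 F) (pt3 t 1 \<alpha>) + meval (mpderiv 1 F) (pt3 t 1 \<alpha>) = 0"
      using homog_euler[of t 1 \<alpha>] that by (simp add: u)
    hence "t * (meval (mpderiv 0 F) (pt3 t 1 \<alpha>) * \<alpha>) + meval (mpderiv 1 F) (pt3 t 1 \<alpha>) * \<alpha> = 0"
      by (metis distrib_right mult.assoc mult_zero_left)
    hence "\<alpha> ^ n * (t * f1 (t / \<alpha>) (1 / \<alpha>) + f2 (t / \<alpha>) (1 / \<alpha>)) = 0"
      unfolding homog_partials[OF nz[OF \<alpha>]] by (simp add: distrib_left mult_ac)
    hence "(t / \<alpha>) * f1 (t / \<alpha>) (1 / \<alpha>) + (1 / \<alpha>) * f2 (t / \<alpha>) (1 / \<alpha>) = 0"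
      using nz[OF \<alpha>] by (simp flip: add_divide_distrib)
    thus False using fiber_regular(3)[OF t fib[OF \<alpha>]] by simp
  qed
  have "u \<noteq> 0" using F0 u[of 0] by auto
  have "degree u = length as"
  proof -
    have "degree (\<Prod>\<alpha>\<leftarrow>as. [:-\<alpha>, 1::complex:]) = length as" by (rule degree_linear_factors)
    thus ?thesis unfolding us using L by simp
  qed
  \<comment> \<open>There are as many distinct roots as the degree, so the list has no repetitions
    and its products become products over a set.\<close>
  hence "card (set as) = length as"
    using card_roots_complex[OF \<open>u \<noteq> 0\<close> simple] by (simp add: roots)
  hence dist: "distinct as" by (rule card_distinct)
  \<comment> \<open>Collects the leading coefficient and the powers of y3 split off by
    dehomogenizing \<open>S_poly\<close>; it depends on the slope only.\<close>
  define C where "C = meval LF (pt2 t 1) ^ NS * (\<Prod>\<alpha>\<in>set as. \<alpha> ^ (2 * n))"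
  have "C \<noteq> 0" using L nz by (simp add: C_def)
  have bij: "bij_betw (\<lambda>\<alpha>. (t / \<alpha>, 1 / \<alpha>)) (set as) (fiber t)"
  proof (rule bij_betw_byWitness[where f' = "\<lambda>y. 1 / snd y"])
    show "(\<lambda>\<alpha>. (t / \<alpha>, 1 / \<alpha>)) ` set as \<subseteq> fiber t" using fib by auto
    show "(\<lambda>y. 1 / snd y) ` fiber t \<subseteq> set as"
    proof
      fix \<alpha> assume "\<alpha> \<in> (\<lambda>y. 1 / snd y) ` fiber t"
      then obtain y1 y2 where y: "fv y1 y2 = 0" "y2 \<noteq> 0" "y1 = t * y2" "\<alpha> = 1 / y2"
        by (auto simp: fiber_def)
      hence "poly u \<alpha> = 0" by (simp add: u homog_dehomog)
      thus "\<alpha> \<in> set as" by (simp add: roots)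
    qed
  qed (auto simp: fiber_def)
  have "meval (res_FS f) (pt5 t 1 0 d k) = C * (\<Prod>y\<in>fiber t. sfun y d k)" for d k
  proof -
    have "meval (res_FS f) (pt5 t 1 0 d k)
      = meval LF (pt2 t 1) ^ NS * (\<Prod>\<alpha>\<in>set as. meval (S_poly f) (pt5 t 1 \<alpha> d k))"
      using res_FS_product[OF as len] by (simp add: prod.distinct_set_conv_list[OF dist])
    also have "(\<Prod>\<alpha>\<in>set as. meval (S_poly f) (pt5 t 1 \<alpha> d k))
      = (\<Prod>\<alpha>\<in>set as. \<alpha> ^ (2 * n) * sfun (t / \<alpha>, 1 / \<alpha>) d k)"
      by (rule prod.cong[OF refl]) (rule S_poly_dehomog[OF nz])
    also have "\<dots> = (\<Prod>\<alpha>\<in>set as. \<alpha> ^ (2 * n)) * (\<Prod>y\<in>fiber t. sfun y d k)"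
      unfolding prod.distrib using prod.reindex_bij_betw[OF bij, of "\<lambda>y. sfun y d k"] by simp
    finally show ?thesis by (simp add: C_def)
  qed
  thus ?thesis using \<open>C \<noteq> 0\<close> by blast
qed

end

section \<open>Homogeneity of the resultant and of its factors\<close>

lemma mpoly_poly_eq_0I:
  assumes "\<And>a s. poly (map_poly (\<lambda>c. meval c a) D) s = 0"
  shows "D = 0"
proof (rule poly_eqI)
  fix j
  have "coeff D j = 0"
  proof (rule mpoly_eq_0I)
    fix a
    have "map_poly (\<lambda>c. meval c a) D = 0" using assms[of a] by (intro poly_eq_complexI) simp
    hence "coeff (map_poly (\<lambda>c. meval c a) D) j = 0" by simp
    thus "meval (coeff D j) a = 0" by (simp add: coeff_map_poly)
  qed
  thus "coeff D j = coeff 0 j" by simp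
qed

text \<open>Order at 0 and degree are additive, the order never exceeds the degree, and they agree
  for a monomial. Hence they agree for each factor.\<close>

lemma factor_of_monom:
  fixes A B :: "'a::idom poly"
  assumes "A * B = monom r M" "r \<noteq> 0"
  shows "\<exists>b j. B = monom b j"
proof -
  have nz: "A * B \<noteq> 0" using assms by simp
  hence AB: "A \<noteq> 0" "B \<noteq> 0" by auto
  have "order 0 (monom r M) = order 0 ([:0, 1:] ^ M :: 'a poly)"
    unfolding monom_altdef by (rule order_smult[OF assms(2)])
  also have "\<dots> = M" using order_power_n_n[of "0::'a" M] by (simp only: minus_zero)
  finally have "order 0 (monom r M) = M" .
  hence "order 0 A + order 0 B = M" using assms(1) order_mult[OF nz, of 0] by simp
  moreover have "degree A + degree B = M"
    using degree_mult_eq[OF AB] assms by (simp add: degree_monom_eq)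
  ultimately have ord: "order 0 B = degree B"
    using order_degree[OF AB(1), of 0] order_degree[OF AB(2), of 0] by simp
  have "[:- 0, 1:] ^ order 0 B dvd B" by (rule order_1)
  then obtain q where q: "B = [:0, 1:] ^ degree B * q" unfolding ord minus_zero by (elim dvdE)
  have "q \<noteq> 0" using q AB(2) by auto
  have "degree B = degree ([:0, 1::'a:] ^ degree B * q)" by (rule arg_cong[OF q])
  also have "\<dots> = degree ([:0, 1::'a:] ^ degree B) + degree q"
    using \<open>q \<noteq> 0\<close> by (intro degree_mult_eq) simp_all
  also have "degree ([:0, 1::'a:] ^ degree B) = degree B"
    by (simp add: degree_power_eq)
  finally have "degree q = 0" by simp
  then obtain b where "q = [:b:]" by (rule degree_eq_zeroE)
  moreover have "[:0, 1:] ^ degree B * [:b:] = monom b (degree B)" by (simp add: monom_altdef)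
  ultimately have "B = monom b (degree B)" using q by metis
  thus ?thesis by blast
qed

lemma scale_poly_eq_0_iff: "scale_poly V p = 0 \<longleftrightarrow> p = 0"
proof
  assume 0: "scale_poly V p = 0"
  have "(\<lambda>i. if i \<in> V then 1 * a i else a i) = a" for a :: "nat \<Rightarrow> complex" by auto
  hence "meval p a = 0" for a using scale_poly_eval[of a V p 1] unfolding 0 by (simp only: map_poly_0 poly_0)
  thus "p = 0" by (rule mpoly_eq_0I)
qed simp

lemma order_prod:
  fixes h :: "'b \<Rightarrow> 'a::idom poly"
  assumes "finite A" "\<And>y. y \<in> A \<Longrightarrow> h y \<noteq> 0"
  shows "order x (\<Prod>y\<in>A. h y) = (\<Sum>y\<in>A. order x (h y))"
  using assms
proof (induction A rule: finite_induct)
  case (insert y A)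
  have "h y * prod h A \<noteq> 0" using insert by (simp add: prod_zero_iff)
  thus ?case using insert by (simp add: order_mult)
qed (simp add: order_0I)

lemma poly_eqI_nonzero:
  fixes p q :: "complex poly"
  assumes "\<And>s. s \<noteq> 0 \<Longrightarrow> poly p s = poly q s"
  shows "p = q"
proof -
  have "[:0, 1:] * (p - q) = 0"
    by (rule poly_eq_complexI) (use assms in auto)
  thus ?thesis by simp
qed

text \<open>Here \<open>u\<close> and \<open>v\<close> are the two charts of one binary form of
  degree \<open>D\<close>, and a nonzero value of \<open>v\<close> at 0 says that no root lies at
  infinity. Both \<open>v\<close> and \<open>reflect_poly u\<close> are nonzero at 0, so comparing
  orders there gives the degree.\<close>

lemma degree_by_reversal:
  fixes u v :: "complex poly"
  assumes uv: "\<And>s. s \<noteq> 0 \<Longrightarrow> poly v s = s ^ D * poly u (1 / s)" and v0: "poly v 0 \<noteq> 0"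
  shows "u \<noteq> 0" "degree u = D"
proof -
  show "u \<noteq> 0"
  proof
    assume "u = 0"
    hence "v = 0" by (intro poly_eqI_nonzero) (simp add: uv)
    thus False using v0 by simp
  qed
  have "monom 1 (degree u) * v = monom 1 D * reflect_poly u"
    by (rule poly_eqI_nonzero) (simp add: uv poly_monom poly_reflect_poly_nz divide_inverse)
  moreover have "order 0 (monom 1 e * w) = e" if "poly w 0 \<noteq> 0" for e and w :: "complex poly"
  proof -
    have "w \<noteq> 0" using that by auto
    have "order 0 ([:- 0, 1:] ^ e :: complex poly) = e" by (rule order_power_n_n)
    thus ?thesis using \<open>w \<noteq> 0\<close> that by (simp add: order_mult monom_altdef order_0I)
  qed
  ultimately show "degree u = D"
    using v0 \<open>u \<noteq> 0\<close> by (metis coeff_0_reflect_poly leading_coeff_0_iff poly_0_coeff_0)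
qed

text \<open>The factor theorem for replacing \<open>mVar i\<close> by \<open>r\<close>: sums and
  products preserve the divisibility of the difference.\<close>

lemma dvd_diff_substitution:
  "(mVar i - r) dvd (p - mev mConst (mVar(i := r)) p)"
proof -
  interpret mev_hom mConst "mVar(i := r)" unfolding mev_hom_def by (rule mConst_hom)
  show ?thesis
  proof (induction p rule: mpoly_induct)
    case (add p q)
    have "p + q - mev mConst (mVar(i := r)) (p + q)
      = (p - mev mConst (mVar(i := r)) p) + (q - mev mConst (mVar(i := r)) q)" by (simp add: mev_add)
    thus ?case using add by (metis dvd_add)
  next
    case (mult p q)
    have "p * q - mev mConst (mVar(i := r)) (p * q)
      = p * (q - mev mConst (mVar(i := r)) q) + mev mConst (mVar(i := r)) q * (p - mev mConst (mVar(i := r)) p)"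
      by (simp add: mev_mult algebra_simps)
    thus ?case using mult by (metis dvd_add dvd_mult)
  next
    case (const c)
    show ?case by (simp only: mev_mConst) simp
  next
    case (var j)
    show ?case by (simp only: mev_mVar) simp
  qed
qed

lemma generic_ball:
  assumes "finite A" "\<And>x. x \<in> A \<Longrightarrow> generic (P x)"
  shows "generic (\<lambda>d k. \<forall>x\<in>A. P x d k)"
  using assms
proof (induction A rule: finite_induct)
  case empty
  show ?case by (simp add: generic_def)
next
  case (insert x A)
  have "generic (\<lambda>d k. P x d k \<and> (\<forall>x\<in>A. P x d k))"
    by (rule generic_conj) (use insert in auto)
  thus ?case by simp
qed

lemma eventually_meval_d_nonzero:
  assumes "meval P (pt5 a b 0 d0 k) \<noteq> 0"
  shows "\<forall>\<^sub>F d in cofinite. meval P (pt5 a b 0 d k) \<noteq> 0"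
proof -
  define r where "r = (\<lambda>i::nat. if i = 0 then [:a:] else if i = 1 then [:b:] else if i = 3 then [:0, 1:]
    else if i = 4 then [:k:] else 0)"
  have "(\<lambda>i. poly (r i) d) = pt5 a b 0 d k" for d by (rule ext) (simp add: r_def pt5_def)
  thus ?thesis using eventually_meval_line_nonzero[of P r d0] assms by simp
qed

lemma generic_meval_nonzero:
  assumes "meval P (pt5 a b 0 d0 k0) \<noteq> 0"
  shows "generic (\<lambda>d k. meval P (pt5 a b 0 d k) \<noteq> 0)"
  unfolding generic_def
proof (rule eventually_mono[OF eventually_meval_d_nonzero[OF assms]])
  fix d assume *: "meval P (pt5 a b 0 d k0) \<noteq> 0"
  define r where "r = (\<lambda>i::nat. if i = 0 then [:a:] else if i = 1 then [:b:] else if i = 3 then [:d:]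
    else if i = 4 then [:0, 1:] else 0)"
  have "(\<lambda>i. poly (r i) k) = pt5 a b 0 d k" for k by (rule ext) (simp add: r_def pt5_def)
  thus "\<forall>\<^sub>F k in cofinite. meval P (pt5 a b 0 d k) \<noteq> 0"
    using eventually_meval_line_nonzero[of P r k0] * by simp
qed

lemma homogeneous_eval:
  assumes "scale_poly {0, 1} P = monom P D"
  shows "meval P (pt5 (s * a) (s * b) z d k) = s ^ D * meval P (pt5 a b z d k)"
proof -
  have "(\<lambda>i. if i \<in> {0, 1} then s * pt5 a b z d k i else pt5 a b z d k i) = pt5 (s * a) (s * b) z d k"
    by (rule ext) (simp add: pt5_def)
  hence "meval P (pt5 (s * a) (s * b) z d k) = poly (map_poly (\<lambda>c. meval c (pt5 a b z d k)) (monom P D)) s"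
    using scale_poly_eval[of "pt5 a b z d k" "{0, 1}" P s] by (simp only: assms)
  thus ?thesis by (simp add: map_poly_monom poly_monom mult.commute)
qed

context plane_curve
begin

lemma res_FS_pt5: "meval (res_FS f) x = meval (res_FS f) (pt5 (x 0) (x 1) 0 (x 3) (x 4))"
  by (rule meval_cong) (use res_FS_vars in \<open>auto simp: pt5_def\<close>)

text \<open>The pointwise law \<open>res_FS_scale\<close> needs a nonzero s, leading coefficient and
  value at y3 = 0. Multiplying by these factors gives an identity valid everywhere, and they cancel
  over an integral domain.\<close>

lemma scale_res_FS:
  "monom 1 (degree Fz * NS) * scale_poly {0, 1} (res_FS f)
    = monom (res_FS f) (n * NS + 2 * n * degree Fz)"
proof -
  let ?e = "degree Fz * NS" and ?M = "n * NS + 2 * n * degree Fz" and ?R = "res_FS f"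
  define F0 where "F0 = mev mConst (mVar(2 := 0)) F"
  have F0: "meval F0 x = meval F (pt3 (x 0) (x 1) 0)" for x
    unfolding F0_def meval_mev_mConst by (rule meval_cong) (use homog_vars in \<open>auto simp: pt3_def\<close>)
  define W where "W = LF * F0"
  have W: "meval W x = meval LF (pt2 (x 0) (x 1)) * meval F (pt3 (x 0) (x 1) 0)" for x
  proof -
    have "meval LF x = meval LF (pt2 (x 0) (x 1))"
      by (rule meval_cong) (use LF_vars in \<open>auto simp: pt2_def\<close>)
    thus ?thesis by (simp add: W_def F0 meval.hom_mult)
  qed
  have "W \<noteq> 0"
  proof -
    obtain t where "t \<notin> bad_slopes" using finite_bad_slopes infinite_UNIV_char_0 ex_new_if_finite by blast
    hence "meval W (pt2 t 1) \<noteq> 0" by (simp add: W bad_slopes_def pt2_def)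
    thus ?thesis by auto
  qed
  define D where "D = monom 1 ?e * scale_poly {0, 1} ?R - monom ?R ?M"
  have "[:W:] * ([:0, 1:] * D) = 0"
  proof (rule mpoly_poly_eq_0I)
    fix a s
    interpret E: comm_ring_hom "\<lambda>D. poly (map_poly (\<lambda>c. meval c a) D) s"
      by (rule map_poly_eval_hom[OF meval_comm_ring_hom])
    let ?E = "\<lambda>D. poly (map_poly (\<lambda>c. meval c a) D) s"
    have mon: "?E (monom r j) = meval r a * s ^ j" for r j
      by (simp add: map_poly_monom poly_monom)
    have sc: "?E (scale_poly {0, 1} ?R) = meval ?R (pt5 (s * a 0) (s * a 1) 0 (a 3) (a 4))"
      unfolding scale_poly_eval by (subst res_FS_pt5) simp
    have lin: "?E [:0, 1:] = s" "?E [:W:] = meval W a"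
      by (simp_all add: Polynomial.map_poly_pCons)
    have D: "?E D = s ^ ?e * meval ?R (pt5 (s * a 0) (s * a 1) 0 (a 3) (a 4))
        - s ^ ?M * meval ?R (pt5 (a 0) (a 1) 0 (a 3) (a 4))"
      unfolding D_def E.hom_minus E.hom_mult mon sc using res_FS_pt5[of a] by simp
    show "?E ([:W:] * ([:0, 1:] * D)) = 0"
    proof (cases "meval W a = 0 \<or> s = 0")
      case True
      thus ?thesis unfolding E.hom_mult lin by auto
    next
      case False
      hence "?E D = 0" unfolding D using res_FS_scale[of "a 0" "a 1" s "a 3" "a 4"] by (simp add: W)
      thus ?thesis unfolding E.hom_mult by simp
    qed
  qed
  hence "[:W:] = 0 \<or> [:0, 1::mpoly:] = 0 \<or> D = 0" by (simp only: mult_eq_0_iff)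
  moreover have "[:W:] \<noteq> 0" using \<open>W \<noteq> 0\<close> by simp
  moreover have "[:0, 1::mpoly:] \<noteq> 0" by simp
  ultimately have "D = 0" by (elim disjE) simp_all
  thus ?thesis by (simp add: D_def)
qed

definition sfun_poly :: "complex \<times> complex \<Rightarrow> complex \<Rightarrow> complex poly" where
  "sfun_poly y d = Polynomial.smult (sg (fst y) (snd y)) ([:snd y, -1:] * [:snd y, -1:])
     - [:(f2 (fst y) (snd y))\<^sup>2 * d\<^sup>2:]"

lemma poly_sfun_poly [simp]: "poly (sfun_poly y d) k = sfun y d k"
  unfolding sfun_poly_def sfun_def power2_eq_square[of "snd y - k"]
  by (simp del: mult_pCons_left mult_pCons_right)

lemma sfun_poly_nonzero:
  assumes "sg (fst y) (snd y) \<noteq> 0"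
  shows "sfun_poly y d \<noteq> 0"
proof
  assume 0: "sfun_poly y d = 0"
  have "sfun y d k = 0" for k using poly_sfun_poly[of y d k] unfolding 0 by simp
  from this[of "snd y"] this[of "snd y + 1"] show False using assms by (simp add: sfun_def)
qed

text \<open>As a polynomial in k this is a quadratic centered at y2. A double root could only be k =
  y2, where the value is minus the square of f2 d.\<close>

lemma order_sfun_poly:
  assumes "sg (fst y) (snd y) \<noteq> 0" "f2 (fst y) (snd y) \<noteq> 0" "d \<noteq> 0"
  shows "order k (sfun_poly y d) = (if sfun y d k = 0 then 1 else 0)"
proof (cases "sfun y d k = 0")
  case True
  have ne: "snd y - k \<noteq> 0" using True assms by (auto simp: sfun_def)
  have eq: "poly (pderiv (sfun_poly y d)) k = - (2 * sg (fst y) (snd y) * (snd y - k))"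
    unfolding sfun_poly_def pderiv_diff pderiv_smult pderiv_mult
    by (simp add: pderiv_pCons algebra_simps)
  have "- (2 * sg (fst y) (snd y) * (snd y - k)) \<noteq> 0"
    using ne assms(1) by (simp only: neg_equal_0_iff_equal mult_eq_0_iff) simp
  hence "poly (pderiv (sfun_poly y d)) k \<noteq> 0" unfolding eq .
  thus ?thesis using True order_eq_1I[of "sfun_poly y d" k] by simp
next
  case False
  thus ?thesis by (simp add: order_0I)
qed

lemma prod_sfun_poly_nonzero:
  assumes "t \<notin> bad_slopes"
  shows "(\<Prod>y\<in>fiber t. sfun_poly y d) \<noteq> 0"
proof -
  have "sfun_poly y d \<noteq> 0" if "y \<in> fiber t" for y
    using fiber_regular(1)[OF assms, of "fst y" "snd y"] that by (intro sfun_poly_nonzero) simp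
  thus ?thesis using finite_fiber by (simp add: prod_zero_iff)
qed

lemma res_FS_nonzero: "res_FS f \<noteq> 0"
proof
  assume 0: "res_FS f = 0"
  obtain t where t: "t \<notin> bad_slopes" using finite_bad_slopes infinite_UNIV_char_0 ex_new_if_finite by blast
  obtain C where C: "C \<noteq> 0" "\<And>d k. meval (res_FS f) (pt5 t 1 0 d k) = C * (\<Prod>y\<in>fiber t. sfun y d k)"
    using res_FS_fiber[OF t] by blast
  have "(\<Prod>y\<in>fiber t. sfun_poly y 1) = 0"
    by (rule poly_eq_complexI) (use C in \<open>simp add: poly_prod 0\<close>)
  thus False using prod_sfun_poly_nonzero[OF t] by blast
qed

text \<open>Up to a power of the scaling variable the resultant is sent to a monomial, so each
  factor is sent to a monomial as well. Setting that variable to 1 identifies the coefficient as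
  \<open>B\<close>.\<close>

lemma res_FS_factor_homogeneous:
  assumes "res_FS f = A * B"
  shows "scale_poly {0, 1} B = monom B (mdegV {0, 1} B)"
proof -
  have "B \<noteq> 0" using assms res_FS_nonzero by auto
  have "(monom 1 (degree Fz * NS) * scale_poly {0, 1} A) * scale_poly {0, 1} B
    = monom (res_FS f) (n * NS + 2 * n * degree Fz)"
    using scale_res_FS unfolding assms scale_poly.hom_mult by (simp only: mult.assoc)
  from factor_of_monom[OF this res_FS_nonzero] obtain b j where b: "scale_poly {0, 1} B = monom b j" by blast
  have "b = B"
  proof (rule mpoly_eqI)
    fix a :: "nat \<Rightarrow> complex"
    have "(\<lambda>i. if i \<in> {0, 1} then 1 * a i else a i) = a" by (rule ext) simp
    hence "meval B a = poly (map_poly (\<lambda>c. meval c a) (monom b j)) 1"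
      using scale_poly_eval[of a "{0, 1}" B 1] by (simp only: b)
    thus "meval b a = meval B a" by (simp add: map_poly_monom poly_monom)
  qed
  moreover have "mdegV {0, 1} B = j"
    using degree_scale_poly[of "{0, 1}" B] \<open>B \<noteq> 0\<close> by (simp add: b \<open>b = B\<close> degree_monom_eq)
  ultimately show ?thesis using b by simp
qed

text \<open>Split off a divisor in y1, y2 of largest degree. Degrees are additive and bounded by
  that of the resultant, so there is one, and a further nonconstant divisor of the cofactor would
  enlarge it.\<close>

lemma primitive_part_exists: "\<exists>P. is_PP_dk (res_FS f) P"
proof -
  let ?ok = "\<lambda>c. mvars c \<subseteq> {0, 1} \<and> c \<noteq> 0 \<and> c dvd res_FS f"
  have deg: "mdegV {0, 1} (a * b) = mdegV {0, 1} a + mdegV {0, 1} b" if "a \<noteq> 0" "b \<noteq> 0" for a b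
    using that degree_mult_eq[of "scale_poly {0, 1} a" "scale_poly {0, 1} b"]
    by (simp add: scale_poly_eq_0_iff scale_poly.hom_mult flip: degree_scale_poly)
  have bound: "\<forall>c. ?ok c \<longrightarrow> mdegV {0, 1} c < Suc (mdegV {0, 1} (res_FS f))"
  proof (intro allI impI)
    fix c assume c: "?ok c"
    then obtain b where b: "res_FS f = c * b" by (elim conjE dvdE)
    hence "b \<noteq> 0" using res_FS_nonzero by auto
    thus "mdegV {0, 1} c < Suc (mdegV {0, 1} (res_FS f))" using c by (simp add: b deg)
  qed
  have "?ok 1" by simp
  from ex_has_greatest_nat[of ?ok, OF this bound]
  obtain c where c: "?ok c" and max: "\<And>c'. ?ok c' \<Longrightarrow> mdegV {0, 1} c' \<le> mdegV {0, 1} c" by blast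
  then obtain P where P: "res_FS f = c * P" by (elim conjE dvdE)
  have "mtdeg q = 0" if q: "q dvd P" "mvars q \<subseteq> {0, 1}" for q
  proof -
    obtain r where r: "P = q * r" using q(1) by (elim dvdE)
    have "q \<noteq> 0" using P r res_FS_nonzero by auto
    have "mvars (c * q) \<subseteq> {0, 1}" using c q(2) by (intro order.trans[OF mvars_mult] Un_least) auto
    moreover have "c * q dvd res_FS f" unfolding P r by (simp only: mult.assoc[symmetric] dvd_triv_left)
    ultimately have "mdegV {0, 1} (c * q) \<le> mdegV {0, 1} c" using max c \<open>q \<noteq> 0\<close> by simp
    hence "mdegV {0, 1} q = 0" using c \<open>q \<noteq> 0\<close> by (simp add: deg)
    thus ?thesis using mtdeg_eq_mdegV[of "{0, 1}" q] q(2) by simp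
  qed
  thus ?thesis unfolding is_PP_dk_def using c P by blast
qed

end

section \<open>The degree of the primitive part\<close>

locale primitive_part = plane_curve +
  fixes c P :: mpoly
  assumes c_vars: "mvars c \<subseteq> {0, 1}" and c_nonzero: "c \<noteq> 0" and res_eq: "res_FS f = c * P"
    and primitive: "\<And>q. q dvd P \<Longrightarrow> mvars q \<subseteq> {0, 1} \<Longrightarrow> mtdeg q = 0"
begin

abbreviation (input) D where "D \<equiv> mdegV {0, 1} P"

lemma P_homogeneous: "scale_poly {0, 1} P = monom P D"
  by (rule res_FS_factor_homogeneous[OF res_eq])

text \<open>Setting all other variables to 0 fixes the resultant and \<open>c\<close>; cancelling
  \<open>c\<close> shows that it fixes \<open>P\<close>.\<close>

lemma P_vars: "mvars P \<subseteq> {0, 1, 3, 4}"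
proof -
  define \<theta> where "\<theta> = mev mConst (\<lambda>i. if i \<in> {0, 1, 3, 4} then mVar i else 0)"
  interpret \<theta>: comm_ring_hom \<theta> unfolding \<theta>_def
    by (rule mev_hom.mev_comm_ring_hom) (simp add: mev_hom_def mConst_hom)
  have fixed: "\<theta> p = p" if "mvars p \<subseteq> {0, 1, 3, 4}" for p
  proof -
    have "\<theta> p = mev mConst mVar p" unfolding \<theta>_def by (rule mev_cong) (use that in auto)
    thus ?thesis by (simp add: mev_mConst_mVar)
  qed
  have tc: "\<theta> c = c" by (rule fixed) (use c_vars in blast)
  have "c * \<theta> P = c * P"
    using fixed[OF res_FS_vars] unfolding res_eq \<theta>.hom_mult tc .
  hence "\<theta> P = P" using c_nonzero by simp
  moreover have "mvars (\<theta> P) \<subseteq> {0, 1, 3, 4}" unfolding \<theta>_def by (rule mvars_mev) simp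
  ultimately show ?thesis by simp
qed

lemma P_pt5: "meval P x = meval P (pt5 (x 0) (x 1) 0 (x 3) (x 4))"
  by (rule meval_cong) (use P_vars in \<open>auto simp: pt5_def\<close>)

lemma nonconstant_linear_form:
  assumes "scale_poly {0, 1} l = [:0, l:]" "l \<noteq> 0" "mvars l \<subseteq> {0, 1}"
  shows "\<not> l dvd P"
proof
  assume "l dvd P"
  hence "mtdeg l = 0" using primitive assms(3) by blast
  moreover have "mtdeg l = mdegV {0, 1} l" by (rule mtdeg_eq_mdegV) (use assms(3) in auto)
  moreover have "mdegV {0, 1} l = 1"
    using degree_scale_poly[of "{0, 1}" l] assms(1,2) by (simp add: degree_pCons_eq One_nat_def)
  ultimately show False by simp
qed

text \<open>If \<open>P\<close> vanished at slope t for all d and k, homogeneity would make it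
  vanish on y1 = t y2, and the linear form would divide it by the factor theorem, against
  primitivity.\<close>

lemma P_nonzero_at_slope: "\<exists>d k. meval P (pt5 t 1 0 d k) \<noteq> 0"
proof (rule ccontr)
  assume "\<not> ?thesis"
  hence 0: "meval P (pt5 t 1 0 d k) = 0" for d k by blast
  define l where "l = mVar 0 - mConst t * mVar 1"
  have "mev mConst (mVar(0 := mConst t * mVar 1)) P * mVar 1 = 0"
  proof (rule mpoly_eq_0I)
    fix x
    have "meval (mev mConst (mVar(0 := mConst t * mVar 1)) P) x = meval P (pt5 (x 1 * t) (x 1 * 1) 0 (x 3) (x 4))"
      unfolding meval_mev_mConst by (subst P_pt5) (simp add: meval.hom_mult mult.commute)
    thus "meval (mev mConst (mVar(0 := mConst t * mVar 1)) P * mVar 1) x = 0"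
      unfolding homogeneous_eval[OF P_homogeneous] by (simp add: meval.hom_mult 0)
  qed
  hence "mev mConst (mVar(0 := mConst t * mVar 1)) P = 0" using mVar_nonzero[of 1] by simp
  hence "l dvd P" using dvd_diff_substitution[of 0 "mConst t * mVar 1" P] by (simp add: l_def)
  moreover have "\<not> l dvd P"
  proof (rule nonconstant_linear_form)
    show "scale_poly {0, 1} l = [:0, l:]"
      by (simp add: l_def scale_poly.hom_minus scale_poly.hom_mult)
    have "meval l (pt2 1 0) = 1" by (simp add: l_def meval.hom_minus meval.hom_mult pt2_def)
    thus "l \<noteq> 0" by auto
    show "mvars l \<subseteq> {0, 1}" unfolding l_def
      by (intro order.trans[OF mvars_diff] Un_least order.trans[OF mvars_mult]) simp_all
  qed
  ultimately show False by blast
qed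

text \<open>The same argument in the direction y2 = 0, which no slope represents. It will keep the
  degree in the slope from dropping.\<close>

lemma P_nonzero_at_infinity: "\<exists>d k. meval P (pt5 1 0 0 d k) \<noteq> 0"
proof (rule ccontr)
  assume "\<not> ?thesis"
  hence 0: "meval P (pt5 1 0 0 d k) = 0" for d k by blast
  have "mev mConst (mVar(1 := 0)) P * mVar 0 = 0"
  proof (rule mpoly_eq_0I)
    fix x
    have "meval (mev mConst (mVar(1 := 0)) P) x = meval P (pt5 (x 0 * 1) (x 0 * 0) 0 (x 3) (x 4))"
      unfolding meval_mev_mConst by (subst P_pt5) simp
    thus "meval (mev mConst (mVar(1 := 0)) P * mVar 0) x = 0"
      unfolding homogeneous_eval[OF P_homogeneous] by (simp add: meval.hom_mult 0)
  qed
  hence "mev mConst (mVar(1 := 0)) P = 0" using mVar_nonzero[of 0] by simp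
  hence "mVar 1 dvd P" using dvd_diff_substitution[of 1 0 P] by simp
  moreover have "\<not> mVar 1 dvd P"
    by (rule nonconstant_linear_form) (simp_all add: mVar_nonzero)
  ultimately show False by blast
qed

text \<open>Where \<open>c\<close> vanishes, the value of the resultant says nothing about
  \<open>P\<close>.\<close>

definition exc_slopes :: "complex set" where
  "exc_slopes = bad_slopes \<union> {t. meval c (pt2 t 1) = 0}"

lemma finite_exc_slopes: "finite exc_slopes"
proof -
  have hom: "scale_poly {0, 1} c = monom c (mdegV {0, 1} c)"
    by (rule res_FS_factor_homogeneous[of P]) (simp add: res_eq mult.commute)
  have pt: "meval c (pt5 a b z d k) = meval c (pt2 a b)" for a b z d k
    by (rule meval_cong) (use c_vars in \<open>auto simp: pt5_def pt2_def\<close>)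
  have "c * mVar 1 \<noteq> 0" using c_nonzero mVar_nonzero by simp
  then obtain x where x: "meval (c * mVar 1) x \<noteq> 0" using mpoly_eq_0I by blast
  have "meval c x = meval c (pt2 (x 0) (x 1))"
    by (rule meval_cong) (use c_vars in \<open>auto simp: pt2_def\<close>)
  hence x1: "x 1 \<noteq> 0" "meval c (pt2 (x 0) (x 1)) \<noteq> 0" using x by (auto simp: meval.hom_mult)
  hence "meval c (pt2 (x 0 / x 1) 1) \<noteq> 0"
    using homogeneous_eval[OF hom, of "x 1" "x 0 / x 1" 1 0 0 0] by (auto simp: pt)
  hence "poly (curve2 [:0, 1:] 1 c) (x 0 / x 1) \<noteq> 0" by simp
  hence "curve2 [:0, 1:] 1 c \<noteq> 0" by (rule contrapos_nn) (simp only: poly_0)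
  from poly_roots_finite[OF this] show ?thesis
    using finite_bad_slopes by (simp add: exc_slopes_def)
qed

text \<open>With y2 = 1 and d a number, the slope is the outer and k the inner variable, the shape
  that \<open>eventually_order_swap\<close> treats.\<close>

definition Pdk :: "complex \<Rightarrow> complex poly poly" where
  "Pdk d = mev (\<lambda>c. [:[:c:]:]) (\<lambda>i. if i = 0 then [:0, 1:] else if i = 1 then 1
     else if i = 3 then [:[:d:]:] else if i = 4 then [:[:0, 1:]:] else 0) P"

lemma eval2_Pdk: "eval2 (Pdk d) t k = meval P (pt5 t 1 0 d k)"
  unfolding Pdk_def comm_ring_hom_mev_eq[OF eval2_hom const2_hom]
  by (simp add: meval_mev eval2_def) (rule mev_cong, simp add: pt5_def)

text \<open>The nonzero value of \<open>c\<close> cancels, so at this slope \<open>P\<close> is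
  proportional to the product of the quadratics in k over the fiber. For nonzero d each of them
  contributes a simple root or none.\<close>

lemma order_Pdk_slice:
  assumes t: "t \<notin> exc_slopes"
  shows "poly (Pdk d) [:t:] \<noteq> 0"
    and "d \<noteq> 0 \<Longrightarrow> order k (poly (Pdk d) [:t:]) = card {y \<in> fiber t. sfun y d k = 0}"
proof -
  have tb: "t \<notin> bad_slopes" and ct: "meval c (pt2 t 1) \<noteq> 0" using t by (auto simp: exc_slopes_def)
  obtain C where C: "C \<noteq> 0" "\<And>d k. meval (res_FS f) (pt5 t 1 0 d k) = C * (\<Prod>y\<in>fiber t. sfun y d k)"
    using res_FS_fiber[OF tb] by blast
  have cpt: "meval c (pt5 t 1 0 d k) = meval c (pt2 t 1)" for d k
    by (rule meval_cong) (use c_vars in \<open>auto simp: pt5_def pt2_def\<close>)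
  have eq: "Polynomial.smult (meval c (pt2 t 1)) (poly (Pdk d) [:t:])
    = Polynomial.smult C (\<Prod>y\<in>fiber t. sfun_poly y d)"
  proof (rule poly_eq_complexI)
    fix k
    have "meval c (pt2 t 1) * meval P (pt5 t 1 0 d k) = C * (\<Prod>y\<in>fiber t. sfun y d k)"
      using C(2)[of d k] unfolding res_eq meval.hom_mult cpt .
    thus "poly (Polynomial.smult (meval c (pt2 t 1)) (poly (Pdk d) [:t:])) k
      = poly (Polynomial.smult C (\<Prod>y\<in>fiber t. sfun_poly y d)) k"
      unfolding eval2_Pdk[symmetric] eval2_def by (simp add: poly_prod)
  qed
  have nz: "(\<Prod>y\<in>fiber t. sfun_poly y d) \<noteq> 0" by (rule prod_sfun_poly_nonzero[OF tb])
  thus "poly (Pdk d) [:t:] \<noteq> 0" using eq C(1) by auto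
  assume d: "d \<noteq> 0"
  have reg: "sg (fst y) (snd y) \<noteq> 0" "f2 (fst y) (snd y) \<noteq> 0" if "y \<in> fiber t" for y
    using fiber_regular[OF tb, of "fst y" "snd y"] that by simp_all
  have "order k (poly (Pdk d) [:t:]) = order k (Polynomial.smult (meval c (pt2 t 1)) (poly (Pdk d) [:t:]))"
    by (rule order_smult[symmetric, OF ct])
  also have "\<dots> = order k (\<Prod>y\<in>fiber t. sfun_poly y d)"
    unfolding eq by (rule order_smult[OF C(1)])
  also have "\<dots> = (\<Sum>y\<in>fiber t. order k (sfun_poly y d))"
    by (rule order_prod[OF finite_fiber sfun_poly_nonzero[OF reg(1)]])
  also have "\<dots> = (\<Sum>y\<in>fiber t. if sfun y d k = 0 then 1 else 0)"
    by (rule sum.cong[OF refl]) (rule order_sfun_poly[OF reg d])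
  also have "\<dots> = card {y \<in> fiber t. sfun y d k = 0}"
    using finite_fiber[of t] by (simp add: sum.If_cases Int_def conj_commute)
  finally show "order k (poly (Pdk d) [:t:]) = card {y \<in> fiber t. sfun y d k = 0}" .
qed

text \<open>Outside the exceptional slopes no slice is zero, whatever d is; at each of the finitely
  many exceptional ones the slice is nonzero for all but finitely many d. So the swap applies to all
  slopes at once.\<close>

lemma generic_order_swap:
  "generic (\<lambda>d k. \<forall>t. order t (map_poly (\<lambda>c. poly c k) (Pdk d)) = order k (poly (Pdk d) [:t:]))"
proof -
  have "\<forall>\<^sub>F d in cofinite. \<forall>t\<in>exc_slopes. poly (Pdk d) [:t:] \<noteq> 0"
  proof (rule eventually_all_finite[OF finite_exc_slopes])
    fix t
    obtain d0 k0 where "meval P (pt5 t 1 0 d0 k0) \<noteq> 0" using P_nonzero_at_slope by blast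
    from eventually_meval_d_nonzero[OF this] show "\<forall>\<^sub>F d in cofinite. poly (Pdk d) [:t:] \<noteq> 0"
    proof (rule eventually_mono)
      fix d assume "meval P (pt5 t 1 0 d k0) \<noteq> 0"
      thus "poly (Pdk d) [:t:] \<noteq> 0" unfolding eval2_Pdk[symmetric] eval2_def by auto
    qed
  qed
  thus ?thesis unfolding generic_def
  proof (rule eventually_mono)
    fix d assume "\<forall>t\<in>exc_slopes. poly (Pdk d) [:t:] \<noteq> 0"
    hence *: "poly (Pdk d) [:t:] \<noteq> 0" for t using order_Pdk_slice(1)[of t d] by (cases "t \<in> exc_slopes") auto
    hence "Pdk d \<noteq> 0" using *[of 0] by auto
    from eventually_order_swap[OF this *]
    show "\<forall>\<^sub>F k in cofinite. \<forall>t. order t (map_poly (\<lambda>c. poly c k) (Pdk d)) = order k (poly (Pdk d) [:t:])" .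
  qed
qed

text \<open>The curve points that a count over good slopes could miss: those on the axis y2 = 0,
  which have no slope, and those over exceptional slopes. They are finitely many, so
  \<open>sfun\<close> is nonzero at all of them for generic k.\<close>

definition excluded_points :: "(complex \<times> complex) set" where
  "excluded_points = {y. sg (fst y) (snd y) \<noteq> 0} \<inter>
     ({(y1, y2). fv y1 y2 = 0 \<and> (\<exists>s. y1 = 0 + s * 1 \<and> y2 = 0 + s * 0)} \<union> (\<Union>t\<in>exc_slopes. fiber t))"

lemma generic_sfun_excluded: "generic (\<lambda>d k. \<forall>y\<in>excluded_points. sfun y d k \<noteq> 0)"
proof (rule generic_ball)
  have "finite {(y1, y2). fv y1 y2 = 0 \<and> (\<exists>s. y1 = 0 + s * 1 \<and> y2 = 0 + s * 0)}"
    by (rule finite_curve_inter_line) simp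
  thus "finite excluded_points"
    unfolding excluded_points_def using finite_exc_slopes finite_fiber by blast
  fix y assume "y \<in> excluded_points"
  hence "sg (fst y) (snd y) \<noteq> 0" by (simp add: excluded_points_def)
  from eventually_poly_nonzero[OF sfun_poly_nonzero[OF this]]
  show "generic (\<lambda>d k. sfun y d k \<noteq> 0)" by (intro generic_snd) simp
qed

text \<open>For generic parameters the polynomial in the slope has full degree \<open>D\<close>, and
  its roots are good slopes. Counting these with multiplicity, and trading the multiplicity in t for
  the one in k, counts the feet fiber by fiber.\<close>

theorem generic_card_line_feet_P: "generic (\<lambda>d k. card (line_feet d k) = D)"
proof -
  have gs: "generic (\<lambda>d k. \<forall>t\<in>exc_slopes. meval P (pt5 t 1 0 d k) \<noteq> 0)"
    by (rule generic_ball[OF finite_exc_slopes]) (use P_nonzero_at_slope generic_meval_nonzero in blast)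
  have gi: "generic (\<lambda>d k. meval P (pt5 1 0 0 d k) \<noteq> 0)"
    using P_nonzero_at_infinity generic_meval_nonzero by blast
  from generic_conj[OF generic_conj[OF gs gi] generic_conj[OF generic_conj[OF generic_order_swap generic_sfun_excluded]
    generic_d_nonzero]]
  show ?thesis
  proof (rule generic_mono)
    fix d k
    assume "((\<forall>t\<in>exc_slopes. meval P (pt5 t 1 0 d k) \<noteq> 0) \<and> meval P (pt5 1 0 0 d k) \<noteq> 0) \<and>
      ((\<forall>t. order t (map_poly (\<lambda>c. poly c k) (Pdk d)) = order k (poly (Pdk d) [:t:])) \<and>
       (\<forall>y\<in>excluded_points. sfun y d k \<noteq> 0)) \<and> d \<noteq> 0"
    hence gs: "\<And>t. t \<in> exc_slopes \<Longrightarrow> meval P (pt5 t 1 0 d k) \<noteq> 0" and gi: "meval P (pt5 1 0 0 d k) \<noteq> 0"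
      and swap: "\<And>t. order t (map_poly (\<lambda>c. poly c k) (Pdk d)) = order k (poly (Pdk d) [:t:])"
      and excl: "\<And>y. y \<in> excluded_points \<Longrightarrow> sfun y d k \<noteq> 0" and d0: "d \<noteq> 0" by blast+
    define u where "u = map_poly (\<lambda>c. poly c k) (Pdk d)"
    have u: "poly u t = meval P (pt5 t 1 0 d k)" for t
      by (simp add: u_def eval2_Pdk flip: eval2_map_poly)
    \<comment> \<open>The other chart of the homogeneous polynomial: y1 = 1, with the inverse slope
      as variable.\<close>
    define r where "r = (\<lambda>i::nat. if i = 0 then 1 else if i = 1 then [:0, 1:] else if i = 3 then [:d:]
      else if i = 4 then [:k:] else 0)"
    have "(\<lambda>i. poly (r i) s) = pt5 1 s 0 d k" for s by (rule ext) (simp add: r_def pt5_def)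
    hence v: "poly (curve_mev r P) s = meval P (pt5 1 s 0 d k)" for s by (simp add: poly_mev_const)
    have rev: "poly (curve_mev r P) s = s ^ D * poly u (1 / s)" if "s \<noteq> 0" for s
      using homogeneous_eval[OF P_homogeneous, of s "1 / s" 1 0 d k] that by (simp add: u v)
    have v0: "poly (curve_mev r P) 0 \<noteq> 0" using gi by (simp add: v)
    note u0 = degree_by_reversal[OF rev v0]
    let ?T = "{t. poly u t = 0}"
    have good: "t \<notin> exc_slopes" if "t \<in> ?T" for t using that gs by (auto simp: u)
    have "D = size (proots u)" using u0 by (simp add: size_proots_complex)
    also have "\<dots> = (\<Sum>t\<in>?T. order t u)"
      unfolding size_multiset_overloaded_eq using u0(1) by simp
    also have "\<dots> = (\<Sum>t\<in>?T. card {y \<in> fiber t. sfun y d k = 0})"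
    proof (rule sum.cong[OF refl])
      fix t assume "t \<in> ?T"
      thus "order t u = card {y \<in> fiber t. sfun y d k = 0}"
        unfolding u_def swap using order_Pdk_slice(2)[OF good d0] by (simp add: u_def)
    qed
    also have "\<dots> = card (\<Union>t\<in>?T. {y \<in> fiber t. sfun y d k = 0})"
    proof (rule card_UN_disjoint[symmetric])
      show "finite ?T" by (rule poly_roots_finite[OF u0(1)])
      show "\<forall>t\<in>?T. finite {y \<in> fiber t. sfun y d k = 0}" using finite_fiber by simp
      show "\<forall>t\<in>?T. \<forall>t'\<in>?T. t \<noteq> t' \<longrightarrow> {y \<in> fiber t. sfun y d k = 0} \<inter> {y \<in> fiber t'. sfun y d k = 0} = {}"
        by (auto simp: fiber_def)
    qed
    also have "(\<Union>t\<in>?T. {y \<in> fiber t. sfun y d k = 0}) = line_feet d k"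
    proof (intro equalityI subsetI)
      fix y assume "y \<in> (\<Union>t\<in>?T. {y \<in> fiber t. sfun y d k = 0})"
      then obtain t where t: "t \<in> ?T" "y \<in> fiber t" "sfun y d k = 0" by blast
      obtain y1 y2 where y: "y = (y1, y2)" by (cases y)
      have "t \<notin> bad_slopes" using good[OF t(1)] by (simp add: exc_slopes_def)
      moreover have m: "(y1, y2) \<in> fiber t" using t(2) y by simp
      ultimately have "sg y1 y2 \<noteq> 0" "f2 y1 y2 \<noteq> 0" by (rule fiber_regular)+
      moreover have "fv y1 y2 = 0"
        using m unfolding fiber_def mem_Collect_eq prod.case by (elim conjE)
      ultimately show "y \<in> line_feet d k" using t(3) by (simp add: line_feet_def y sfun_def)
    next
      fix y assume y: "y \<in> line_feet d k"
      obtain y1 y2 where y12: "y = (y1, y2)" by (cases y)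
      have l: "fv y1 y2 = 0" "f2 y1 y2 \<noteq> 0" "sg y1 y2 \<noteq> 0" and s0: "sfun y d k = 0"
        using y by (simp_all add: y12 line_feet_def sfun_def)
      have ne: "y \<notin> excluded_points" using excl s0 by blast
      have y2: "y2 \<noteq> 0"
      proof
        assume "y2 = 0"
        hence "y \<in> excluded_points" using l by (simp add: excluded_points_def y12)
        thus False using ne by blast
      qed
      define t where "t = y1 / y2"
      have fib: "y \<in> fiber t" using l y2 by (simp add: fiber_def y12 t_def)
      have ts: "t \<notin> exc_slopes"
      proof
        assume "t \<in> exc_slopes"
        hence "y \<in> excluded_points" using fib l unfolding excluded_points_def by (auto simp: y12)
        thus False using ne by blast
      qed
      have tb: "t \<notin> bad_slopes" and ct: "meval c (pt2 t 1) \<noteq> 0" using ts by (auto simp: exc_slopes_def)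
      obtain C where "meval (res_FS f) (pt5 t 1 0 d k) = C * (\<Prod>y\<in>fiber t. sfun y d k)"
        using res_FS_fiber[OF tb] by blast
      moreover have "(\<Prod>y\<in>fiber t. sfun y d k) = 0"
        using fib s0 finite_fiber by (meson prod_zero_iff)
      ultimately have "meval c (pt5 t 1 0 d k) * meval P (pt5 t 1 0 d k) = 0"
        unfolding res_eq meval.hom_mult by simp
      moreover have "meval c (pt5 t 1 0 d k) = meval c (pt2 t 1)"
        by (rule meval_cong) (use c_vars in \<open>auto simp: pt5_def pt2_def\<close>)
      ultimately have "poly u t = 0" using ct by (simp add: u)
      thus "y \<in> (\<Union>t\<in>?T. {y \<in> fiber t. sfun y d k = 0})" using fib s0 by blast
    qed
    finally show "card (line_feet d k) = D" by simp
  qed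
qed

end

theorem mainTheorem8:
  fixes f g :: mpoly
  assumes f_vars: "mvars f \<subseteq> {0, 1}"
    and f_irred: "irreducible f"
    and not_line: "\<not> (\<exists>a b c :: complex. (a, b) \<noteq> (0, 0) \<and>
          {(y1, y2). meval f (pt2 y1 y2) = 0} = {(y1, y2). a * y1 + b * y2 + c = 0})"
    and f_ndvd: "\<not> f dvd ((mpderiv 0 f)^2 + (mpderiv 1 f)^2)"
    and g_def: "is_generic_offset_eq f g"
  shows "(\<exists>P. is_PP_dk (res_FS f) P) \<and>
         (\<forall>P. is_PP_dk (res_FS f) P \<longrightarrow> mdegV {0} g = mdegV {0, 1} P)"
proof -
  interpret plane_curve f
    using f_vars f_irred not_line f_ndvd by (rule plane_curve.intro)
  interpret generic_offset_eq f g
    by (unfold_locales) (rule g_def)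
  have "mdegV {0} g = mdegV {0, 1} P" if P: "is_PP_dk (res_FS f) P" for P
  proof -
    have "\<exists>c. mvars c \<subseteq> {0, 1} \<and> c \<noteq> 0 \<and> res_FS f = c * P"
      using P unfolding is_PP_dk_def by (elim conjE)
    then obtain c where c: "mvars c \<subseteq> {0, 1}" "c \<noteq> 0" "res_FS f = c * P" by (elim exE conjE)
    have prim: "\<forall>q. q dvd P \<longrightarrow> mvars q \<subseteq> {0, 1} \<longrightarrow> mtdeg q = 0"
      using P unfolding is_PP_dk_def by (elim conjE)
    interpret primitive_part f c P
    proof unfold_locales
      show "mvars c \<subseteq> {0, 1}" "c \<noteq> 0" "res_FS f = c * P" by (rule c)+
      show "mtdeg q = 0" if "q dvd P" "mvars q \<subseteq> {0, 1}" for q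
        using prim that by (elim allE impE)
    qed
    \<comment> \<open>Both counts hold generically, hence for one common pair (d, k).\<close>
    obtain d k where "card (line_feet d k) = degree G" "card (line_feet d k) = mdegV {0, 1} P"
      using generic_ex[OF generic_conj[OF generic_card_line_feet generic_card_line_feet_P]] by blast
    thus ?thesis using degree_to_poly3[OF g_vars] by simp
  qed
  thus ?thesis using primitive_part_exists by blast
qed

end
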